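(* Let $\Omega$ be a domain in $\mathbb R^n$, $n\ge3$, and let $(f,\Gamma)$ satisfy the standing structural assumptions. If $u$ is a continuous viscosity solution of $f(\lambda(-A^u))=1$ in $\Omega$ satisfying $0<a\le u\le b<+\infty$ in $\Omega$ for some constants $a,b$, then $u$ is locally Lipschitz in $\Omega$. Furthermore, for any $\Omega'\Subset\Omega$ there is a constant $C=C(b/a,n,\Omega',\Omega)$ such that $\frac{|\nabla u|}{u}\le C$ (almost everywhere) in $\Omega'$.
   Context: Let $n\ge3$. For a positive $C^2$ function $u$, its conformal Hessian is $A^u=-\frac{2}{n-2}u^{-\frac{n+2}{n-2}}\nabla^2u+\frac{2n}{(n-2)^2}u^{-\frac{2n}{n-2}}\nabla u\otimes\nabla u-\frac{2}{(n-2)^2}u^{-\frac{2n}{n-2}}|\nabla u|^2I$, and $\lambda(-A^u)$ is the vector of eigenvalues of $-A^u$. Let $\Gamma_n=\{\mu:\mu_i>0\ \forall i\}$. Standing structural assumptions on $(f,\Gamma)$: $\Gamma\subset\mathbb R^n$ is an open symmetric cone with vertex at the origin, $\Gamma+\Gamma_n\subset\Gamma$; $f\in C^0(\bar\Gamma)$ symmetric, $f>0$ in $\Gamma$, $f=0$ on $\partial\Gamma$, $f(\lambda+\mu)\ge f(\lambda)$ for $\lambda\in\Gamma,\mu\in\Gamma_n$, $f$ homogeneous of some positive degree. Viscosity solutions: sub-solutions $u\in USC$ satisfy $f(\lambda(-A^\varphi(x_0)))\ge1$ for every $C^2$ $\varphi$ touching $u$ from above at $x_0$; super-solutions $u\in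 LSC$ satisfy either $\lambda(-A^\varphi(x_0))\notin\bar\Gamma$ or $f(\lambda(-A^\varphi(x_0)))\le1$ for every $C^2$ $\varphi$ touching from below; solutions are continuous functions that are both. *)

theory Defs
  imports "HOL-Analysis.Analysis"
begin

definition diag_mat :: "real^'n \<Rightarrow> real^'n^'n" where
  "diag_mat l = (\<chi> i j. if i = j then l $ i else 0)"

definition outer_prod :: "real^'n \<Rightarrow> real^'n^'n" where
  "outer_prod g = (\<chi> i j. g $ i * g $ j)"

text \<open>l is a vector of eigenvalues of the (symmetric) matrix M
  (orthogonal diagonalisation; the order is irrelevant since f and Gamma are symmetric).\<close>
definition is_eigvals :: "real^'n^'n \<Rightarrow> real^'n \<Rightarrow> bool" where
  "is_eigvals M l \<longleftrightarrow> (\<exists>Q. orthogonal_matrix Q \<and> M = Q ** diag_mat l ** transpose Q)"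

text \<open>Conformal Hessian A^u at a point, given the value v = u(x), gradient g and Hessian H there.\<close>
definition conf_hess :: "real \<Rightarrow> real^'n \<Rightarrow> real^'n^'n \<Rightarrow> real^'n^'n" where
  "conf_hess v g H =
    (let n = real CARD('n) in
      (- (2 / (n - 2)) * v powr (- (n + 2) / (n - 2))) *\<^sub>R H
      + ((2 * n / (n - 2)^2) * v powr (- 2 * n / (n - 2))) *\<^sub>R outer_prod g
      - ((2 / (n - 2)^2) * v powr (- 2 * n / (n - 2)) * (norm g)^2) *\<^sub>R mat 1)"

definition C2_near :: "(real^'n \<Rightarrow> real) \<Rightarrow> (real^'n \<Rightarrow> real^'n) \<Rightarrow> (real^'n \<Rightarrow> real^'n^'n)
    \<Rightarrow> real^'n \<Rightarrow> bool" where
  "C2_near phi g H x0 \<longleftrightarrow> (\<exists>r>0.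
      (\<forall>x\<in>ball x0 r. (phi has_derivative (\<lambda>h. g x \<bullet> h)) (at x)
                    \<and> (g has_derivative (\<lambda>h. H x *v h)) (at x))
      \<and> continuous_on (ball x0 r) H)"

definition touches_above :: "(real^'n \<Rightarrow> real) \<Rightarrow> (real^'n \<Rightarrow> real) \<Rightarrow> real^'n \<Rightarrow> bool" where
  "touches_above phi u x0 \<longleftrightarrow> phi x0 = u x0 \<and> (\<exists>r>0. \<forall>x\<in>ball x0 r. u x \<le> phi x)"

definition touches_below :: "(real^'n \<Rightarrow> real) \<Rightarrow> (real^'n \<Rightarrow> real) \<Rightarrow> real^'n \<Rightarrow> bool" where
  "touches_below phi u x0 \<longleftrightarrow> phi x0 = u x0 \<and> (\<exists>r>0. \<forall>x\<in>ball x0 r. phi x \<le> u x)"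

text \<open>Viscosity sub-solution inequality f(lambda(-A^phi(x0))) >= 1 (f lives on the closure of Gamma).\<close>
definition visc_sub_ineq :: "(real^'n \<Rightarrow> real) \<Rightarrow> (real^'n) set \<Rightarrow> (real^'n) set \<Rightarrow> (real^'n \<Rightarrow> real) \<Rightarrow> bool" where
  "visc_sub_ineq f \<Gamma> \<Omega> u \<longleftrightarrow>
     (\<forall>x0\<in>\<Omega>. \<forall>phi g H. C2_near phi g H x0 \<and> touches_above phi u x0 \<longrightarrow>
        (\<forall>l. is_eigvals (- conf_hess (phi x0) (g x0) (H x0)) l \<longrightarrow> l \<in> closure \<Gamma> \<and> f l \<ge> 1))"

definition visc_super_ineq :: "(real^'n \<Rightarrow> real) \<Rightarrow> (real^'n) set \<Rightarrow> (real^'n) set \<Rightarrow> (real^'n \<Rightarrow> real) \<Rightarrow> bool" where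
  "visc_super_ineq f \<Gamma> \<Omega> u \<longleftrightarrow>
     (\<forall>x0\<in>\<Omega>. \<forall>phi g H. C2_near phi g H x0 \<and> touches_below phi u x0 \<longrightarrow>
        (\<forall>l. is_eigvals (- conf_hess (phi x0) (g x0) (H x0)) l \<longrightarrow> l \<notin> closure \<Gamma> \<or> f l \<le> 1))"

definition visc_solution :: "(real^'n \<Rightarrow> real) \<Rightarrow> (real^'n) set \<Rightarrow> (real^'n) set \<Rightarrow> (real^'n \<Rightarrow> real) \<Rightarrow> bool" where
  "visc_solution f \<Gamma> \<Omega> u \<longleftrightarrow> continuous_on \<Omega> u \<and> visc_sub_ineq f \<Gamma> \<Omega> u \<and> visc_super_ineq f \<Gamma> \<Omega> u"

definition permute_vec :: "('n \<Rightarrow> 'n) \<Rightarrow> real^'n \<Rightarrow> real^'n" where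
  "permute_vec p l = (\<chi> i. l $ p i)"

definition structural :: "(real^'n \<Rightarrow> real) \<Rightarrow> (real^'n) set \<Rightarrow> bool" where
  "structural f \<Gamma> \<longleftrightarrow>
     open \<Gamma>
   \<and> (\<forall>l\<in>\<Gamma>. \<forall>t>0. t *\<^sub>R l \<in> \<Gamma>)
   \<and> (\<forall>p l. p permutes UNIV \<and> l \<in> \<Gamma> \<longrightarrow> permute_vec p l \<in> \<Gamma>)
   \<and> (\<forall>l\<in>\<Gamma>. \<forall>m. (\<forall>i. m $ i > 0) \<longrightarrow> l + m \<in> \<Gamma>)
   \<and> continuous_on (closure \<Gamma>) f
   \<and> (\<forall>p l. p permutes UNIV \<and> l \<in> closure \<Gamma> \<longrightarrow> f (permute_vec p l) = f l)
   \<and> (\<forall>l\<in>\<Gamma>. f l > 0)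
   \<and> (\<forall>l\<in>frontier \<Gamma>. f l = 0)
   \<and> (\<forall>l\<in>\<Gamma>. \<forall>m. (\<forall>i. m $ i > 0) \<longrightarrow> f (l + m) \<ge> f l)
   \<and> (\<exists>d>0. \<forall>l\<in>closure \<Gamma>. \<forall>t>0. f (t *\<^sub>R l) = t powr d * f l)"

definition locally_lipschitz_in :: "(real^'n) set \<Rightarrow> (real^'n \<Rightarrow> real) \<Rightarrow> bool" where
  "locally_lipschitz_in \<Omega> u \<longleftrightarrow> (\<forall>x\<in>\<Omega>. \<exists>r>0. \<exists>L. L-lipschitz_on (ball x r \<inter> \<Omega>) u)"

end

theory Submission
  imports Defs
begin

text \<open>Write \<open>u = exp (- \<kappa> \<psi>)\<close> with \<open>\<kappa> = (n - 2) / 2\<close>. Then \<open>- A\<^sup>u\<close> becomes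
  \<open>exp (2 \<psi>) (- D\<^sup>2 \<psi> - D \<psi> \<otimes> D \<psi> + |D \<psi>|\<^sup>2 I / 2)\<close>: adding a positive constant to \<open>\<psi>\<close> multiplies
  it by a factor larger than one, so homogeneity of \<open>f\<close> makes the equation strictly proper and
  two viscosity solutions can be compared after regularisation by sup- and inf-convolution.

  By conformal invariance the Kelvin transform \<open>\<psi>' (y) = \<psi> (y\<^sup>*) + 2 ln (|y - c| / m)\<close> in a sphere of
  centre \<open>c\<close> and radius \<open>m\<close> is again a solution. If \<open>m\<close> is small compared with the distance to the
  boundary, in terms of the oscillation of \<open>\<psi>\<close> alone, then \<open>\<psi> \<le> \<psi>'\<close> on the boundary of an annulus
  around \<open>c\<close>, hence inside it. Moving \<open>c\<close> and \<open>m\<close>, this bounds the growth of \<open>\<psi>\<close> along each ray from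
  \<open>c\<close> by that of the logarithm, which is a Lipschitz bound; Rademacher's theorem does the rest.

  Comparison needs a point near the maximum of a difference of regularised functions at which both have
  second order expansions. Jensen's argument provides a contact set of positive measure, and on that
  set Alexandrov's theorem follows from Rademacher's theorem applied to proximal maps.\<close>

section \<open>Rademacher's theorem\<close>

text \<open>The structural assumptions make \<open>f\<close> only weakly monotone, so the strictness
  in the comparison comes from the values alone: where \<open>\<psi>1 - \<psi>2\<close> is positive,
  homogeneity lifts \<open>f\<close> above 1 by a fixed amount, and this amount has to beat the
  errors of Jensen's argument. The gradients at the contact points are bounded only in terms of the
  convolution parameter, so that parameter is fixed first; compactness of the possible eigenvalue
  vectors then yields a threshold below which the error is chosen. The operator does not involve the
  point itself, hence a paraboloid touching a regularised function can be translated to the original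
  function at no cost. Adding paraboloids makes the regularisations convex. If a sum of convex
  functions is touched from above by a paraboloid, so is each summand; hence expansions are needed
  only at touching points. On the outer sphere of the annulus the Kelvin transform gains
  \<open>2 * ln (\<rho> / m)\<close>, which must exceed the oscillation \<open>\<Lambda>\<close> of
  \<open>\<psi>\<close>; on the inner sphere both functions agree. Since \<open>\<Lambda>\<close> is
  \<open>ln (b / a) / \<kappa>\<close>, the final constant sees the solution only through
  \<open>b / a\<close>.\<close>

definition outer_meas :: "'a::euclidean_space set \<Rightarrow> real" where
  "outer_meas S = Inf (measure lebesgue ` {T \<in> lmeasurable. S \<subseteq> T})"

lemma outer_meas_le:
  assumes "T \<in> lmeasurable" "S \<subseteq> T"
  shows "outer_meas S \<le> measure lebesgue T"
  unfolding outer_meas_def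
  by (rule cInf_lower) (use assms in \<open>auto intro!: bdd_belowI[of _ 0]\<close>)

text \<open>Boundedness makes the infimum run over a nonempty family; outside bounded sets
  \<open>outer_meas\<close> may be the \<open>Inf\<close> of the empty set. Openness of
  \<open>W\<close> is what lets a covering by small balls stay inside it.\<close>

lemma outer_meas_approx:
  assumes "bounded S" "e > 0"
  obtains W where "open W" "W \<in> lmeasurable" "S \<subseteq> W" "measure lebesgue W < outer_meas S + e"
proof -
  have ne: "measure lebesgue ` {T \<in> lmeasurable. S \<subseteq> T} \<noteq> {}"
    using bounded_subset_cbox_symmetric[OF assms(1)] by (metis (mono_tags, lifting) empty_iff image_eqI lmeasurable_cbox mem_Collect_eq)
  have "outer_meas S < outer_meas S + e/2" using assms by simp
  then obtain T where T: "T \<in> lmeasurable" "S \<subseteq> T" "measure lebesgue T < outer_meas S + e/2"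
    using cInf_lessD[OF ne, of "outer_meas S + e/2"] by (auto simp: outer_meas_def)
  obtain W where W: "open W" "T \<subseteq> W" "W - T \<in> lmeasurable" "emeasure lebesgue (W - T) < ennreal (e/2)"
    using sets_lebesgue_outer_open[of T "e/2"] T assms by auto
  have mW: "measure lebesgue (W - T) < e/2"
    using W(3,4) assms(2) by (simp add: emeasure_eq_measure2 ennreal_less_iff)
  have "W = T \<union> (W - T)" using W by auto
  then have "W \<in> lmeasurable" "measure lebesgue W \<le> measure lebesgue T + measure lebesgue (W - T)"
    using T W(3) by (metis fmeasurable.Un, metis measure_Un_le fmeasurableD)
  then show ?thesis using that[of W] W T mW by force
qed

lemma outer_meas_zero_imp_negligible:
  assumes "bounded S" "outer_meas S \<le> 0"
  shows "negligible S"
  unfolding negligible_outer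
  using outer_meas_approx[OF assms(1)] assms(2) by (metis add_le_same_cancel2 dual_order.strict_trans1)

text \<open>A non-measurable change-of-variables bound: no regularity of \<open>S\<close> is assumed, which spares all
  measurability arguments for the exceptional sets of Lipschitz functions.\<close>

lemma outer_meas_image_le:
  fixes \<phi> :: "'a::euclidean_space \<Rightarrow> 'b::euclidean_space"
  assumes "bounded S" "\<theta> \<ge> 0"
    and null: "\<And>N. N \<subseteq> S \<Longrightarrow> negligible N \<Longrightarrow> negligible (\<phi> ` N)"
    and small: "\<And>x r. \<lbrakk>x \<in> S; r > 0\<rbrakk> \<Longrightarrow> \<exists>c d U. 0 < d \<and> d < r \<and> x \<in> cball c d \<and>
        \<phi> ` (S \<inter> cball c d) \<subseteq> U \<and> U \<in> lmeasurable \<and> measure lebesgue U \<le> \<theta> * measure lebesgue (cball c d)"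
  shows "outer_meas (\<phi> ` S) \<le> \<theta> * outer_meas S"
proof (rule field_le_epsilon)
  fix \<epsilon> :: real assume \<epsilon>: "\<epsilon> > 0"
  let ?\<mu> = "measure lebesgue"
  define e where "e = \<epsilon> / (\<theta> + 1)"
  have e: "e > 0" "\<theta> * e \<le> \<epsilon>" using \<epsilon> assms(2) by (auto simp: e_def field_simps)
  obtain W where W: "open W" "W \<in> lmeasurable" "S \<subseteq> W" "?\<mu> W < outer_meas S + e"
    using outer_meas_approx[OF assms(1) e(1)] .
  define P where "P = (\<lambda>c d U. \<phi> ` (S \<inter> cball c d) \<subseteq> U \<and> U \<in> lmeasurable \<and> ?\<mu> U \<le> \<theta> * ?\<mu> (cball c d))"
  define K where "K = {(c,d). 0 < d \<and> cball c d \<subseteq> W \<and> (\<exists>U. P c d U)}"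
  \<comment> \<open>The balls of this covering theorem need only contain the point, not be centred
    there. The slope argument on the line relies on this: there the point is an end of the
    interval.\<close>
  obtain C where C: "countable C" "C \<subseteq> K"
     "pairwise (\<lambda>i j. disjnt (cball (fst i) (snd i)) (cball (fst j) (snd j))) C"
     "negligible(S - (\<Union>i \<in> C. cball (fst i) (snd i)))"
  proof (rule Vitali_covering_theorem_cballs[of K snd S fst])
    show "\<And>i. i \<in> K \<Longrightarrow> 0 < snd i" by (auto simp: K_def)
    fix x d assume x: "x \<in> S" and "(d::real) > 0"
    obtain k where k: "k > 0" "ball x k \<subseteq> W" using W x by (meson openE subsetD)
    obtain c s U where s: "0 < s" "s < min d (k/2)" "x \<in> cball c s" "P c s U"
      using small[OF x, of "min d (k/2)"] k \<open>d > 0\<close> unfolding P_def by auto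
    have "cball c s \<subseteq> ball x k"
    proof
      fix y assume "y \<in> cball c s"
      then have "dist x y \<le> s + s" using s(3) dist_triangle[of x y c] by (auto simp: dist_commute)
      then show "y \<in> ball x k" using s(2) by auto
    qed
    then have "(c,s) \<in> K" using s k by (auto simp: K_def)
    then show "\<exists>i. i \<in> K \<and> x \<in> cball (fst i) (snd i) \<and> snd i < d"
      using s by (intro exI[of _ "(c,s)"]) auto
  qed
  have "\<exists>U. P (fst i) (snd i) U" if "i \<in> C" for i using that C(2) by (cases i) (auto simp: K_def)
  then obtain U where U: "\<And>i. i \<in> C \<Longrightarrow> P (fst i) (snd i) (U i)" by metis
  have Um: "U i \<in> lmeasurable" if "i \<in> C" for i using U[OF that] by (simp add: P_def)
  have CW: "cball (fst i) (snd i) \<subseteq> W" if "i \<in> C" for i using that C(2) by (cases i) (auto simp: K_def)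
  \<comment> \<open>Only the source balls are disjoint. The sets \<open>U i\<close> may overlap,
    which does no harm to an upper bound; bounds for finite subfamilies control the countable
    union.\<close>
  have lee: "?\<mu> (\<Union>i\<in>I. U i) \<le> \<theta> * ?\<mu> W" if I: "I \<subseteq> C" "finite I" for I
  proof -
    have "?\<mu> (\<Union>i\<in>I. U i) \<le> (\<Sum>i\<in>I. ?\<mu> (U i))"
      using I Um by (intro measure_UNION_le) (auto simp: fmeasurableD)
    also have "\<dots> \<le> (\<Sum>i\<in>I. \<theta> * ?\<mu> (cball (fst i) (snd i)))"
      by (rule sum_mono) (use I U in \<open>auto simp: P_def\<close>)
    also have "\<dots> = \<theta> * ?\<mu> (\<Union>i\<in>I. cball (fst i) (snd i))"
      unfolding sum_distrib_left[symmetric]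
      by (subst measure_UNION') (use I C(3) in \<open>auto elim: pairwise_mono\<close>)
    also have "\<dots> \<le> \<theta> * ?\<mu> W"
      by (intro mult_left_mono assms measure_mono_fmeasurable W(2))
         (use I CW in \<open>blast, simp add: sets.finite_UN\<close>)
    finally show ?thesis .
  qed
  have UC: "\<Union>(U ` C) \<in> lmeasurable" "?\<mu> (\<Union>(U ` C)) \<le> \<theta> * ?\<mu> W"
    using Um lee assms(2)
    by (auto intro!: fmeasurable_UN_bound[OF \<open>countable C\<close>] measure_UN_bound[OF \<open>countable C\<close>])
  \<comment> \<open>The part of \<open>S\<close> missed by the covering is null, and
    \<open>null\<close> keeps its image null.\<close>
  let ?N = "\<phi> ` (S - (\<Union>i \<in> C. cball (fst i) (snd i)))"
  have N: "negligible ?N" by (intro null C(4)) auto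
  have "outer_meas (\<phi> ` S) \<le> ?\<mu> (?N \<union> \<Union>(U ` C))"
    by (rule outer_meas_le) (use N UC U in \<open>fastforce simp: P_def negligible_imp_measurable fmeasurable.Un\<close>)+
  also have "\<dots> \<le> ?\<mu> ?N + ?\<mu> (\<Union>(U ` C))"
    using N UC by (intro measure_Un_le) (auto simp: negligible_imp_sets)
  also have "\<dots> \<le> \<theta> * ?\<mu> W" using UC negligible_imp_measure0[OF N] by simp
  also have "\<dots> \<le> \<theta> * (outer_meas S + e)" using W(4) assms(2) by (intro mult_left_mono) auto
  also have "\<dots> \<le> \<theta> * outer_meas S + \<epsilon>" using e by (simp add: algebra_simps)
  finally show "outer_meas (\<phi> ` S) \<le> \<theta> * outer_meas S + \<epsilon>" .
qed

text \<open>Around each of its points, \<open>S\<close> misses a fixed fraction of arbitrarily small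
  balls. The covering bound for the identity map then gives that the outer measure is at most
  \<open>\<theta>\<close> times itself with \<open>\<theta> < 1\<close>. Cutting with
  \<open>cball 0 n\<close> keeps the outer measure finite.\<close>

lemma negligible_porous:
  fixes S :: "'a::euclidean_space set"
  assumes "c > 0" and por: "\<And>x r. \<lbrakk>x \<in> S; r > 0\<rbrakk> \<Longrightarrow> \<exists>y d. 0 < d \<and> d < r \<and>
      ball y (c*d) \<subseteq> cball x d \<and> S \<inter> ball y (c*d) = {}"
  shows "negligible S"
proof -
  let ?\<mu> = "measure lebesgue"
  have main: "negligible (S \<inter> cball 0 (real n))" for n
  proof -
    let ?T = "S \<inter> cball 0 (real n)"
    \<comment> \<open>The \<open>min\<close> keeps \<open>\<theta>\<close> nonnegative without any
      information on the size of \<open>c\<close>.\<close>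
    define \<theta> where "\<theta> = 1 - min 1 (c ^ DIM('a))"
    have th: "\<theta> \<ge> 0" "\<theta> < 1" using assms(1) by (auto simp: \<theta>_def)
    have "outer_meas (id ` ?T) \<le> \<theta> * outer_meas ?T"
    proof (rule outer_meas_image_le)
      fix x and r :: real assume x: "x \<in> ?T" "r > 0"
      obtain y d where d: "0 < d" "d < r" "ball y (c*d) \<subseteq> cball x d" "S \<inter> ball y (c*d) = {}"
        using por[of x r] x by auto
      have "?\<mu> (cball x d - ball y (c*d)) = ?\<mu> (cball x d) - ?\<mu> (ball y (c*d))"
        using d by (intro measurable_measure_Diff) auto
      also have "\<dots> = (1 - c ^ DIM('a)) * ?\<mu> (cball x d)"
        using d assms(1) by (simp add: content_ball content_cball power_mult_distrib algebra_simps)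
      also have "\<dots> \<le> \<theta> * ?\<mu> (cball x d)"
        by (intro mult_right_mono) (auto simp: \<theta>_def)
      finally show "\<exists>c d U. 0 < d \<and> d < r \<and> x \<in> cball c d \<and> id ` (?T \<inter> cball c d) \<subseteq> U \<and>
          U \<in> lmeasurable \<and> ?\<mu> U \<le> \<theta> * ?\<mu> (cball c d)"
        using d by (intro exI[of _ x] exI[of _ d] exI[of _ "cball x d - ball y (c*d)"]) (auto simp: fmeasurable.Diff)
    qed (use th in auto)
    then have "(1 - \<theta>) * outer_meas ?T \<le> 0" by (simp add: algebra_simps)
    then have "outer_meas ?T \<le> 0" using th by (simp add: mult_le_0_iff)
    then show ?thesis by (intro outer_meas_zero_imp_negligible) auto
  qed
  have eq: "S = (\<Union>n. S \<inter> cball 0 (real n))" by (auto simp: real_arch_simple)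
  have "negligible (\<Union>n. S \<inter> cball 0 (real n))"
    by (rule negligible_countable_Union) (use main in auto)
  then show ?thesis using eq by simp
qed


text \<open>Covering \<open>E\<close> by intervals of slope below \<open>p\<close> gives
  \<open>|g(E)| \<le> p |E|\<close>; covering \<open>g(E)\<close> by images of intervals of slope
  above \<open>q\<close> gives \<open>|E| \<le> |g(E)| / q\<close>. Together they force
  \<open>|E| = 0\<close>. Slopes of at least 1 make \<open>g\<close> injective with a Lipschitz
  inverse, so both coverings are legitimate.\<close>

lemma negligible_slope_gap:
  fixes g :: "real \<Rightarrow> real"
  assumes g: "\<And>x y. x < y \<Longrightarrow> y - x \<le> g y - g x \<and> g y - g x \<le> M * (y - x)"
    and pq: "0 < p" "p < q" and "bounded E"
    and lo: "\<And>x r. \<lbrakk>x \<in> E; r > 0\<rbrakk> \<Longrightarrow> \<exists>h. h \<noteq> 0 \<and> \<bar>h\<bar> < r \<and> (g (x + h) - g x) / h < p"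
    and hi: "\<And>x r. \<lbrakk>x \<in> E; r > 0\<rbrakk> \<Longrightarrow> \<exists>h. h \<noteq> 0 \<and> \<bar>h\<bar> < r \<and> (g (x + h) - g x) / h > q"
  shows "negligible E"
proof -
  \<comment> \<open>A difference quotient with an increment of either sign is the slope over an
    interval having \<open>x\<close> as an end point.\<close>
  have iv: "\<exists>a b. a < b \<and> (x = a \<or> x = b) \<and> b - a < r \<and> (g (x + h) - g x) / h = (g b - g a) / (b - a)"
    if "h \<noteq> 0" "\<bar>h\<bar> < r" for x h r
  proof (cases "h > 0")
    case True then show ?thesis using that by (intro exI[of _ x] exI[of _ "x+h"]) auto
  next
    case False then show ?thesis using that
      by (intro exI[of _ "x+h"] exI[of _ x]) (auto simp: field_simps)
  qed
  have cb: "cball ((a+b)/2) ((b-a)/2) = {a..b}" for a b :: real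
    by (auto simp: cball_eq_atLeastAtMost field_simps)
  have mono: "g x \<le> g y \<longleftrightarrow> x \<le> y" for x y
    using g[of x y] g[of y x] by (cases x y rule: linorder_cases) auto
  have gab: "\<bar>g x - g y\<bar> \<le> M * \<bar>x - y\<bar>" "\<bar>x - y\<bar> \<le> \<bar>g x - g y\<bar>" for x y
    using g[of x y] g[of y x] by (cases x y rule: linorder_cases; auto)+
  have inj: "inj g" using mono by (metis injI order_antisym order_refl)
  have M1: "M \<ge> 1" using g[of 0 1] by auto
  have m1: "outer_meas (g ` E) \<le> p * outer_meas E"
  proof (rule outer_meas_image_le)
    show "negligible (g ` N)" if "negligible N" for N
      by (rule negligible_locally_Lipschitz_image[OF _ that]) (use gab in \<open>auto intro!: exI[of _ UNIV] exI[of _ M]\<close>)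
    fix x r assume x: "x \<in> E" "(r::real) > 0"
    obtain h where h: "h \<noteq> 0" "\<bar>h\<bar> < r" "(g (x + h) - g x) / h < p" using lo[OF x] by blast
    then obtain a b where ab: "a < b" "x = a \<or> x = b" "b - a < r" "(g b - g a) / (b - a) < p" by (metis iv)
    then have "g b - g a \<le> p * (b - a)" by (auto simp: field_simps)
    then show "\<exists>c d U. 0 < d \<and> d < r \<and> x \<in> cball c d \<and> g ` (E \<inter> cball c d) \<subseteq> U \<and> U \<in> lmeasurable \<and>
        measure lebesgue U \<le> p * measure lebesgue (cball c d)"
      using ab mono[of a b]
      by (intro exI[of _ "(a+b)/2"] exI[of _ "(b-a)/2"] exI[of _ "{g a..g b}"]) (auto simp: cb mono)
  qed (use assms in auto)
  have bE: "bounded (g ` E)"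
  proof -
    obtain B where B: "\<And>x. x \<in> E \<Longrightarrow> \<bar>x\<bar> \<le> B" using \<open>bounded E\<close> by (auto simp: bounded_iff)
    have "\<bar>g x\<bar> \<le> \<bar>g 0\<bar> + M * B" if "x \<in> E" for x
    proof -
      have "M * \<bar>x - 0\<bar> \<le> M * B" using B[OF that] M1 by (intro mult_left_mono) auto
      then show ?thesis using gab(1)[of x 0] by linarith
    qed
    then show ?thesis by (auto simp: bounded_iff)
  qed
  \<comment> \<open>The second covering takes place in the image. Taking increments below
    \<open>r / M\<close> keeps the image intervals shorter than \<open>r\<close>.\<close>
  have "outer_meas (inv g ` (g ` E)) \<le> (1/q) * outer_meas (g ` E)"
  proof (rule outer_meas_image_le)
    show "negligible (inv g ` N)" if NE: "N \<subseteq> g ` E" "negligible N" for N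
    proof (rule negligible_locally_Lipschitz_image[OF _ NE(2)])
      fix y assume "y \<in> N"
      then obtain x where x: "y = g x" using NE(1) by blast
      have "norm (inv g y' - inv g y) \<le> 1 * norm (y' - y)" if y': "y' \<in> N" for y'
      proof -
        obtain x' where "y' = g x'" using y' NE(1) by blast
        then show ?thesis using x gab(2)[of x' x] inj by simp
      qed
      then show "\<exists>T B. open T \<and> y \<in> T \<and> (\<forall>y'\<in>N \<inter> T. norm (inv g y' - inv g y) \<le> B * norm (y' - y))"
        by (intro exI[of _ UNIV] exI[of _ 1]) auto
    qed simp
    fix y r assume y: "y \<in> g ` E" "(r::real) > 0"
    then obtain x where x: "x \<in> E" "y = g x" by auto
    obtain h where h: "h \<noteq> 0" "\<bar>h\<bar> < r / M" "(g (x + h) - g x) / h > q"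
      using hi[OF x(1), of "r / M"] y M1 by auto
    then obtain a b where ab: "a < b" "x = a \<or> x = b" "b - a < r / M" "(g b - g a) / (b - a) > q" by (metis iv)
    then have 1: "b - a \<le> (1/q) * (g b - g a)" using pq by (auto simp: field_simps)
    have 2: "g b - g a < r" "g a < g b" using g[OF ab(1)] ab M1 by (auto simp: field_simps)
    show "\<exists>c d U. 0 < d \<and> d < r \<and> y \<in> cball c d \<and> inv g ` (g ` E \<inter> cball c d) \<subseteq> U \<and> U \<in> lmeasurable \<and>
        measure lebesgue U \<le> (1/q) * measure lebesgue (cball c d)"
      using ab 1 2 x inj
      by (intro exI[of _ "(g a+g b)/2"] exI[of _ "(g b-g a)/2"] exI[of _ "{a..b}"]) (auto simp: cb mono)
  qed (use pq bE in auto)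
  then have "outer_meas E \<le> (1/q) * outer_meas (g ` E)" using inj by (simp add: image_comp o_def)
  then have "q * outer_meas E \<le> p * outer_meas E" using m1 pq by (simp add: field_simps)
  then have "(q - p) * outer_meas E \<le> 0" by (simp add: algebra_simps)
  then have "outer_meas E \<le> 0" using pq by (simp add: mult_le_0_iff)
  then show ?thesis using \<open>bounded E\<close> outer_meas_zero_imp_negligible by blast
qed

lemma negligible_UN_nat:
  assumes "\<And>n::nat. negligible (S n)" shows "negligible (\<Union>n. S n)"
  by (rule negligible_countable_Union) (use assms in auto)

text \<open>If the lower and upper limits of the difference quotients differ, two rationals fit
  strictly between them, and the point lies in one of countably many null sets of the preceding
  kind.\<close>

lemma lipschitz_real_ae_differentiable:
  fixes f :: "real \<Rightarrow> real"
  assumes f: "L-lipschitz_on UNIV f"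
  shows "negligible {x. \<not> (\<exists>l. ((\<lambda>h. (f (x + h) - f x) / h) \<longlongrightarrow> l) (at 0))}" (is "negligible ?N")
proof -
  \<comment> \<open>The slopes of \<open>f\<close> lie in \<open>[-L, L]\<close>; the added linear
    term moves them to \<open>[1, 2 * L + 1]\<close>.\<close>
  define g where "g = (\<lambda>x. f x + (L + 1) * x)"
  have L: "\<bar>f x - f y\<bar> \<le> L * \<bar>x - y\<bar>" for x y
    using lipschitz_onD[OF f, of x y] by (auto simp: dist_real_def)
  have g: "y - x \<le> g y - g x \<and> g y - g x \<le> (2 * L + 1) * (y - x)" if "x < y" for x y
    using L[of x y] that by (auto simp: g_def abs_if algebra_simps split: if_splits)
  define Q where "Q = (\<lambda>x h. (g (x + h) - g x) / h)"
  have Q: "1 \<le> Q x h" "Q x h \<le> 2 * L + 1" if "h \<noteq> 0" for x h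
  proof -
    show "1 \<le> Q x h" using g[of x "x+h"] g[of "x+h" x] that
      by (cases "h > 0") (auto simp: Q_def field_simps)
    show "Q x h \<le> 2 * L + 1" using g[of x "x+h"] g[of "x+h" x] that
      by (cases "h > 0") (auto simp: Q_def field_simps)
  qed
  define E where "E = (\<lambda>p q. {x. (\<forall>r>0. \<exists>h. h \<noteq> 0 \<and> \<bar>h\<bar> < r \<and> Q x h < p) \<and> (\<forall>r>0. \<exists>h. h \<noteq> 0 \<and> \<bar>h\<bar> < r \<and> Q x h > q)})"
  have negE: "negligible (E p q)" if "0 < p" "p < q" for p q
  proof -
    have "negligible (E p q \<inter> cball 0 (real n))" for n
      by (rule negligible_slope_gap[OF g that]) (auto simp: E_def Q_def)
    moreover have "E p q = (\<Union>n. E p q \<inter> cball 0 (real n))" by (auto simp: real_arch_simple)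
    ultimately show ?thesis using negligible_UN_nat[of "\<lambda>n. E p q \<inter> cball 0 (real n)"] by simp
  qed
  let ?I = "{(p,q). p \<in> \<rat> \<and> q \<in> \<rat> \<and> (0::real) < p \<and> p < q}"
  have "countable ?I" by (rule countable_subset[of _ "\<rat> \<times> \<rat>"]) (auto simp: countable_rat)
  then have neg: "negligible (\<Union>(p,q)\<in>?I. E p q)"
    by (intro negligible_countable_Union) (use negE in \<open>auto intro: countable_image\<close>)
  have "?N \<subseteq> (\<Union>(p,q)\<in>?I. E p q)"
  proof
    fix x assume x: "x \<in> ?N"
    show "x \<in> (\<Union>(p,q)\<in>?I. E p q)"
    proof (rule ccontr)
      assume nx: "x \<notin> (\<Union>(p,q)\<in>?I. E p q)"
      \<comment> \<open>The eventual lower bounds of the quotients, so that \<open>Sup A\<close> is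
        their lower limit.\<close>
      define A where "A = {c. \<exists>r>0. \<forall>h. h \<noteq> 0 \<and> \<bar>h\<bar> < r \<longrightarrow> c \<le> Q x h}"
      have A1: "1 \<in> A" using Q(1) unfolding A_def by (auto intro: exI[of _ 1])
      have bA: "bdd_above A"
      proof (rule bdd_aboveI[of _ "2*L+1"])
        fix c assume "c \<in> A"
        then obtain r where r: "r > 0" "\<And>h. h \<noteq> 0 \<and> \<bar>h\<bar> < r \<Longrightarrow> c \<le> Q x h" by (auto simp: A_def)
        show "c \<le> 2*L+1" using r(2)[of "r/2"] r(1) Q(2)[of "r/2" x] by auto
      qed
      define l where "l = Sup A"
      have l1: "l \<ge> 1" unfolding l_def by (rule cSup_upper[OF A1 bA])
      have "((\<lambda>h. Q x h) \<longlongrightarrow> l) (at 0)"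
        unfolding LIM_eq
      proof (intro allI impI)
        fix e :: real assume e: "e > 0"
        obtain c where c: "c \<in> A" "c > l - e"
          using less_cSupD[of A "l - e"] A1 e unfolding l_def by auto
        then obtain r1 where r1: "r1 > 0" "\<And>h. h \<noteq> 0 \<and> \<bar>h\<bar> < r1 \<Longrightarrow> c \<le> Q x h" by (auto simp: A_def)
        \<comment> \<open>As \<open>p\<close> exceeds the lower limit, quotients below
          \<open>p\<close> occur at every scale. Since \<open>x\<close> avoids \<open>E p q\<close>,
          quotients above \<open>q\<close> cannot, which bounds the upper limit by
          \<open>l + e\<close>.\<close>
        obtain p where p: "p \<in> \<rat>" "l < p" "p < l + e" using Rats_dense_in_real[of l "l+e"] e by auto
        obtain q where q: "q \<in> \<rat>" "p < q" "q < l + e" using Rats_dense_in_real[of p "l+e"] p by auto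
        have "p \<notin> A" using cSup_upper[OF _ bA, of p] p l_def by auto
        then have "\<forall>r>0. \<exists>h. h \<noteq> 0 \<and> \<bar>h\<bar> < r \<and> Q x h < p" by (force simp: A_def not_le)
        moreover have "x \<notin> E p q" using nx p q l1 by force
        ultimately have "\<not> (\<forall>r>0. \<exists>h. h \<noteq> 0 \<and> \<bar>h\<bar> < r \<and> Q x h > q)" unfolding E_def by blast
        then obtain r2 where r2: "r2 > 0" "\<not> (\<exists>h. h \<noteq> 0 \<and> \<bar>h\<bar> < r2 \<and> Q x h > q)" by blast
        show "\<exists>s>0. \<forall>h. h \<noteq> 0 \<and> norm (h - 0) < s \<longrightarrow> norm (Q x h - l) < e"
        proof (intro exI[of _ "min r1 r2"] conjI allI impI)
          show "0 < min r1 r2" using r1 r2 by auto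
          fix h :: real assume h: "h \<noteq> 0 \<and> norm (h - 0) < min r1 r2"
          show "norm (Q x h - l) < e" using r1(2)[of h] r2(2) h c q by force
        qed
      qed
      then have "((\<lambda>h. Q x h - (L + 1)) \<longlongrightarrow> l - (L + 1)) (at 0)" by (intro tendsto_intros)
      moreover have "eventually (\<lambda>h. Q x h - (L + 1) = (f (x + h) - f x) / h) (at 0)"
        unfolding eventually_at by (rule exI[of _ 1]) (auto simp: Q_def g_def field_simps)
      ultimately have "((\<lambda>h. (f (x + h) - f x) / h) \<longlongrightarrow> l - (L + 1)) (at 0)"
        by (rule Lim_transform_eventually)
      then show False using x by blast
    qed
  qed
  then show ?thesis using neg negligible_subset by blast
qed


section \<open>Directional derivatives almost everywhere and Rademacher's theorem\<close>

lemma cauchy_quotient_tendsto: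
  fixes q :: "real \<Rightarrow> real"
  assumes "\<And>e. e > 0 \<Longrightarrow> \<exists>d>0. \<forall>s t. 0 < \<bar>s\<bar> \<and> \<bar>s\<bar> < d \<and> 0 < \<bar>t\<bar> \<and> \<bar>t\<bar> < d \<longrightarrow> \<bar>q s - q t\<bar> \<le> e"
  shows "\<exists>l. (q \<longlongrightarrow> l) (at 0)"
proof -
  have "Cauchy (\<lambda>n. q (inverse (real (Suc n))))"
    unfolding Cauchy_def
  proof (intro allI impI)
    fix e :: real assume "e > 0"
    then obtain d where d: "d > 0" "\<And>s t. 0 < \<bar>s\<bar> \<and> \<bar>s\<bar> < d \<and> 0 < \<bar>t\<bar> \<and> \<bar>t\<bar> < d \<Longrightarrow> \<bar>q s - q t\<bar> \<le> e/2"
      using assms[of "e/2"] by auto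
    obtain n0 where n0: "inverse (real (Suc n0)) < d" using reals_Archimedean[OF d(1)] by blast
    have small: "inverse (real (Suc n)) < d" if "n \<ge> n0" for n
    proof -
      have "inverse (real (Suc n)) \<le> inverse (real (Suc n0))" using that by (intro le_imp_inverse_le) auto
      then show ?thesis using n0 by linarith
    qed
    show "\<exists>M. \<forall>m\<ge>M. \<forall>n\<ge>M. dist (q (inverse (real (Suc m)))) (q (inverse (real (Suc n)))) < e"
    proof (intro exI[of _ n0] allI impI)
      fix m n assume "m \<ge> n0" "n \<ge> n0"
      then have "\<bar>q (inverse (real (Suc m))) - q (inverse (real (Suc n)))\<bar> \<le> e/2"
        using small[of m] small[of n] by (intro d(2)) auto
      then show "dist (q (inverse (real (Suc m)))) (q (inverse (real (Suc n)))) < e"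
        using \<open>e > 0\<close> by (simp add: dist_real_def)
    qed
  qed
  then obtain l where l: "(\<lambda>n. q (inverse (real (Suc n)))) \<longlonglongrightarrow> l" using convergent_eq_Cauchy by blast
  have "(q \<longlongrightarrow> l) (at 0)" unfolding LIM_eq
  proof (intro allI impI)
    fix e :: real assume e: "e > 0"
    then obtain d where d: "d > 0" "\<And>s t. 0 < \<bar>s\<bar> \<and> \<bar>s\<bar> < d \<and> 0 < \<bar>t\<bar> \<and> \<bar>t\<bar> < d \<Longrightarrow> \<bar>q s - q t\<bar> \<le> e/2"
      using assms[of "e/2"] by auto
    have ev: "eventually (\<lambda>n. inverse (real (Suc n)) < d) sequentially"
      using LIMSEQ_inverse_real_of_nat d(1) by (rule order_tendstoD(2))
    have "\<bar>q s - l\<bar> \<le> e/2" if s: "s \<noteq> 0" "\<bar>s\<bar> < d" for s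
    proof -
      have "(\<lambda>n. \<bar>q s - q (inverse (real (Suc n)))\<bar>) \<longlonglongrightarrow> \<bar>q s - l\<bar>" by (intro tendsto_intros l)
      moreover have "eventually (\<lambda>n. \<bar>q s - q (inverse (real (Suc n)))\<bar> \<le> e/2) sequentially"
        using ev by eventually_elim (use s d(2) in auto)
      ultimately show ?thesis by (rule tendsto_upperbound) simp
    qed
    then show "\<exists>s>0. \<forall>h. h \<noteq> 0 \<and> norm (h - 0) < s \<longrightarrow> norm (q h - l) < e"
      using d(1) e by (intro exI[of _ d]) force
  qed
  then show ?thesis by blast
qed

text \<open>Lets a Cauchy condition on difference quotients be tested on rational increments only,
  which makes the set of points satisfying it Borel.\<close>

lemma real_closure_rat_nonzero:
  fixes s :: real assumes "0 < \<bar>s\<bar>" "\<bar>s\<bar> < d"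
  obtains \<sigma> where "\<And>n::nat. \<sigma> n \<in> \<rat> \<and> 0 < \<bar>\<sigma> n\<bar> \<and> \<bar>\<sigma> n\<bar> < d" "\<sigma> \<longlonglongrightarrow> s"
proof -
  define \<eta> where "\<eta> = min \<bar>s\<bar> (d - \<bar>s\<bar>)"
  have "\<eta> > 0" using assms by (auto simp: \<eta>_def)
  have "\<exists>r\<in>\<rat>. s < r \<and> r < s + \<eta> / real (Suc n)" for n
    using Rats_dense_in_real[of s "s + \<eta> / real (Suc n)"] \<open>\<eta> > 0\<close> by auto
  then obtain \<sigma> where \<sigma>: "\<And>n. \<sigma> n \<in> \<rat>" "\<And>n. s < \<sigma> n" "\<And>n. \<sigma> n < s + \<eta> / real (Suc n)" by metis
  have "\<eta> / real (Suc n) \<le> \<eta>" for n using \<open>\<eta> > 0\<close> by (simp add: field_simps)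
  then have b: "s < \<sigma> n \<and> \<sigma> n < s + \<eta>" for n using \<sigma> by (metis add_left_mono order_less_le_trans)
  have "\<sigma> \<longlonglongrightarrow> s"
  proof (rule tendsto_sandwich[of "\<lambda>_. s" \<sigma> _ "\<lambda>n. s + \<eta> * inverse (real (Suc n))"])
    have "(\<lambda>n. s + \<eta> * inverse (real (Suc n))) \<longlonglongrightarrow> s + \<eta> * 0" by (intro tendsto_intros LIMSEQ_inverse_real_of_nat)
    then show "(\<lambda>n. s + \<eta> * inverse (real (Suc n))) \<longlonglongrightarrow> s" by simp
  qed (use \<sigma> in \<open>auto simp: divide_inverse intro!: always_eventually less_imp_le\<close>)
  moreover have "\<sigma> n \<in> \<rat> \<and> 0 < \<bar>\<sigma> n\<bar> \<and> \<bar>\<sigma> n\<bar> < d" for n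
    using \<sigma>(1) b[of n] unfolding \<eta>_def by (auto simp: min_def abs_if split: if_splits)
  ultimately show ?thesis using that by blast
qed

text \<open>Translation invariance along \<open>e\<close> together with Tonelli replaces a slicing of the
  space into lines.\<close>

lemma negligible_if_lines_negligible:
  fixes e :: "'a::euclidean_space"
  assumes N: "N \<in> sets borel" and sl: "\<And>x. negligible {t. x + t *\<^sub>R e \<in> N}"
  shows "negligible N"
proof -
  \<comment> \<open>Restricting \<open>t\<close> to \<open>[0, 1]\<close> gives it total mass one,
    so that the double integral is exactly the measure of \<open>N\<close>; integrating in
    \<open>t\<close> first gives zero.\<close>
  have m: "(\<lambda>(t,x). indicator N (x + t *\<^sub>R e) * indicator {0..1} t :: ennreal) \<in> borel_measurable (lborel \<Otimes>\<^sub>M lborel)"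
    using N by measurable
  have 0: "(\<integral>\<^sup>+t. indicator N (x + t *\<^sub>R e) * indicator {0..1} t \<partial>lborel) = 0" for x
  proof -
    have "{t. x + t *\<^sub>R e \<in> N} \<in> sets borel"
    proof -
      have "(\<lambda>t::real. x + t *\<^sub>R e) -` N \<inter> space borel \<in> sets borel"
        by (rule measurable_sets[OF _ N]) measurable
      then show ?thesis by (simp add: vimage_def)
    qed
    then have "{t. x + t *\<^sub>R e \<in> N} \<in> null_sets lborel"
      using sl[of x] by (simp add: negligible_iff_null_sets null_sets_completion_iff)
    then have "AE t in lborel. indicator N (x + t *\<^sub>R e) * indicator {0..1} t = (0::ennreal)"
      by (rule AE_I') (auto simp: indicator_def)
    then have "(\<integral>\<^sup>+t. indicator N (x + t *\<^sub>R e) * indicator {0..1} t \<partial>lborel) = (\<integral>\<^sup>+(t::real). 0 \<partial>lborel)"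
      by (rule nn_integral_cong_AE)
    then show ?thesis by simp
  qed
  have tr: "(\<integral>\<^sup>+x. indicator N (x + t *\<^sub>R e) \<partial>lborel) = emeasure lborel N" for t
  proof -
    have "emeasure lborel N = (\<integral>\<^sup>+x. indicator N x \<partial>(distr lborel borel ((+) (t *\<^sub>R e))))"
      using N by (simp add: lborel_distr_plus)
    also have "\<dots> = (\<integral>\<^sup>+x. indicator N (t *\<^sub>R e + x) \<partial>lborel)"
      using N by (subst nn_integral_distr) auto
    finally show ?thesis by (simp add: add.commute)
  qed
  have "emeasure lborel N = (\<integral>\<^sup>+t. emeasure lborel N * indicator {0..1} t \<partial>(lborel::real measure))"
    by (subst nn_integral_cmult_indicator) auto
  also have "\<dots> = (\<integral>\<^sup>+t. (\<integral>\<^sup>+x. indicator N (x + t *\<^sub>R e) * indicator {0..1} t \<partial>lborel) \<partial>lborel)"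
    by (intro nn_integral_cong) (use N in \<open>simp add: nn_integral_multc tr\<close>)
  also have "\<dots> = (\<integral>\<^sup>+x. (\<integral>\<^sup>+t. indicator N (x + t *\<^sub>R e) * indicator {0..1} t \<partial>lborel) \<partial>lborel)"
    using lborel_pair.Fubini'[OF m] by simp
  also have "\<dots> = 0" by (simp add: 0)
  finally have "N \<in> null_sets lborel" using N by auto
  then show ?thesis by (simp add: negligible_iff_null_sets null_sets_completionI)
qed

text \<open>For fixed increments the Cauchy condition is closed in \<open>x\<close>, so the good set
  \<open>C\<close> is Borel. Along each line in direction \<open>e\<close> the function is Lipschitz
  in one variable, so the line meets the complement of \<open>C\<close> in a null set.\<close>

lemma lipschitz_ae_directional:
  fixes f :: "'a::euclidean_space \<Rightarrow> real" and e :: 'a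
  assumes f: "L-lipschitz_on UNIV f"
  shows "negligible {x. \<not> (\<exists>l. ((\<lambda>t. (f (x + t *\<^sub>R e) - f x) / t) \<longlongrightarrow> l) (at 0))}"
proof -
  define q where "q = (\<lambda>x t. (f (x + t *\<^sub>R e) - f x) / t)"
  have cf: "continuous_on UNIV f" using f lipschitz_on_continuous_on by blast
  have cont[continuous_intros]: "continuous_on A (\<lambda>x. f (h x))" if "continuous_on A h" for A and h :: "'c::topological_space \<Rightarrow> 'a"
    using continuous_on_compose2[OF cf that] by auto
  define I where "I = (\<lambda>m::nat. {s \<in> \<rat>. 0 < \<bar>s\<bar> \<and> \<bar>s\<bar> < inverse (real (Suc m))})"
  define C where "C = (\<Inter>k::nat. \<Union>m::nat. \<Inter>s\<in>I m. \<Inter>t\<in>I m. {x. \<bar>q x s - q x t\<bar> \<le> inverse (real (Suc k))})"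
  have cl: "closed {x. \<bar>q x s - q x t\<bar> \<le> inverse (real (Suc k))}" if "s \<in> I m" "t \<in> I m" for s t m k
    using that unfolding q_def I_def by (intro closed_Collect_le continuous_intros) auto
  have cl2: "closed (\<Inter>s\<in>I m. \<Inter>t\<in>I m. {x. \<bar>q x s - q x t\<bar> \<le> inverse (real (Suc k))})" for m k
    by (intro closed_INT ballI) (use cl in blast)
  have "C \<in> sets borel" unfolding C_def
    by (intro sets.countable_INT'' sets.countable_UN'' borel_closed cl2) auto
  then have N: "- C \<in> sets borel" by (metis borel_comp)
  have lim: "\<exists>l. (q x \<longlongrightarrow> l) (at 0)" if "x \<in> C" for x
  proof (rule cauchy_quotient_tendsto)
    fix \<epsilon> :: real assume "\<epsilon> > 0"
    then obtain k where k: "inverse (real (Suc k)) < \<epsilon>" using reals_Archimedean by blast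
    obtain m where m: "\<And>s t. s \<in> I m \<Longrightarrow> t \<in> I m \<Longrightarrow> \<bar>q x s - q x t\<bar> \<le> inverse (real (Suc k))"
    proof -
      have "x \<in> (\<Union>m. \<Inter>s\<in>I m. \<Inter>t\<in>I m. {x. \<bar>q x s - q x t\<bar> \<le> inverse (real (Suc k))})"
        using INT_D[OF \<open>x \<in> C\<close>[unfolded C_def], of k] by simp
      then show thesis using that by auto
    qed
    show "\<exists>d>0. \<forall>s t. 0 < \<bar>s\<bar> \<and> \<bar>s\<bar> < d \<and> 0 < \<bar>t\<bar> \<and> \<bar>t\<bar> < d \<longrightarrow> \<bar>q x s - q x t\<bar> \<le> \<epsilon>"
    proof (intro exI[of _ "inverse (real (Suc m))"] conjI allI impI; (elim conjE)?)
      fix s t assume s: "0 < \<bar>s\<bar>" "\<bar>s\<bar> < inverse (real (Suc m))" and t: "0 < \<bar>t\<bar>" "\<bar>t\<bar> < inverse (real (Suc m))"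
      obtain \<sigma> where \<sigma>: "\<And>n::nat. \<sigma> n \<in> \<rat> \<and> 0 < \<bar>\<sigma> n\<bar> \<and> \<bar>\<sigma> n\<bar> < inverse (real (Suc m))" "\<sigma> \<longlonglongrightarrow> s"
        using real_closure_rat_nonzero[OF s] by blast
      obtain \<tau> where \<tau>: "\<And>n::nat. \<tau> n \<in> \<rat> \<and> 0 < \<bar>\<tau> n\<bar> \<and> \<bar>\<tau> n\<bar> < inverse (real (Suc m))" "\<tau> \<longlonglongrightarrow> t"
        using real_closure_rat_nonzero[OF t] by blast
      have qc: "isCont (q x) s" if "s \<noteq> 0" for s
      proof -
        have "continuous_on (-{0}) (q x)" unfolding q_def by (intro continuous_intros) auto
        then show ?thesis using that by (simp add: continuous_on_eq_continuous_at open_Compl)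
      qed
      have "(\<lambda>n. \<bar>q x (\<sigma> n) - q x (\<tau> n)\<bar>) \<longlonglongrightarrow> \<bar>q x s - q x t\<bar>"
        using s t by (intro tendsto_intros isCont_tendsto_compose[OF qc] \<sigma> \<tau>) auto
      then have "\<bar>q x s - q x t\<bar> \<le> inverse (real (Suc k))"
        by (rule tendsto_upperbound) (use \<sigma>(1) \<tau>(1) m in \<open>auto simp: I_def\<close>)
      then show "\<bar>q x s - q x t\<bar> \<le> \<epsilon>" using k by linarith
    qed simp
  qed
  have "negligible (- C)"
  proof (rule negligible_if_lines_negligible[OF N, of e])
    fix x
    define F where "F = (\<lambda>t. f (x + t *\<^sub>R e))"
    have "(L * norm e)-lipschitz_on UNIV F"
    proof (rule lipschitz_onI)
      fix s t :: real
      have "dist (F s) (F t) \<le> L * dist (x + s *\<^sub>R e) (x + t *\<^sub>R e)" unfolding F_def using f by (rule lipschitz_onD) auto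
      also have "\<dots> = L * norm e * dist s t" by (simp add: dist_norm flip: scaleR_diff_left)
      finally show "dist (F s) (F t) \<le> L * norm e * dist s t" .
    qed (use lipschitz_on_nonneg[OF f] in auto)
    then have neg: "negligible {t. \<not> (\<exists>l. ((\<lambda>h. (F (t + h) - F t) / h) \<longlongrightarrow> l) (at 0))}" by (rule lipschitz_real_ae_differentiable)
    have "{t. x + t *\<^sub>R e \<in> - C} \<subseteq> {t. \<not> (\<exists>l. ((\<lambda>h. (F (t + h) - F t) / h) \<longlongrightarrow> l) (at 0))}"
    proof (clarify)
      fix t l assume nC: "x + t *\<^sub>R e \<notin> C" and "((\<lambda>h. (F (t + h) - F t) / h) \<longlongrightarrow> l) (at 0)"
      moreover have "(\<lambda>h. (F (t + h) - F t) / h) = q (x + t *\<^sub>R e)" by (auto simp: F_def q_def algebra_simps)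
      ultimately have l: "(q (x + t *\<^sub>R e) \<longlongrightarrow> l) (at 0)" by simp
      have "x + t *\<^sub>R e \<in> C" unfolding C_def
      proof (intro INT_I)
        fix k
        obtain d where d: "d > 0" "\<And>h. h \<noteq> 0 \<and> \<bar>h\<bar> < d \<Longrightarrow> \<bar>q (x + t *\<^sub>R e) h - l\<bar> < inverse (real (Suc k)) / 2"
          using l unfolding LIM_eq by (force dest: spec[of _ "inverse (real (Suc k)) / 2"])
        obtain m where m: "inverse (real (Suc m)) < d" using reals_Archimedean[OF d(1)] by blast
        show "x + t *\<^sub>R e \<in> (\<Union>m::nat. \<Inter>s\<in>I m. \<Inter>r\<in>I m. {x. \<bar>q x s - q x r\<bar> \<le> inverse (real (Suc k))})"
        proof (intro UN_I[of m] INT_I)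
          fix s r assume "s \<in> I m" "r \<in> I m"
          then show "x + t *\<^sub>R e \<in> {x. \<bar>q x s - q x r\<bar> \<le> inverse (real (Suc k))}"
            using d(2)[of s] d(2)[of r] m unfolding I_def by (auto simp: abs_if split: if_splits)
        qed simp
      qed
      then show False using nC by simp
    qed
    then show "negligible {t. x + t *\<^sub>R e \<in> - C}" using neg negligible_subset by blast
  qed
  then show ?thesis
    by (rule negligible_subset) (use lim in \<open>auto simp: q_def\<close>)
qed

text \<open>Going from \<open>x\<close> to \<open>x + t *\<^sub>R e\<close> and then along
  \<open>e'\<close> adds the two derivatives, provided the derivative along \<open>e'\<close> is
  controlled near the intermediate point. If additivity fails at \<open>x\<close>, no point with the
  same uniform control lies near \<open>x + t *\<^sub>R e\<close>: the exceptional set has holes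
  there and is porous.\<close>

lemma lipschitz_ae_dir_additive:
  fixes f :: "'a::euclidean_space \<Rightarrow> real" and e e' :: 'a
  assumes f: "L-lipschitz_on UNIV f"
  defines "q \<equiv> \<lambda>e x t. (f (x + t *\<^sub>R e) - f x) / t"
  shows "negligible {x. \<exists>l l' l''. (q e x \<longlongrightarrow> l) (at 0) \<and> (q e' x \<longlongrightarrow> l') (at 0) \<and>
      (q (e + e') x \<longlongrightarrow> l'') (at 0) \<and> l'' \<noteq> l + l'}" (is "negligible ?N")
proof -
  have L: "L \<ge> 0" using lipschitz_on_nonneg[OF f] .
  have fL: "\<bar>f x - f y\<bar> \<le> L * norm (x - y)" for x y
    using lipschitz_onD[OF f, of x y] by (auto simp: dist_norm)
  define B where "B = (\<lambda>(\<eta>::real) \<delta> y z. {x. \<forall>t. 0 < \<bar>t\<bar> \<and> \<bar>t\<bar> < \<delta> \<longrightarrow> \<bar>q e x t - y\<bar> \<le> \<eta> \<and> \<bar>q e' x t - z\<bar> \<le> \<eta>})"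
  define Bad where "Bad = (\<lambda>(\<eta>::real) \<delta> y z. {x \<in> B \<eta> \<delta> y z. \<exists>l. (q (e + e') x \<longlongrightarrow> l) (at 0) \<and> \<bar>l - (y + z)\<bar> > 4 * \<eta>})"
  have neg: "negligible (Bad \<eta> \<delta> y z)" if \<eta>: "\<eta> > 0" and \<delta>: "\<delta> > 0" for \<eta> \<delta> y z
  proof -
    \<comment> \<open>The radius of the hole in units of \<open>t\<close>: replacing
      \<open>x + t *\<^sub>R e\<close> by a point \<open>w\<close> of the hole changes
      \<open>f\<close> by at most \<open>\<eta>/2 * t\<close>.\<close>
    define \<kappa> where "\<kappa> = \<eta> / (2 * (L + 1))"
    have \<kappa>: "\<kappa> > 0" "2 * L * \<kappa> \<le> \<eta>" using \<eta> L by (auto simp: \<kappa>_def field_simps)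
    define c where "c = \<kappa> / (norm e + \<kappa>)"
    have ek: "norm e + \<kappa> > 0" using \<kappa>(1) norm_ge_zero[of e] by linarith
    then have c: "c > 0" using \<kappa> by (auto simp: c_def)
    show ?thesis
    proof (rule negligible_porous[OF c])
      fix x and r :: real assume x: "x \<in> Bad \<eta> \<delta> y z" and r: "r > 0"
      obtain l where l: "(q (e + e') x \<longlongrightarrow> l) (at 0)" "\<bar>l - (y + z)\<bar> > 4 * \<eta>" and xB: "x \<in> B \<eta> \<delta> y z"
        using x by (auto simp: Bad_def)
      obtain s where s: "s > 0" "\<And>t. t \<noteq> 0 \<and> \<bar>t\<bar> < s \<Longrightarrow> \<bar>q (e + e') x t - l\<bar> < \<eta>/2"
        using l(1) \<eta> unfolding LIM_eq by (metis half_gt_zero diff_zero real_norm_def)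
      define t where "t = min (s/2) (min (\<delta>/2) (r / (2 * (norm e + \<kappa>))))"
      have "t \<le> s/2" "t \<le> \<delta>/2" unfolding t_def by (rule min.cobounded1, rule min.coboundedI2, rule min.cobounded1)
      moreover have "0 < t" using s(1) \<delta> r ek by (simp add: t_def)
      ultimately have t: "0 < t" "t < s" "t < \<delta>" using s(1) \<delta> by auto
      have "t \<le> r / (2 * (norm e + \<kappa>))" by (simp add: t_def)
      then have "t * (norm e + \<kappa>) \<le> r / 2" using ek by (simp add: field_simps)
      then have tr: "t * (norm e + \<kappa>) < r" using r by linarith
      define d where "d = t * (norm e + \<kappa>)"
      have d: "0 < d" "d < r" "c * d = \<kappa> * t" using t ek tr by (auto simp: d_def c_def)
      have "ball (x + t *\<^sub>R e) (\<kappa> * t) \<subseteq> cball x d"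
      proof
        fix w assume "w \<in> ball (x + t *\<^sub>R e) (\<kappa> * t)"
        then have "norm (x + t *\<^sub>R e - w) < \<kappa> * t" by (simp add: dist_norm)
        then have "norm (x - w) \<le> \<kappa> * t + t * norm e"
          using norm_triangle_ineq4[of "x + t *\<^sub>R e - w" "t *\<^sub>R e"] t(1) by (simp add: algebra_simps)
        then show "w \<in> cball x d" by (simp add: dist_norm d_def algebra_simps)
      qed
      moreover have "Bad \<eta> \<delta> y z \<inter> ball (x + t *\<^sub>R e) (\<kappa> * t) = {}"
      proof (rule ccontr)
        assume "\<not> ?thesis"
        then obtain w where w: "w \<in> B \<eta> \<delta> y z" "norm (x + t *\<^sub>R e - w) < \<kappa> * t"
          by (auto simp: Bad_def dist_norm)
        have Lk: "L * norm (x + t *\<^sub>R e - w) \<le> (\<eta>/2) * t"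
        proof -
          have "L * norm (x + t *\<^sub>R e - w) \<le> L * (\<kappa> * t)" using w L by (intro mult_left_mono) auto
          also have "\<dots> = (L * \<kappa>) * t" by simp
          also have "\<dots> \<le> (\<eta>/2) * t" using \<kappa> t by (intro mult_right_mono) auto
          finally show ?thesis .
        qed
        have tq: "t * q a b t = f (b + t *\<^sub>R a) - f b" for a b using t by (simp add: q_def)
        have ab: "\<bar>t * u - t * v\<bar> \<le> t * k" if "\<bar>u - v\<bar> \<le> k" for u v k
          using t that by (simp add: abs_mult flip: right_diff_distrib)
        have 1: "\<bar>f (x + t *\<^sub>R e) - f x - t * y\<bar> \<le> t * \<eta>"
          using ab[of "q e x t" y \<eta>] xB t unfolding tq B_def by auto
        have 2: "\<bar>f (w + t *\<^sub>R e') - f w - t * z\<bar> \<le> t * \<eta>"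
          using ab[of "q e' w t" z \<eta>] w(1) t unfolding tq B_def by auto
        have 3: "\<bar>f (x + t *\<^sub>R (e + e')) - f x - t * l\<bar> \<le> t * (\<eta>/2)"
          using ab[of "q (e+e') x t" l "\<eta>/2"] s(2)[of t] t unfolding tq by auto
        have 4: "\<bar>f (x + t *\<^sub>R (e + e')) - f (w + t *\<^sub>R e')\<bar> \<le> (\<eta>/2) * t"
          using fL[of "x + t *\<^sub>R (e + e')" "w + t *\<^sub>R e'"] Lk by (simp add: algebra_simps)
        have 5: "\<bar>f (x + t *\<^sub>R e) - f w\<bar> \<le> (\<eta>/2) * t"
          using fL[of "x + t *\<^sub>R e" w] Lk by (simp add: algebra_simps)
        \<comment> \<open>The errors add up to \<open>7/2 * \<eta> * t\<close>, below the threshold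
          \<open>4 * \<eta> * t\<close> that defines \<open>Bad\<close>.\<close>
        have "\<bar>t * l - (t * y + t * z)\<bar> \<le> t * \<eta> + t * \<eta> + t * (\<eta>/2) + (\<eta>/2) * t + (\<eta>/2) * t"
          using 1 2 3 4 5 by linarith
        also have "\<dots> \<le> t * (4 * \<eta>)" using t \<eta> by (simp add: algebra_simps)
        finally have "t * \<bar>l - (y + z)\<bar> \<le> t * (4 * \<eta>)" using t by (simp add: abs_mult flip: right_diff_distrib distrib_left)
        then show False using l(2) t by simp
      qed
      ultimately show "\<exists>y' d. 0 < d \<and> d < r \<and> ball y' (c * d) \<subseteq> cball x d \<and> Bad \<eta> \<delta> y z \<inter> ball y' (c * d) = {}"
        using d by (intro exI[of _ "x + t *\<^sub>R e"] exI[of _ d]) simp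
    qed
  qed
  \<comment> \<open>Rational parameters suffice, and there are only countably many of them.\<close>
  let ?I = "{(\<eta>,\<delta>,y,z). \<eta> \<in> \<rat> \<and> \<delta> \<in> \<rat> \<and> y \<in> \<rat> \<and> z \<in> \<rat> \<and> (0::real) < \<eta> \<and> (0::real) < \<delta>}"
  have "countable ?I" by (rule countable_subset[of _ "\<rat> \<times> \<rat> \<times> \<rat> \<times> \<rat>"]) (auto simp: countable_rat)
  then have "negligible (\<Union>(\<eta>,\<delta>,y,z)\<in>?I. Bad \<eta> \<delta> y z)"
    by (intro negligible_countable_Union) (use neg in \<open>auto intro: countable_image\<close>)
  moreover have "?N \<subseteq> (\<Union>(\<eta>,\<delta>,y,z)\<in>?I. Bad \<eta> \<delta> y z)"
  proof clarify
    fix x l l' l'' assume l: "(q e x \<longlongrightarrow> l) (at 0)" "(q e' x \<longlongrightarrow> l') (at 0)" "(q (e + e') x \<longlongrightarrow> l'') (at 0)" "l'' \<noteq> l + l'"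
    then have "\<bar>l'' - (l + l')\<bar> > 0" by simp
    then obtain \<eta> where \<eta>: "\<eta> \<in> \<rat>" "0 < \<eta>" "\<eta> < \<bar>l'' - (l + l')\<bar> / 6"
      using Rats_dense_in_real[of 0 "\<bar>l'' - (l + l')\<bar> / 6"] by auto
    obtain y where y: "y \<in> \<rat>" "l < y" "y < l + \<eta>/2" using Rats_dense_in_real[of l "l + \<eta>/2"] \<eta> by auto
    obtain z where z: "z \<in> \<rat>" "l' < z" "z < l' + \<eta>/2" using Rats_dense_in_real[of l' "l' + \<eta>/2"] \<eta> by auto
    obtain s1 where s1: "s1 > 0" "\<And>t. t \<noteq> 0 \<and> \<bar>t\<bar> < s1 \<Longrightarrow> \<bar>q e x t - l\<bar> < \<eta>/2"
      using l(1) \<eta> unfolding LIM_eq by (metis half_gt_zero diff_zero real_norm_def)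
    obtain s2 where s2: "s2 > 0" "\<And>t. t \<noteq> 0 \<and> \<bar>t\<bar> < s2 \<Longrightarrow> \<bar>q e' x t - l'\<bar> < \<eta>/2"
      using l(2) \<eta> unfolding LIM_eq by (metis half_gt_zero diff_zero real_norm_def)
    obtain \<delta> where \<delta>: "\<delta> \<in> \<rat>" "0 < \<delta>" "\<delta> < min s1 s2" using Rats_dense_in_real[of 0 "min s1 s2"] s1 s2 by auto
    have "x \<in> B \<eta> \<delta> y z" unfolding B_def
    proof (clarify)
      fix t assume t: "0 < \<bar>t\<bar>" "\<bar>t\<bar> < \<delta>"
      show "\<bar>q e x t - y\<bar> \<le> \<eta> \<and> \<bar>q e' x t - z\<bar> \<le> \<eta>"
        using s1(2)[of t] s2(2)[of t] t \<delta> y z by (auto simp: abs_if split: if_splits)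
    qed
    moreover have "\<bar>l'' - (y + z)\<bar> > 4 * \<eta>" using \<eta> y z by (auto simp: abs_if split: if_splits)
    ultimately have "x \<in> Bad \<eta> \<delta> y z" using l(3) by (auto simp: Bad_def)
    then show "x \<in> (\<Union>(\<eta>,\<delta>,y,z)\<in>?I. Bad \<eta> \<delta> y z)"
      using \<eta> \<delta> y z by (intro UN_I[of "(\<eta>,\<delta>,y,z)"]) auto
  qed
  ultimately show ?thesis using negligible_subset by blast
qed

lemma countable_rational_vectors: "countable {v::real^'n. \<forall>i. v $ i \<in> \<rat>}"
proof -
  have "countable (PiE (UNIV::'n set) (\<lambda>_. \<rat> :: real set))" by (rule countable_PiE) (auto simp: countable_rat)
  then have "countable (vec_lambda ` PiE (UNIV::'n set) (\<lambda>_. \<rat> :: real set))" by (rule countable_image)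
  moreover have "{v::real^'n. \<forall>i. v $ i \<in> \<rat>} \<subseteq> vec_lambda ` PiE (UNIV::'n set) (\<lambda>_. \<rat>)"
    by (auto intro!: image_eqI[where x="vec_nth _"] simp: vec_nth_inverse)
  ultimately show ?thesis using countable_subset by blast
qed

lemma rational_vectors_dense:
  fixes w :: "real^'n" assumes "\<epsilon> > 0"
  obtains v where "\<And>i. v $ i \<in> \<rat>" "norm (v - w) < \<epsilon>"
proof -
  define \<eta> where "\<eta> = \<epsilon> / (2 * real CARD('n))"
  have \<eta>: "\<eta> > 0" using assms by (simp add: \<eta>_def)
  have "\<exists>r\<in>\<rat>. w $ i < r \<and> r < w $ i + \<eta>" for i using Rats_dense_in_real[of "w $ i" "w $ i + \<eta>"] \<eta> by auto
  then obtain r where r: "\<And>i. r i \<in> \<rat>" "\<And>i. w $ i < r i" "\<And>i. r i < w $ i + \<eta>" by metis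
  have "norm ((\<chi> i. r i) - w) \<le> (\<Sum>i\<in>UNIV. \<bar>((\<chi> i. r i) - w) $ i\<bar>)" by (rule norm_le_l1_cart)
  also have "\<dots> \<le> (\<Sum>i\<in>(UNIV::'n set). \<eta>)"
  proof (rule sum_mono)
    fix i show "\<bar>((\<chi> i. r i) - w) $ i\<bar> \<le> \<eta>" using r(2)[of i] r(3)[of i] by simp
  qed
  also have "\<dots> = \<epsilon> / 2" by (simp add: \<eta>_def)
  finally show ?thesis using that[of "\<chi> i. r i"] r(1) assms by simp
qed

text \<open>Off countably many null sets the derivatives along rational directions exist and are
  additive, hence given by one vector \<open>g\<close>. A finite net of rational directions on the
  unit ball and the Lipschitz bound make the convergence uniform in the direction.\<close>

theorem rademacher:
  fixes f :: "real^'n \<Rightarrow> real"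
  assumes f: "L-lipschitz_on UNIV f"
  shows "negligible {x. \<not> (\<exists>g. (f has_derivative (\<lambda>h. g \<bullet> h)) (at x))}"
proof -
  define q where "q = (\<lambda>e x t. (f (x + t *\<^sub>R e) - f x) / t)"
  have L: "L \<ge> 0" using lipschitz_on_nonneg[OF f] .
  have fL: "\<bar>f x - f y\<bar> \<le> L * norm (x - y)" for x y
    using lipschitz_onD[OF f, of x y] by (auto simp: dist_norm)
  define D where "D = {v::real^'n. \<forall>i. v $ i \<in> \<rat>}"
  have cD: "countable D" unfolding D_def by (rule countable_rational_vectors)
  define N1 where "N1 = (\<Union>e\<in>D. {x. \<not> (\<exists>l. (q e x \<longlongrightarrow> l) (at 0))})"
  define N2 where "N2 = (\<Union>(e,e')\<in>D\<times>D. {x. \<exists>l l' l''. (q e x \<longlongrightarrow> l) (at 0) \<and> (q e' x \<longlongrightarrow> l') (at 0) \<and>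
      (q (e + e') x \<longlongrightarrow> l'') (at 0) \<and> l'' \<noteq> l + l'})"
  have "negligible N1" unfolding N1_def q_def
    by (intro negligible_countable_Union) (use cD lipschitz_ae_directional[OF f] in auto)
  moreover have "negligible N2" unfolding N2_def q_def
    by (intro negligible_countable_Union) (use cD lipschitz_ae_dir_additive[OF f] in auto)
  ultimately have "negligible (N1 \<union> N2)" by (rule negligible_Un)
  moreover have "\<exists>g. (f has_derivative (\<lambda>h. g \<bullet> h)) (at x)" if x: "x \<notin> N1 \<union> N2" for x
  proof -
    have "\<exists>l. (q e x \<longlongrightarrow> l) (at 0)" if "e \<in> D" for e using x that by (auto simp: N1_def)
    then obtain l where l: "\<And>e. e \<in> D \<Longrightarrow> (q e x \<longlongrightarrow> l e) (at 0)" by metis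
    have uniq: "l e = k" if "e \<in> D" "(q e x \<longlongrightarrow> k) (at 0)" for e k
      using tendsto_unique[OF _ l[OF that(1)] that(2)] by simp
    have add: "l (e + e') = l e + l e'" if "e \<in> D" "e' \<in> D" for e e'
    proof -
      have "e + e' \<in> D" using that by (auto simp: D_def)
      then show ?thesis using x l[of e] l[of e'] l[of "e + e'"] that unfolding N2_def by blast
    qed
    have sc: "l (c *\<^sub>R e) = c * l e" if "e \<in> D" "c \<in> \<rat>" for c e
    proof -
      have cd: "c *\<^sub>R e \<in> D" using that by (auto simp: D_def)
      have "(q (c *\<^sub>R e) x \<longlongrightarrow> c * l e) (at 0)"
      proof (cases "c = 0")
        case True then show ?thesis by (simp add: q_def)
      next
        case False
        have "((\<lambda>t. q e x (c * t)) \<longlongrightarrow> l e) (at 0)"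
        proof (rule filterlim_compose[OF l[OF that(1)]])
          have "((\<lambda>t. c * t) \<longlongrightarrow> 0) (at 0)" by (rule tendsto_eq_intros | simp)+
          moreover have "\<forall>\<^sub>F t in at 0. c * t \<noteq> 0" using False by (auto simp: eventually_at intro!: exI[of _ 1])
          ultimately show "filterlim (\<lambda>t. c * t) (at 0) (at 0)" by (simp add: filterlim_at)
        qed
        then have "((\<lambda>t. c * q e x (c * t)) \<longlongrightarrow> c * l e) (at 0)" by (rule tendsto_mult_left)
        moreover have "(\<lambda>t. c * q e x (c * t)) = q (c *\<^sub>R e) x" using False by (auto simp: q_def mult.commute)
        ultimately show ?thesis by simp
      qed
      then show ?thesis using uniq[OF cd] by simp
    qed
    define g where "g = (\<chi> i. l (axis i 1))"
    have ax: "axis i 1 \<in> D" for i by (auto simp: D_def axis_def)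
    have lin: "l e = g \<bullet> e" if e: "e \<in> D" for e
    proof -
      \<comment> \<open>Additivity is available only for pairs of rational directions, so
        coordinates are added one at a time, with all partial sums in \<open>D\<close>.\<close>
      have "(\<Sum>i\<in>A. (e $ i) *\<^sub>R axis i 1) \<in> D \<and> l (\<Sum>i\<in>A. (e $ i) *\<^sub>R axis i 1) = (\<Sum>i\<in>A. e $ i * g $ i)" if "finite A" for A :: "'n set"
        using that
      proof (induction A rule: finite_induct)
        case empty
        have "(0::real^'n) \<in> D" by (auto simp: D_def)
        then show ?case using sc[of 0 0] by simp
      next
        case (insert i A)
        have "(e $ i) *\<^sub>R axis i 1 \<in> D" using e by (auto simp: D_def axis_def)
        moreover have "l ((e $ i) *\<^sub>R axis i 1) = e $ i * g $ i" using sc[OF ax, of "e $ i" i] e by (auto simp: D_def g_def)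
        ultimately show ?case using insert add[of "(e $ i) *\<^sub>R axis i 1" "\<Sum>i\<in>A. (e $ i) *\<^sub>R axis i 1"]
          by (auto simp: D_def)
      qed
      from this[of UNIV] have "l (\<Sum>i\<in>UNIV. (e $ i) *\<^sub>R axis i 1) = (\<Sum>i\<in>UNIV. e $ i * g $ i)" by simp
      moreover have "(\<Sum>i\<in>UNIV. (e $ i) *\<^sub>R axis i 1) = e" using basis_expansion[of e] by (simp add: scalar_mult_eq_scaleR)
      ultimately show ?thesis by (simp add: inner_vec_def mult.commute)
    qed
    have "(f has_derivative (\<lambda>h. g \<bullet> h)) (at x)"
      unfolding has_derivative_at_alt
    proof (intro conjI allI impI)
      fix \<epsilon>0 :: real assume e0: "\<epsilon>0 > 0"
      \<comment> \<open>The three terms of the divisor pay for the expansion along a direction of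
        the net, the change of \<open>f\<close> and the change of \<open>g \<bullet> h\<close> when
        the true direction is replaced by that one.\<close>
      define \<epsilon> where "\<epsilon> = \<epsilon>0 / (1 + L + norm g)"
      have Lg: "1 + L + norm g > 0" using L norm_ge_zero[of g] by linarith
      have \<epsilon>: "\<epsilon> > 0" "\<epsilon> * (1 + L + norm g) = \<epsilon>0" using e0 Lg by (auto simp: \<epsilon>_def)
      have "cball 0 1 \<subseteq> (\<Union>e\<in>D. ball e \<epsilon>)"
      proof
        fix w :: "real^'n"
        obtain v where "\<And>i. v $ i \<in> \<rat>" "norm (v - w) < \<epsilon>" using rational_vectors_dense[OF \<epsilon>(1)] by blast
        then show "w \<in> (\<Union>e\<in>D. ball e \<epsilon>)" by (auto simp: D_def dist_norm)
      qed
      then obtain D0 where D0: "D0 \<subseteq> D" "finite D0" "cball 0 1 \<subseteq> (\<Union>e\<in>D0. ball e \<epsilon>)"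
        using compactE_image[OF compact_cball, of D "\<lambda>e. ball e \<epsilon>" 0 1] by auto
      have "\<exists>d>0. \<forall>t. 0 < t \<and> t < d \<longrightarrow> \<bar>f (x + t *\<^sub>R e) - f x - t * (g \<bullet> e)\<bar> \<le> \<epsilon> * t" if eD: "e \<in> D" for e
      proof -
        obtain d where d: "d > 0" "\<And>t. t \<noteq> 0 \<and> \<bar>t\<bar> < d \<Longrightarrow> \<bar>q e x t - g \<bullet> e\<bar> < \<epsilon>"
          using l[OF eD] \<epsilon> unfolding LIM_eq lin[OF eD] by (metis diff_zero real_norm_def)
        have "\<bar>f (x + t *\<^sub>R e) - f x - t * (g \<bullet> e)\<bar> \<le> \<epsilon> * t" if "0 < t" "t < d" for t
        proof -
          have "f (x + t *\<^sub>R e) - f x - t * (g \<bullet> e) = t * (q e x t - g \<bullet> e)" using that by (simp add: q_def field_simps)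
          then show ?thesis using d(2)[of t] that by (simp add: abs_mult)
        qed
        then show ?thesis using d(1) by blast
      qed
      then obtain \<delta> where \<delta>: "\<And>e. e \<in> D \<Longrightarrow> \<delta> e > 0" "\<And>e t. e \<in> D \<Longrightarrow> 0 < t \<Longrightarrow> t < \<delta> e \<Longrightarrow> \<bar>f (x + t *\<^sub>R e) - f x - t * (g \<bullet> e)\<bar> \<le> \<epsilon> * t"
        by metis
      define d where "d = Min (insert 1 (\<delta> ` D0))"
      have d: "d > 0" "\<And>e. e \<in> D0 \<Longrightarrow> d \<le> \<delta> e" using D0 \<delta>(1) by (auto simp: d_def)
      have "norm (f y - f x - g \<bullet> (y - x)) \<le> \<epsilon>0 * norm (y - x)" if y: "norm (y - x) < d" for y
      proof (cases "y = x")
        case False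
        define t where "t = norm (y - x)"
        define w where "w = (y - x) /\<^sub>R t"
        have t: "t > 0" "t < d" using False y by (auto simp: t_def)
        have w: "y = x + t *\<^sub>R w" "norm w = 1" using t by (auto simp: w_def t_def)
        then obtain e where e: "e \<in> D0" "norm (e - w) < \<epsilon>" using D0(3) by (force simp: dist_norm)
        have 1: "\<bar>f (x + t *\<^sub>R e) - f x - t * (g \<bullet> e)\<bar> \<le> \<epsilon> * t" using \<delta>(2)[of e t] e D0 d(2)[of e] t by force
        have 2: "\<bar>f y - f (x + t *\<^sub>R e)\<bar> \<le> L * (\<epsilon> * t)"
        proof -
          have "\<bar>f y - f (x + t *\<^sub>R e)\<bar> \<le> L * norm (t *\<^sub>R (w - e))"
            using fL[of y "x + t *\<^sub>R e"] by (simp add: w algebra_simps)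
          also have "\<dots> \<le> L * (\<epsilon> * t)" using t e L by (intro mult_left_mono) (auto simp: norm_minus_commute)
          finally show ?thesis .
        qed
        have 3: "\<bar>t * (g \<bullet> e) - g \<bullet> (y - x)\<bar> \<le> norm g * (\<epsilon> * t)"
        proof -
          have "t * (g \<bullet> e) - g \<bullet> (y - x) = g \<bullet> (t *\<^sub>R (e - w))" by (simp add: w inner_diff_right algebra_simps)
          also have "\<bar>\<dots>\<bar> \<le> norm g * norm (t *\<^sub>R (e - w))" by (rule Cauchy_Schwarz_ineq2)
          also have "\<dots> \<le> norm g * (\<epsilon> * t)" using t e by (intro mult_left_mono) auto
          finally show ?thesis .
        qed
        have "\<bar>f y - f x - g \<bullet> (y - x)\<bar> \<le> \<epsilon> * t + L * (\<epsilon> * t) + norm g * (\<epsilon> * t)" using 1 2 3 by linarith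
        also have "\<dots> = \<epsilon>0 * t" unfolding \<epsilon>(2)[symmetric] by (simp add: algebra_simps)
        finally show ?thesis by (simp add: t_def)
      qed simp
      then show "\<exists>d>0. \<forall>y. norm (y - x) < d \<longrightarrow> norm (f y - f x - g \<bullet> (y - x)) \<le> \<epsilon>0 * norm (y - x)"
        using d(1) by blast
    qed (rule bounded_linear_inner_right)
    then show ?thesis by blast
  qed
  ultimately show ?thesis by (blast intro: negligible_subset)
qed

section \<open>Symmetric matrices\<close>

lemma minus_matrix_vector_mult: "- X *v h = - (X *v h)" for X :: "real^'n^'m"
  by (simp add: matrix_vector_mult_def vec_eq_iff sum_negf)

lemma outer_prod_vec: "outer_prod p *v v = (p \<bullet> v) *\<^sub>R p"
  by (simp add: outer_prod_def matrix_vector_mult_def vec_eq_iff inner_vec_def sum_distrib_left sum_distrib_right algebra_simps)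

lemma symmetric_inner: "transpose M = M \<Longrightarrow> x \<bullet> (M *v y) = (M *v x) \<bullet> (y::real^'n)"
  by (metis dot_lmul_matrix transpose_matrix_vector)

text \<open>A maximiser \<open>v\<close> of the Rayleigh quotient on the unit sphere of
  \<open>V\<close> is an eigenvector: the residual \<open>w = M *v v - \<mu> *\<^sub>R v\<close>
  lies in \<open>V\<close> and is orthogonal to \<open>v\<close>, and perturbing \<open>v\<close>
  along \<open>w\<close> would raise the quotient to first order.\<close>

lemma symmetric_eigenvector:
  fixes M :: "real^'n^'n"
  assumes M: "transpose M = M" and V: "subspace V" "V \<noteq> {0}" and inv: "\<And>x. x \<in> V \<Longrightarrow> M *v x \<in> V"
  obtains v \<mu> where "v \<in> V" "norm v = 1" "M *v v = \<mu> *\<^sub>R v"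
proof -
  obtain y where y: "y \<in> V" "y \<noteq> 0" using V subspace_0 by blast
  define K where "K = V \<inter> sphere 0 1"
  have "(1 / norm y) *\<^sub>R y \<in> K" using y V by (auto simp: K_def subspace_mul)
  then have "K \<noteq> {}" by blast
  moreover have "compact K" unfolding K_def by (intro closed_Int_compact closed_subspace V compact_sphere)
  moreover have "continuous_on K (\<lambda>x. x \<bullet> (M *v x))" by (intro continuous_intros)
  ultimately obtain v where v: "v \<in> K" "\<And>x. x \<in> K \<Longrightarrow> x \<bullet> (M *v x) \<le> v \<bullet> (M *v v)"
    using continuous_attains_sup[of K "\<lambda>x. x \<bullet> (M *v x)"] by blast
  define \<mu> where "\<mu> = v \<bullet> (M *v v)"
  have vV: "v \<in> V" "norm v = 1" using v by (auto simp: K_def)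
  have hom: "x \<bullet> (M *v x) \<le> \<mu> * (norm x)\<^sup>2" if "x \<in> V" for x
  proof (cases "x = 0")
    case False
    have "(1 / norm x) *\<^sub>R x \<in> K" using that False V by (auto simp: K_def subspace_mul)
    from v(2)[OF this] show ?thesis using False by (simp add: \<mu>_def matrix_vector_mult_scaleR power2_eq_square field_simps)
  qed simp
  define w where "w = M *v v - \<mu> *\<^sub>R v"
  have wV: "w \<in> V" unfolding w_def using V vV inv by (intro subspace_diff subspace_mul) auto
  have vv: "v \<bullet> v = 1" using vV by (simp add: dot_square_norm)
  have "w \<bullet> v = (M *v v) \<bullet> v - \<mu> * (v \<bullet> v)" by (simp add: w_def inner_diff_left)
  then have wv: "w \<bullet> v = 0" using vv \<mu>_def inner_commute[of v "M *v v"] by simp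
  have ww: "w \<bullet> (M *v v) = (norm w)\<^sup>2"
    by (simp add: power2_norm_eq_inner) (simp add: w_def inner_diff_left inner_diff_right vv \<mu>_def inner_commute)
  have key: "2 * t * (norm w)\<^sup>2 \<le> t\<^sup>2 * (\<mu> * (norm w)\<^sup>2 - w \<bullet> (M *v w))" for t
  proof -
    have "v + t *\<^sub>R w \<in> V" using V vV wV by (intro subspace_add subspace_mul) auto
    from hom[OF this] have "(v + t *\<^sub>R w) \<bullet> (M *v (v + t *\<^sub>R w)) \<le> \<mu> * ((v + t *\<^sub>R w) \<bullet> (v + t *\<^sub>R w))" by (simp add: power2_norm_eq_inner)
    moreover have "(v + t *\<^sub>R w) \<bullet> (v + t *\<^sub>R w) = 1 + t\<^sup>2 * (norm w)\<^sup>2"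
      unfolding power2_norm_eq_inner using wv by (simp add: inner_add_left inner_add_right vv inner_commute power2_eq_square)
    moreover have "v \<bullet> (M *v w) = (norm w)\<^sup>2" using symmetric_inner[OF M, of v w] ww by (simp add: inner_commute)
    moreover have "(v + t *\<^sub>R w) \<bullet> (M *v (v + t *\<^sub>R w)) = \<mu> + t * (w \<bullet> (M *v v)) + t * (v \<bullet> (M *v w)) + t\<^sup>2 * (w \<bullet> (M *v w))"
      by (simp add: matrix_vector_right_distrib matrix_vector_mult_scaleR inner_add_left inner_add_right \<mu>_def power2_eq_square algebra_simps)
    ultimately have "\<mu> + t * (norm w)\<^sup>2 + t * (norm w)\<^sup>2 + t\<^sup>2 * (w \<bullet> (M *v w)) \<le> \<mu> * (1 + t\<^sup>2 * (norm w)\<^sup>2)"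
      using ww by simp
    then show ?thesis by (simp add: algebra_simps)
  qed
  have "w = 0"
  proof (rule ccontr)
    assume "w \<noteq> 0"
    then have n: "(norm w)\<^sup>2 > 0" by simp
    \<comment> \<open>With this \<open>c\<close> and \<open>t\<close> the quadratic term is at most
      \<open>t * (norm w)\<^sup>2\<close>, half of the first order gain.\<close>
    define c where "c = \<bar>\<mu> * (norm w)\<^sup>2 - w \<bullet> (M *v w)\<bar> + 1"
    define t where "t = (norm w)\<^sup>2 / c"
    have c: "c > 0" "\<mu> * (norm w)\<^sup>2 - w \<bullet> (M *v w) \<le> c" by (auto simp: c_def)
    have t: "t > 0" using n c by (simp add: t_def)
    have "2 * t * (norm w)\<^sup>2 \<le> t\<^sup>2 * c" using key[of t] c(2) by (smt (verit) mult_left_mono zero_le_power2)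
    also have "\<dots> = t * (norm w)\<^sup>2" using c by (simp add: t_def power2_eq_square)
    finally show False using t n by simp
  qed
  then show ?thesis using that[of v \<mu>] vV by (simp add: w_def)
qed

text \<open>Induction on the dimension: by symmetry the part of \<open>V\<close> orthogonal to an
  eigenvector is again invariant.\<close>

lemma symmetric_orthonormal_eigenbasis:
  fixes M :: "real^'n^'n"
  assumes M: "transpose M = M"
  shows "subspace V \<Longrightarrow> (\<And>x. x \<in> V \<Longrightarrow> M *v x \<in> V) \<Longrightarrow>
    \<exists>B. B \<subseteq> V \<and> pairwise orthogonal B \<and> (\<forall>b\<in>B. norm b = 1 \<and> (\<exists>c. M *v b = c *\<^sub>R b)) \<and> span B = V"
proof (induction "dim V" arbitrary: V rule: less_induct)
  case less
  show ?case
  proof (cases "V = {0}")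
    case True then show ?thesis by (intro exI[of _ "{}"]) auto
  next
    case False
    obtain v \<mu> where v: "v \<in> V" "norm v = 1" "M *v v = \<mu> *\<^sub>R v"
      using symmetric_eigenvector[OF M less.prems(1) False less.prems(2)] by blast
    have vv: "v \<bullet> v = 1" using v by (simp add: dot_square_norm)
    define W where "W = {w \<in> V. w \<bullet> v = 0}"
    have W: "subspace W" using less.prems(1) unfolding W_def subspace_def by (auto simp: inner_add_left)
    have MW: "M *v x \<in> W" if "x \<in> W" for x
      using that less.prems(2) symmetric_inner[OF M, of x v] v by (auto simp: W_def)
    have "v \<notin> W" using vv by (simp add: W_def)
    moreover have "W \<subseteq> V" by (auto simp: W_def)
    ultimately have "W \<subset> V" using v(1) by blast
    then have "dim W < dim V" using W less.prems(1) by (metis dim_psubset span_eq_iff)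
    from less.hyps[OF this W MW] obtain B where B: "B \<subseteq> W" "pairwise orthogonal B"
      "\<forall>b\<in>B. norm b = 1 \<and> (\<exists>c. M *v b = c *\<^sub>R b)" "span B = W" by blast
    show ?thesis
    proof (intro exI[of _ "insert v B"] conjI)
      show "insert v B \<subseteq> V" using B v by (auto simp: W_def)
      show "pairwise orthogonal (insert v B)"
        using B(1,2) by (auto simp: pairwise_insert orthogonal_def W_def inner_commute)
      show "\<forall>b\<in>insert v B. norm b = 1 \<and> (\<exists>c. M *v b = c *\<^sub>R b)" using B v by auto
      show "span (insert v B) = V"
      proof
        show "span (insert v B) \<subseteq> V" using B v less.prems(1) by (intro span_minimal) (auto simp: W_def)
        show "V \<subseteq> span (insert v B)"
        proof
          fix x assume x: "x \<in> V"
          have "x - (x \<bullet> v) *\<^sub>R v \<in> W" using x v less.prems(1) vv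
            by (auto simp: W_def inner_diff_left intro!: subspace_diff subspace_mul)
          then have "x - (x \<bullet> v) *\<^sub>R v \<in> span B" using B by simp
          then show "x \<in> span (insert v B)" unfolding span_insert by blast
        qed
      qed
    qed
  qed
qed

text \<open>The viscosity inequalities quantify over all eigenvalue vectors of a matrix; existence
  of one is what gives them content at a test function.\<close>

lemma is_eigvals_exists:
  fixes M :: "real^'n^'n"
  assumes M: "transpose M = M"
  shows "\<exists>l. is_eigvals M l"
proof -
  obtain B where B: "pairwise orthogonal B" "\<forall>b\<in>B. norm b = 1 \<and> (\<exists>c. M *v b = c *\<^sub>R b)" "span B = UNIV"
    using symmetric_orthonormal_eigenbasis[OF M, of UNIV] by auto
  have "independent B" using B by (intro pairwise_orthogonal_independent) auto
  then have cB: "card B = CARD('n)" "finite B" using B(3)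
    by (metis dim_span_eq_card_independent dim_UNIV DIM_cart DIM_real mult.right_neutral, metis independent_bound)
  then obtain q where q: "bij_betw q (UNIV::'n set) B" using finite_same_card_bij[of "UNIV::'n set" B] by auto
  have qB: "q j \<in> B" for j using q by (auto simp: bij_betw_def)
  have qn: "q i \<noteq> q j" if "i \<noteq> j" for i j using q that by (auto simp: bij_betw_def inj_on_def)
  have "\<forall>j. \<exists>c. M *v q j = c *\<^sub>R q j" using B(2) qB by blast
  then obtain l where l: "\<And>j. M *v q j = l j *\<^sub>R q j" by metis
  define Q where "Q = (\<chi> i j. q j $ i)"
  have col: "column j Q = q j" for j by (simp add: column_def Q_def vec_eq_iff)
  have oQ: "orthogonal_matrix Q" unfolding orthogonal_matrix_orthonormal_columns col
    using B(1,2) qB qn by (auto simp: pairwise_def)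
  have "M ** Q = Q ** diag_mat (\<chi> j. l j)"
  proof -
    have "(M ** Q) $ i $ j = (Q ** diag_mat (\<chi> j. l j)) $ i $ j" for i j
    proof -
      have "(M ** Q) $ i $ j = (M *v q j) $ i" by (simp add: matrix_matrix_mult_def matrix_vector_mult_def Q_def)
      also have "\<dots> = l j * Q $ i $ j" by (simp add: l Q_def)
      also have "\<dots> = (Q ** diag_mat (\<chi> j. l j)) $ i $ j"
        by (simp add: matrix_matrix_mult_def diag_mat_def if_distrib[of "\<lambda>x. _ * x"] mult.commute cong: if_cong)
      finally show ?thesis .
    qed
    then show ?thesis by (simp add: vec_eq_iff)
  qed
  then have "M ** Q ** transpose Q = Q ** diag_mat (\<chi> j. l j) ** transpose Q" by simp
  then have "M = Q ** diag_mat (\<chi> j. l j) ** transpose Q" using oQ by (simp add: orthogonal_matrix_def matrix_mul_assoc[symmetric])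
  then show ?thesis using oQ by (auto simp: is_eigvals_def)
qed

section \<open>Bounds and monotonicity of eigenvalues\<close>

lemma eigvals_quadratic_form:
  assumes "orthogonal_matrix Q" "M = Q ** diag_mat l ** transpose Q"
  shows "(Q *v x) \<bullet> (M *v (Q *v x)) = (\<Sum>i\<in>UNIV. l $ i * (x $ i)\<^sup>2)"
proof -
  have "transpose Q *v (Q *v x) = x" using assms(1) by (simp add: orthogonal_matrix_def matrix_vector_mul_assoc)
  then have "M *v (Q *v x) = Q *v (diag_mat l *v x)" unfolding assms(2) by (simp add: matrix_vector_mul_assoc[symmetric])
  then have "(Q *v x) \<bullet> (M *v (Q *v x)) = x \<bullet> (diag_mat l *v x)"
    using assms(1) orthogonal_transformation_matrix[of "(*v) Q"] by (simp add: orthogonal_transformation_def)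
  also have "diag_mat l *v x = (\<chi> i. l $ i * x $ i)"
    by (simp add: matrix_vector_mult_def diag_mat_def vec_eq_iff if_distrib[of "\<lambda>x. x * _"] cong: if_cong)
  finally show ?thesis by (simp add: inner_vec_def power2_eq_square algebra_simps)
qed

lemma orthogonal_matrix_norm: "orthogonal_matrix Q \<Longrightarrow> norm (Q *v x) = norm (x::real^'n)"
  using orthogonal_transformation_matrix[of "(*v) Q"] by (simp add: orthogonal_transformation_norm)

lemma eigval_bounds:
  fixes M :: "real^'n^'n"
  assumes "is_eigvals M l" "\<And>v. \<bar>v \<bullet> (M *v v)\<bar> \<le> C * (norm v)\<^sup>2"
  shows "\<bar>l $ i\<bar> \<le> C"
proof -
  obtain Q where Q: "orthogonal_matrix Q" "M = Q ** diag_mat l ** transpose Q" using assms(1) by (auto simp: is_eigvals_def)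
  have "(\<Sum>j\<in>UNIV. l $ j * ((axis i 1 :: real^'n) $ j)\<^sup>2) = l $ i"
    by (simp add: axis_def if_distrib[of "\<lambda>x. x^2"] if_distrib[of "\<lambda>x. _ * x"] cong: if_cong)
  then show ?thesis using assms(2)[of "Q *v axis i 1"] eigvals_quadratic_form[OF Q, of "axis i 1"] orthogonal_matrix_norm[OF Q(1), of "axis i 1"] by simp
qed

text \<open>Greedy matching of the largest value with the largest. Threshold counts take the place
  of sorted lists, which suits eigenvalue vectors known only up to order.\<close>

lemma bij_dominating:
  fixes a :: "'a \<Rightarrow> real" and b :: "'b \<Rightarrow> real"
  assumes "finite S" "finite T" "card S = card T"
    and "\<And>t. card {i \<in> S. b i \<ge> t} \<le> card {j \<in> T. a j \<ge> t}"
  shows "\<exists>f. bij_betw f S T \<and> (\<forall>i\<in>S. b i \<le> a (f i))"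
  using assms
proof (induction "card S" arbitrary: S T)
  case 0
  then show ?case by (auto simp: bij_betw_def)
next
  case (Suc n)
  have ne: "S \<noteq> {}" "T \<noteq> {}" using Suc by auto
  obtain i where i: "i \<in> S" "\<And>k. k \<in> S \<Longrightarrow> b k \<le> b i"
    using Max_in[of "b ` S"] Max_ge[of "b ` S"] Suc.prems(1) ne by (metis (no_types, lifting) finite_imageI image_iff image_is_empty)
  obtain j where j: "j \<in> T" "\<And>k. k \<in> T \<Longrightarrow> a k \<le> a j"
    using Max_in[of "a ` T"] Max_ge[of "a ` T"] Suc.prems(2) ne by (metis (no_types, lifting) finite_imageI image_iff image_is_empty)
  have "i \<in> {k \<in> S. b k \<ge> b i}" using i by auto
  then have "card {k \<in> S. b k \<ge> b i} > 0" using Suc.prems(1) by (auto simp: card_gt_0_iff)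
  then have "card {k \<in> T. a k \<ge> b i} > 0" using Suc.prems(4)[of "b i"] by linarith
  then obtain k where "k \<in> T" "a k \<ge> b i" by (auto simp: card_gt_0_iff)
  then have ij: "b i \<le> a j" using j(2)[of k] by linarith
  \<comment> \<open>Removing the two maxima lowers both counts by one when
    \<open>t \<le> b i\<close>; for larger \<open>t\<close> the left count is zero.\<close>
  have "card {k \<in> S - {i}. b k \<ge> t} \<le> card {k \<in> T - {j}. a k \<ge> t}" for t
  proof (cases "b i \<ge> t")
    case True
    have "{k \<in> S - {i}. b k \<ge> t} = {k \<in> S. b k \<ge> t} - {i}" "{k \<in> T - {j}. a k \<ge> t} = {k \<in> T. a k \<ge> t} - {j}" by auto
    then show ?thesis using Suc.prems(4)[of t] True ij i j by (simp add: card_Diff_singleton_if)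
  next
    case False
    then have "{k \<in> S - {i}. b k \<ge> t} = {}" using i(2) by force
    then show ?thesis by (metis card.empty zero_le)
  qed
  then obtain f where f: "bij_betw f (S - {i}) (T - {j})" "\<forall>k\<in>S - {i}. b k \<le> a (f k)"
    using Suc.hyps(1)[of "S - {i}" "T - {j}"] Suc.hyps(2) Suc.prems(1-3) i j by force
  have "bij_betw (f(i := j)) S T"
  proof -
    have "bij_betw (f(i := j)) (S - {i}) (T - {j})" using f(1) by (subst bij_betw_cong[where g=f]) auto
    then have "bij_betw (f(i := j)) (insert i (S - {i})) (insert j (T - {j}))"
      by (auto simp: bij_betw_def inj_on_def)
    then show ?thesis using i j by (simp add: insert_absorb)
  qed
  then show ?case using f(2) ij by (intro exI[of _ "f(i := j)"]) auto
qed

text \<open>Fix \<open>t\<close>. On the span of the eigenvectors of \<open>B\<close> with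
  eigenvalue at least \<open>t\<close> the form of \<open>B\<close> is at least
  \<open>t * (norm v)\<^sup>2\<close>; on the span of those of \<open>A\<close> with eigenvalue
  below \<open>t\<close> the form of \<open>A\<close> is smaller than this for
  \<open>v \<noteq> 0\<close>. So the spans meet only in 0, and their dimensions give the counts
  needed by \<open>bij_dominating\<close>.\<close>

lemma eigvals_mono:
  fixes A B :: "real^'n^'n"
  assumes a: "is_eigvals A a" and b: "is_eigvals B b" and le: "\<And>v. v \<bullet> (B *v v) \<le> v \<bullet> (A *v v)"
  shows "\<exists>p. p permutes UNIV \<and> (\<forall>i. b $ i \<le> permute_vec p a $ i)"
proof -
  obtain P where P: "orthogonal_matrix P" "A = P ** diag_mat a ** transpose P" using a by (auto simp: is_eigvals_def)
  obtain Q where Q: "orthogonal_matrix Q" "B = Q ** diag_mat b ** transpose Q" using b by (auto simp: is_eigvals_def)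
  have dimim: "dim ((*v) T ` {x. \<forall>i. i \<notin> I \<longrightarrow> x $ i = 0}) = card I" if "orthogonal_matrix T" for T :: "real^'n^'n" and I
  proof -
    have "inj ((*v) T)" using orthogonal_transformation_matrix[of "(*v) T"] that orthogonal_transformation_inj by auto
    then show ?thesis by (subst dim_image_eq) (auto simp: dim_substandard_cart dim_vec_eq[symmetric] intro: inj_on_subset)
  qed
  have "card {i \<in> UNIV. b $ i \<ge> t} \<le> card {j \<in> UNIV. a $ j \<ge> t}" for t
  proof -
    let ?I = "{i. b $ i \<ge> t}" and ?J = "{j. \<not> a $ j \<ge> t}"
    define U where "U = (*v) Q ` {x. \<forall>i. i \<notin> ?I \<longrightarrow> x $ i = 0}"
    define W where "W = (*v) P ` {x. \<forall>i. i \<notin> ?J \<longrightarrow> x $ i = 0}"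
    have sU: "subspace U" "subspace W" unfolding U_def W_def
      by (intro linear_subspace_image matrix_vector_mul_linear; auto simp: subspace_def)+
    have "U \<inter> W \<subseteq> {0}"
    proof
      fix v assume v: "v \<in> U \<inter> W"
      obtain x where x: "v = Q *v x" "\<forall>i. i \<notin> ?I \<longrightarrow> x $ i = 0" using v unfolding U_def by blast
      obtain y where y: "v = P *v y" "\<forall>i. i \<notin> ?J \<longrightarrow> y $ i = 0" using v unfolding W_def by blast
      have nx: "(norm v)\<^sup>2 = (\<Sum>i\<in>UNIV. (x $ i)\<^sup>2)" using orthogonal_matrix_norm[OF Q(1), of x] x(1)
        by (simp add: norm_vec_def L2_set_def sum_nonneg)
      have ny: "(norm v)\<^sup>2 = (\<Sum>i\<in>UNIV. (y $ i)\<^sup>2)" using orthogonal_matrix_norm[OF P(1), of y] y(1)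
        by (simp add: norm_vec_def L2_set_def sum_nonneg)
      have 1: "t * (norm v)\<^sup>2 \<le> v \<bullet> (B *v v)"
        unfolding nx sum_distrib_left unfolding x(1) eigvals_quadratic_form[OF Q]
      proof (rule sum_mono)
        fix i show "t * (x $ i)\<^sup>2 \<le> b $ i * (x $ i)\<^sup>2" using x(2) by (cases "i \<in> ?I") (auto intro: mult_right_mono)
      qed
      show "v \<in> {0}"
      proof (rule ccontr)
        assume "v \<notin> {0}"
        then have "y \<noteq> 0" using y(1) by auto
        then obtain k where k: "y $ k \<noteq> 0" by (auto simp: vec_eq_iff)
        have "v \<bullet> (A *v v) < t * (norm v)\<^sup>2"
          unfolding ny sum_distrib_left unfolding y(1) eigvals_quadratic_form[OF P]
        proof (rule sum_strict_mono_ex1)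
          show "\<forall>i\<in>UNIV. a $ i * (y $ i)\<^sup>2 \<le> t * (y $ i)\<^sup>2"
          proof
            fix i show "a $ i * (y $ i)\<^sup>2 \<le> t * (y $ i)\<^sup>2" using y(2) by (cases "i \<in> ?J") (auto intro: mult_right_mono)
          qed
          show "\<exists>i\<in>UNIV. a $ i * (y $ i)\<^sup>2 < t * (y $ i)\<^sup>2" using k y(2) by (intro bexI[of _ k]) (auto simp: not_le[symmetric])
        qed simp
        then show False using 1 le[of v] by linarith
      qed
    qed
    then have "dim (U \<inter> W) = 0" by (simp add: dim_eq_0)
    then have "dim U + dim W = dim {x + y |x y. x \<in> U \<and> y \<in> W}" using dim_sums_Int[OF sU] by linarith
    also have "\<dots> \<le> CARD('n)" using dim_subset_UNIV[of "{x + y |x y. x \<in> U \<and> y \<in> W}"] by simp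
    finally have "card ?I + card ?J \<le> CARD('n)" unfolding U_def W_def dimim[OF P(1)] dimim[OF Q(1)] .
    moreover have "card ?J = CARD('n) - card {j. a $ j \<ge> t}"
      using card_Diff_subset[of "{j. a $ j \<ge> t}" UNIV] by (simp add: Compl_eq_Diff_UNIV[symmetric] Collect_neg_eq)
    moreover have "card {j. a $ j \<ge> t} \<le> CARD('n)" by (rule card_mono) auto
    ultimately show ?thesis by simp
  qed
  then obtain f where f: "bij_betw f UNIV UNIV" "\<forall>i. b $ i \<le> a $ f i"
    using bij_dominating[of "UNIV::'n set" "UNIV::'n set" "\<lambda>i. b $ i" "\<lambda>i. a $ i"] by auto
  then show ?thesis by (intro exI[of _ f]) (auto simp: permute_vec_def intro: bij_imp_permutes)
qed

section \<open>Proximal maps and second order expansions\<close>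

definition subgrad :: "('a::real_inner \<Rightarrow> real) \<Rightarrow> 'a \<Rightarrow> 'a \<Rightarrow> bool" where
  "subgrad F x g \<longleftrightarrow> (\<forall>y. F x + g \<bullet> (y - x) \<le> F y)"

text \<open>Encodes a finite convex function with Lipschitz constant \<open>B\<close> by its
  supporting planes. Sup-convolutions arrive in this form; convexity and the Lipschitz bound are
  derived from it.\<close>

definition subdifferentiable_bdd :: "real \<Rightarrow> ('a::real_inner \<Rightarrow> real) \<Rightarrow> bool" where
  "subdifferentiable_bdd B F \<longleftrightarrow> (\<forall>x. \<exists>g. norm g \<le> B \<and> subgrad F x g)"

lemma subdiff_lipschitz:
  assumes "subdifferentiable_bdd B F"
  shows "B-lipschitz_on UNIV F"
proof -
  have 1: "F x - F y \<le> B * norm (x - y)" for x y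
  proof -
    obtain g where g: "norm g \<le> B" "subgrad F x g" using assms by (auto simp: subdifferentiable_bdd_def)
    have "F x - F y \<le> g \<bullet> (x - y)" using g(2)[unfolded subgrad_def, rule_format, of y] by (simp add: inner_diff_right)
    also have "\<dots> \<le> norm g * norm (x - y)" by (rule norm_cauchy_schwarz)
    also have "\<dots> \<le> B * norm (x - y)" using g by (intro mult_right_mono) auto
    finally show ?thesis .
  qed
  have "B \<ge> 0" using assms by (metis subdifferentiable_bdd_def norm_ge_zero order_trans)
  then show ?thesis
    using 1 by (intro lipschitz_onI) (auto simp: dist_norm abs_le_iff, metis norm_minus_commute)
qed

lemma subdiff_convex:
  assumes F: "subdifferentiable_bdd B F" and t: "0 \<le> t" "t \<le> 1"
  shows "F ((1 - t) *\<^sub>R x + t *\<^sub>R y) \<le> (1 - t) * F x + t * F y"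
proof -
  define m where "m = (1 - t) *\<^sub>R x + t *\<^sub>R y"
  obtain g where g: "subgrad F m g" using F by (auto simp: subdifferentiable_bdd_def)
  have "(1 - t) * (F m + g \<bullet> (x - m)) + t * (F m + g \<bullet> (y - m)) \<le> (1 - t) * F x + t * F y"
    using t g by (intro add_mono mult_left_mono) (auto simp: subgrad_def)
  moreover have "(1 - t) * (F m + g \<bullet> (x - m)) + t * (F m + g \<bullet> (y - m)) = F m + g \<bullet> ((1 - t) *\<^sub>R x + t *\<^sub>R y - m)"
    by (simp add: inner_diff_right inner_add_right algebra_simps)
  ultimately show ?thesis by (simp add: m_def)
qed

text \<open>The point sought minimises \<open>F x + (norm (x - z))\<^sup>2 / 2\<close>; convexity
  turns minimality into the global subgradient inequality.\<close>

lemma prox_exists: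
  fixes F :: "real^'n \<Rightarrow> real"
  assumes F: "subdifferentiable_bdd B F"
  shows "\<exists>x. subgrad F x (z - x)"
proof -
  have lip: "B-lipschitz_on UNIV F" by (rule subdiff_lipschitz[OF F])
  have B: "B \<ge> 0" using lipschitz_on_nonneg[OF lip] .
  define G where "G = (\<lambda>x. F x + (norm (x - z))\<^sup>2 / 2)"
  have cF: "continuous_on UNIV F" using lip lipschitz_on_continuous_on by blast
  \<comment> \<open>Beyond radius \<open>2 * B + 1\<close> the quadratic term outweighs any decrease
    that the Lipschitz function \<open>F\<close> can produce, so a minimiser over this ball is
    global.\<close>
  have "continuous_on (cball z (2*B+1)) G" unfolding G_def
    by (intro continuous_intros continuous_on_subset[OF cF]) auto
  then obtain x where x: "x \<in> cball z (2*B+1)" "\<And>y. y \<in> cball z (2*B+1) \<Longrightarrow> G x \<le> G y"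
    using continuous_attains_inf[OF compact_cball, of z "2*B+1" G] B by auto
  have min: "G x \<le> G y" for y
  proof (cases "y \<in> cball z (2*B+1)")
    case False
    define s where "s = norm (y - z)"
    have s: "s > 2*B+1" using False by (auto simp: s_def dist_norm norm_minus_commute)
    have "G x \<le> G z" using x(2)[of z] B by auto
    also have "\<dots> = F z" by (simp add: G_def)
    also have "\<dots> \<le> F y + B * s" using lipschitz_onD[OF lip, of z y] by (auto simp: dist_norm s_def norm_minus_commute)
    also have "B * s \<le> s^2 / 2" using s B mult_right_mono[of "2*B" s s] by (auto simp: power2_eq_square)
    finally show ?thesis by (simp add: G_def s_def)
  qed (use x in auto)
  have "F x + (z - x) \<bullet> (y - x) \<le> F y" for y
  proof (rule ccontr)
    assume neg: "\<not> ?thesis"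
    \<comment> \<open>The defect of the subgradient inequality at \<open>y\<close>. Moving a
      fraction \<open>t\<close> towards \<open>y\<close> gains \<open>t * d\<close> and costs at
      most \<open>t\<^sup>2 * n2 / 2\<close>, which contradicts minimality for small
      \<open>t\<close>.\<close>
    define d where "d = F x + (z - x) \<bullet> (y - x) - F y"
    define ip where "ip = (z - x) \<bullet> (y - x)"
    have d: "d = F x + ip - F y" by (simp add: d_def ip_def)
    have gap: "0 < d" using neg by (simp add: d_def)
    define n2 where "n2 = (norm (y - x))\<^sup>2"
    define t where "t = min 1 (d / (n2 + 1))"
    have n2: "n2 \<ge> 0" by (simp add: n2_def)
    have t: "0 < t" "t \<le> 1" using gap n2 by (auto simp: t_def)
    have td: "t * n2 < 2 * d"
    proof -
      have "t * n2 \<le> (d / (n2 + 1)) * n2" using n2 by (intro mult_right_mono) (auto simp: t_def)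
      also have "\<dots> \<le> d" using n2 gap by (simp add: field_simps)
      finally show ?thesis using gap by linarith
    qed
    define m where "m = (1 - t) *\<^sub>R x + t *\<^sub>R y"
    have mz: "m - z = (x - z) + t *\<^sub>R (y - x)" by (simp add: m_def algebra_simps)
    have "(norm (m - z))\<^sup>2 = (norm (x - z))\<^sup>2 - 2 * t * ip + t^2 * n2"
      unfolding mz n2_def ip_def power2_norm_eq_inner
      by (simp add: inner_add_left inner_add_right inner_diff_left inner_diff_right inner_commute power2_eq_square algebra_simps)
    moreover have "F m \<le> (1 - t) * F x + t * F y" unfolding m_def using subdiff_convex[OF F] t by simp
    ultimately have "G x \<le> (1 - t) * F x + t * F y + (norm (x - z))\<^sup>2/2 - t * ip + t^2 * n2 / 2"
      using min[of m] unfolding G_def by (simp add: field_simps)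
    then have "t * d \<le> t * (t * n2 / 2)" by (simp add: G_def d algebra_simps power2_eq_square)
    then have "d \<le> t * n2 / 2" using t by simp
    then show False using td by linarith
  qed
  then show ?thesis by (auto simp: subgrad_def)
qed

text \<open>Adding the two subgradient inequalities, that is, monotonicity of the subdifferential,
  bounds \<open>(norm (x - x'))\<^sup>2\<close> by
  \<open>(z - z') \<bullet> (x - x')\<close>.\<close>

lemma subgrad_resolvent_nonexpansive:
  assumes "subgrad F x (z - x)" "subgrad F x' (z' - x')"
  shows "norm (x - x') \<le> norm (z - z')"
proof -
  have 1: "F x + (z - x) \<bullet> (x' - x) \<le> F x'" "F x' + (z' - x') \<bullet> (x - x') \<le> F x"
    using assms by (auto simp: subgrad_def)
  have e: "(z - x) \<bullet> (x' - x) + (z' - x') \<bullet> (x - x') = (norm (x - x'))\<^sup>2 - (z - z') \<bullet> (x - x')"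
    unfolding power2_norm_eq_inner by (simp add: inner_diff_left inner_diff_right inner_commute algebra_simps)
  have "(norm (x - x'))\<^sup>2 \<le> (z - z') \<bullet> (x - x')" using 1 e by linarith
  also have "\<dots> \<le> norm (z - z') * norm (x - x')" by (rule norm_cauchy_schwarz)
  finally have "norm (x - x') * norm (x - x') \<le> norm (z - z') * norm (x - x')" by (simp add: power2_eq_square)
  then show ?thesis by (cases "x = x'") auto
qed

text \<open>The resolvent of the subdifferential, inverse to \<open>x \<mapsto> x + g\<close> with
  \<open>g\<close> a subgradient at \<open>x\<close>. The choice is harmless for the functions
  considered here, since nonexpansiveness makes the point unique.\<close>

definition prox :: "(real^'n \<Rightarrow> real) \<Rightarrow> real^'n \<Rightarrow> real^'n" where
  "prox F z = (SOME x. subgrad F x (z - x))"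

lemma prox_subgrad: "subdifferentiable_bdd B F \<Longrightarrow> subgrad F (prox F z) (z - prox F z)"
  unfolding prox_def by (rule someI_ex) (rule prox_exists)

lemma prox_eq:
  assumes "subdifferentiable_bdd B F" "subgrad F x g" shows "prox F (x + g) = x"
  using subgrad_resolvent_nonexpansive[of F "prox F (x+g)" "x+g" x "x+g"] prox_subgrad[OF assms(1)] assms(2) by simp

lemma prox_lipschitz: "subdifferentiable_bdd B F \<Longrightarrow> 1-lipschitz_on UNIV (prox F)"
  by (intro lipschitz_onI) (auto simp: dist_norm intro: subgrad_resolvent_nonexpansive[OF prox_subgrad prox_subgrad])

lemma rademacher_vec:
  fixes J :: "real^'n \<Rightarrow> real^'n"
  assumes "L-lipschitz_on UNIV J"
  shows "negligible {z. \<not> (\<exists>D. (J has_derivative D) (at z))}"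
proof -
  have L: "L-lipschitz_on UNIV (\<lambda>z. J z $ i)" for i
  proof (rule lipschitz_onI)
    fix x y
    have "dist (J x $ i) (J y $ i) \<le> dist (J x) (J y)"
      using dist_vec_nth_le by blast
    also have "\<dots> \<le> L * dist x y" using assms by (rule lipschitz_onD) auto
    finally show "dist (J x $ i) (J y $ i) \<le> L * dist x y" .
  qed (use lipschitz_on_nonneg[OF assms] in auto)
  have "negligible (\<Union>i. {z. \<not> (\<exists>g. ((\<lambda>z. J z $ i) has_derivative (\<lambda>h. g \<bullet> h)) (at z))})"
    by (intro negligible_Union) (use rademacher[OF L] in auto)
  moreover have "{z. \<not> (\<exists>D. (J has_derivative D) (at z))} \<subseteq> (\<Union>i. {z. \<not> (\<exists>g. ((\<lambda>z. J z $ i) has_derivative (\<lambda>h. g \<bullet> h)) (at z))})"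
  proof (rule subsetI, rule ccontr)
    fix z assume nd: "z \<in> {z. \<not> (\<exists>D. (J has_derivative D) (at z))}"
      and "z \<notin> (\<Union>i. {z. \<not> (\<exists>g. ((\<lambda>z. J z $ i) has_derivative (\<lambda>h. g \<bullet> h)) (at z))})"
    then have "\<forall>i. \<exists>g. ((\<lambda>z. J z $ i) has_derivative (\<lambda>h. g \<bullet> h)) (at z)" by auto
    then obtain g where g: "\<And>i. ((\<lambda>z. J z $ i) has_derivative (\<lambda>h. g i \<bullet> h)) (at z)" by metis
    have "(J has_derivative (\<lambda>h. \<chi> i. g i \<bullet> h)) (at z)"
      unfolding has_derivative_componentwise_within[of J]
    proof
      fix b :: "real^'n" assume "b \<in> Basis"
      then obtain i where "b = axis i 1" by (auto simp: Basis_vec_def)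
      then show "((\<lambda>x. J x \<bullet> b) has_derivative (\<lambda>h. (\<chi> i. g i \<bullet> h) \<bullet> b)) (at z)" using g[of i] by (simp add: inner_axis)
    qed
    then show False using nd by blast
  qed
  ultimately show ?thesis using negligible_subset by blast
qed

text \<open>Every \<open>x\<close> is \<open>prox F (x + g)\<close> for a subgradient
  \<open>g\<close>, so the points with a preimage at which \<open>prox F\<close> is not
  differentiable form the Lipschitz image of a null set. This is the exceptional set of Alexandrov's
  theorem.\<close>

lemma second_order_exceptional_null:
  assumes "subdifferentiable_bdd B F"
  shows "negligible (prox F ` {z. \<not> (\<exists>D. (prox F has_derivative D) (at z))})"
proof (rule negligible_locally_Lipschitz_image)
  show "negligible {z. \<not> (\<exists>D. (prox F has_derivative D) (at z))}"
    by (rule rademacher_vec[OF prox_lipschitz[OF assms]])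
  have "norm (prox F y - prox F x) \<le> 1 * norm (y - x)" for x y
    using lipschitz_onD[OF prox_lipschitz[OF assms], of y x] by (simp add: dist_norm)
  then show "\<exists>T B. open T \<and> x \<in> T \<and> (\<forall>y\<in>{z. \<not> (\<exists>D. (prox F has_derivative D) (at z))} \<inter> T. norm (prox F y - prox F x) \<le> B * norm (y - x))" for x
    by (intro exI[of _ UNIV] exI[of _ 1]) auto
qed simp

text \<open>At a point where \<open>F\<close> is touched from above by a paraboloid, the inverse of \<open>prox F\<close> is
  Lipschitz; hence the derivative of \<open>prox F\<close> is automatically invertible there and can be inverted
  to a first order expansion of the subdifferential.\<close>

lemma subgrad_expansion:
  fixes F :: "real^'n \<Rightarrow> real"
  assumes F: "subdifferentiable_bdd B F"
    and x: "x \<notin> prox F ` {z. \<not> (\<exists>D. (prox F has_derivative D) (at z))}"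
    and g: "subgrad F x g" and C: "C \<ge> 0" "\<rho> > 0"
    and up: "\<And>y. norm (y - x) \<le> \<rho> \<Longrightarrow> F y \<le> F x + g \<bullet> (y - x) + C * (norm (y - x))\<^sup>2"
  shows "\<exists>A. linear A \<and> (\<forall>\<eta>>0. \<exists>r>0. \<forall>x' g'. norm (x' - x) < r \<and> subgrad F x' g' \<longrightarrow> norm (g' - g - A (x' - x)) \<le> \<eta> * norm (x' - x))"
proof -
  define z where "z = x + g"
  have Jz: "prox F z = x" unfolding z_def by (rule prox_eq[OF F g])
  then obtain D where D: "(prox F has_derivative D) (at z)" using x by blast
  have linD: "linear D" using D has_derivative_linear by blast
  \<comment> \<open>Starting from \<open>x'\<close>, a step of length \<open>\<sigma>\<close> is
    made in the direction of \<open>g' - g\<close>. The supporting plane at \<open>x'\<close> lies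
    below \<open>F\<close>, the paraboloid at \<open>x\<close> above it, and
    \<open>\<sigma> = s\<close> gives the bound.\<close>
  have gl: "norm (g' - g) \<le> 4 * C * norm (x' - x)" if "subgrad F x' g'" "norm (x' - x) \<le> \<rho>/2" for x' g'
  proof (cases "g' = g")
    case False
    define s where "s = norm (x' - x)"
    define e where "e = (g' - g) /\<^sub>R norm (g' - g)"
    have e: "norm e = 1" "(g' - g) \<bullet> e = norm (g' - g)" using False
      by (auto simp: e_def dot_square_norm power2_eq_square)
    have key: "\<sigma> * norm (g' - g) \<le> C * (s + \<sigma>)\<^sup>2" if \<sigma>: "0 \<le> \<sigma>" "s + \<sigma> \<le> \<rho>" for \<sigma>
    proof -
      define w where "w = x' + \<sigma> *\<^sub>R e"
      have wx: "norm (w - x) \<le> s + \<sigma>" using norm_triangle_ineq[of "x' - x" "\<sigma> *\<^sub>R e"] e \<sigma> by (simp add: w_def s_def algebra_simps)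
      have "F x' + g' \<bullet> (w - x') \<le> F w" using \<open>subgrad F x' g'\<close> by (simp add: subgrad_def)
      also have "F w \<le> F x + g \<bullet> (w - x) + C * (norm (w - x))\<^sup>2" using up wx \<sigma> by auto
      also have "\<dots> \<le> F x + g \<bullet> (w - x) + C * (s + \<sigma>)\<^sup>2" using C wx by (intro add_left_mono mult_left_mono power_mono) auto
      finally have "F x' + g' \<bullet> (w - x') \<le> F x + g \<bullet> (w - x) + C * (s + \<sigma>)\<^sup>2" .
      moreover have "F x + g \<bullet> (x' - x) \<le> F x'" using g by (simp add: subgrad_def)
      moreover have "g \<bullet> (w - x) = g \<bullet> (w - x') + g \<bullet> (x' - x)" by (simp add: inner_diff_right)
      ultimately have "(g' - g) \<bullet> (w - x') \<le> C * (s + \<sigma>)\<^sup>2" by (simp add: inner_diff_left)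
      then show ?thesis using e by (simp add: w_def)
    qed
    show ?thesis
    proof (cases "s = 0")
      case False
      then have "s > 0" by (simp add: s_def)
      have "s * norm (g' - g) \<le> C * (s + s)\<^sup>2" using key[of s] that \<open>s > 0\<close> by (simp add: s_def)
      also have "\<dots> = s * (4 * C * s)" by (simp add: power2_eq_square)
      finally show ?thesis using \<open>s > 0\<close> by (simp add: s_def)
    next
      \<comment> \<open>Here two subgradients at the same point are compared: \<open>key\<close>
        with \<open>\<sigma>\<close> small forces them to coincide.\<close>
      case True
      have "norm (g' - g) \<le> 0"
      proof (rule ccontr)
        assume n: "\<not> ?thesis"
        define \<sigma> where "\<sigma> = min \<rho> (norm (g' - g) / (2 * (C + 1)))"
        have \<sigma>: "\<sigma> > 0" using n C by (auto simp: \<sigma>_def)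
        have "\<sigma> * norm (g' - g) \<le> \<sigma> * (C * \<sigma>)" using key[of \<sigma>] True \<sigma> by (simp add: \<sigma>_def power2_eq_square algebra_simps)
        then have "norm (g' - g) \<le> C * \<sigma>" using \<sigma> by simp
        also have "\<dots> \<le> C * (norm (g' - g) / (2 * (C + 1)))" using C by (intro mult_left_mono) (auto simp: \<sigma>_def)
        also have "\<dots> \<le> norm (g' - g) / 2" using C by (simp add: field_simps)
        finally show False using n by simp
      qed
      then show ?thesis using C by (smt (verit) mult_nonneg_nonneg norm_ge_zero)
    qed
  qed (use C in auto)
  \<comment> \<open>The Lipschitz constant, at \<open>x\<close>, of the inverse of
    \<open>prox F\<close>.\<close>
  define c where "c = 1 + 4 * C"
  have c: "c \<ge> 1" using C by (simp add: c_def)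
  have zl: "norm (z' - z) \<le> c * norm (x' - x)" if "subgrad F x' (z' - x')" "norm (x' - x) \<le> \<rho>/2" for x' z'
  proof -
    have "z' - z = (x' - x) + ((z' - x') - g)" by (simp add: z_def)
    then have "norm (z' - z) \<le> norm (x' - x) + norm ((z' - x') - g)" by (metis norm_triangle_ineq)
    then show ?thesis using gl[OF that] by (simp add: c_def algebra_simps)
  qed
  have exp: "\<exists>d>0. \<forall>z'. norm (z' - z) < d \<longrightarrow> norm (prox F z' - x - D (z' - z)) \<le> \<eta> * norm (z' - z)" if "\<eta> > 0" for \<eta>
    using D that unfolding has_derivative_at_alt Jz by auto
  \<comment> \<open>A vector in the kernel of \<open>D\<close> would be a displacement of
    \<open>z\<close> that moves \<open>prox F\<close> by less than the fraction \<open>1 / c\<close>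
    which the inverse Lipschitz bound requires.\<close>
  have inj: "inj D"
    unfolding linear_injective_0[OF linD]
  proof (intro allI impI, rule ccontr)
    fix e assume De: "D e = 0" and "e \<noteq> 0"
    obtain d where d: "d > 0" "\<And>z'. norm (z' - z) < d \<Longrightarrow> norm (prox F z' - x - D (z' - z)) \<le> (1/(2*c)) * norm (z' - z)"
      using exp[of "1/(2*c)"] c by auto
    define \<tau> where "\<tau> = min (d/2) (\<rho>/2) / norm e"
    have \<tau>: "\<tau> > 0" using d C \<open>e \<noteq> 0\<close> by (auto simp: \<tau>_def)
    have te: "norm (\<tau> *\<^sub>R e) = min (d/2) (\<rho>/2)" using \<open>e \<noteq> 0\<close> d C by (simp add: \<tau>_def)
    define z' where "z' = z + \<tau> *\<^sub>R e"
    have "D (\<tau> *\<^sub>R e) = 0" using De linear_cmul[OF linD] by simp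
    then have 1: "norm (prox F z' - x) \<le> (1/(2*c)) * norm (\<tau> *\<^sub>R e)" using d(2)[of z'] te d(1) by (simp add: z'_def)
    also have 2: "\<dots> \<le> norm (\<tau> *\<^sub>R e)" using c by (intro mult_left_le_one_le) auto
    finally have "norm (prox F z' - x) \<le> \<rho>/2" using te by simp
    then have "norm (\<tau> *\<^sub>R e) \<le> c * norm (prox F z' - x)" using zl[OF prox_subgrad[OF F]] by (metis add_diff_cancel_left' z'_def)
    also have "\<dots> \<le> c * ((1/(2*c)) * norm (\<tau> *\<^sub>R e))" using 1 c by (intro mult_left_mono) auto
    also have "\<dots> = norm (\<tau> *\<^sub>R e) / 2" using c by simp
    finally show False using te d C by simp
  qed
  obtain R where R: "linear R" "R \<circ> D = id" using linear_injective_left_inverse[OF linD inj] by blast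
  have RD: "R (D v) = v" for v using R(2) by (metis comp_apply id_apply)
  obtain b where b: "b > 0" "\<And>v. norm (R v) \<le> b * norm v" using linear_bounded_pos[OF R(1)] by blast
  \<comment> \<open>With \<open>R\<close> a left inverse of \<open>D\<close>, the displacement of
    \<open>x + g\<close> is \<open>R (x' - x)\<close> to first order; subtracting the displacement
    of \<open>x\<close> leaves that of the subgradient.\<close>
  define A where "A = (\<lambda>v. R v - v)"
  have "linear A" unfolding A_def by (intro linear_compose_sub R(1) linear_id[unfolded id_def])
  moreover have "\<exists>r>0. \<forall>x' g'. norm (x' - x) < r \<and> subgrad F x' g' \<longrightarrow> norm (g' - g - A (x' - x)) \<le> \<eta> * norm (x' - x)" if \<eta>: "\<eta> > 0" for \<eta>
  proof -
    define \<eta>' where "\<eta>' = \<eta> / (b * c)"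
    have \<eta>': "\<eta>' > 0" "b * (\<eta>' * c) = \<eta>" using \<eta> b c by (auto simp: \<eta>'_def)
    obtain d where d: "d > 0" "\<And>z'. norm (z' - z) < d \<Longrightarrow> norm (prox F z' - x - D (z' - z)) \<le> \<eta>' * norm (z' - z)"
      using exp[OF \<eta>'(1)] by auto
    show ?thesis
    proof (intro exI[of _ "min (\<rho>/2) (d/c)"] conjI allI impI; (elim conjE)?)
      show "0 < min (\<rho>/2) (d/c)" using C d c by auto
      fix x' g' assume x': "norm (x' - x) < min (\<rho>/2) (d/c)" and g': "subgrad F x' g'"
      define z' where "z' = x' + g'"
      have Jz': "prox F z' = x'" unfolding z'_def by (rule prox_eq[OF F g'])
      have zz: "norm (z' - z) \<le> c * norm (x' - x)" using zl[of x' z'] g' x' by (simp add: z'_def)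
      also have "\<dots> < d" using x' c by (simp add: field_simps)
      finally have "norm (x' - x - D (z' - z)) \<le> \<eta>' * norm (z' - z)" using d(2)[of z'] Jz' by simp
      also have "\<dots> \<le> \<eta>' * (c * norm (x' - x))" using zz \<eta>' by (intro mult_left_mono) auto
      finally have *: "norm (x' - x - D (z' - z)) \<le> \<eta>' * (c * norm (x' - x))" .
      have "R (x' - x - D (z' - z)) = R (x' - x) - (z' - z)" using R(1) RD by (simp add: linear_diff)
      then have "g' - g - A (x' - x) = - R (x' - x - D (z' - z))" by (simp add: A_def z_def z'_def)
      then have "norm (g' - g - A (x' - x)) \<le> b * norm (x' - x - D (z' - z))" using b(2) by simp
      also have "\<dots> \<le> b * (\<eta>' * (c * norm (x' - x)))" using * b by (intro mult_left_mono) auto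
      also have "\<dots> = \<eta> * norm (x' - x)" using \<eta>'(2) by (metis mult.assoc)
      finally show "norm (g' - g - A (x' - x)) \<le> \<eta> * norm (x' - x)" .
    qed
  qed
  ultimately show ?thesis by blast
qed


text \<open>Splitting \<open>[0, 1]\<close> into \<open>n\<close> equal parts bounds the total
  increment by \<open>C / n\<close>. This integrates one-sided subgradient bounds along a segment
  without any differentiability of \<open>F\<close>.\<close>

lemma decreasing_of_quadratic_increments:
  fixes k :: "real \<Rightarrow> real"
  assumes "\<And>s t. \<lbrakk>0 \<le> s; s < t; t \<le> 1\<rbrakk> \<Longrightarrow> k t - k s \<le> C * (t - s)\<^sup>2"
  shows "k 1 \<le> k 0"
proof -
  have "k 1 - k 0 \<le> C * inverse (real (Suc n))" for n
  proof -
    let ?m = "real (Suc n)"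
    have "k 1 - k 0 = (\<Sum>j<Suc n. k (real (Suc j) / ?m) - k (real j / ?m))"
      by (subst sum_lessThan_telescope) simp
    also have "\<dots> \<le> (\<Sum>j<Suc n. C * (1 / ?m)\<^sup>2)"
    proof (rule sum_mono)
      fix j assume "j \<in> {..<Suc n}"
      then have "k (real (Suc j) / ?m) - k (real j / ?m) \<le> C * (real (Suc j) / ?m - real j / ?m)\<^sup>2"
        by (intro assms) (auto simp: field_simps)
      also have "real (Suc j) / ?m - real j / ?m = 1 / ?m" by (simp add: field_simps)
      finally show "k (real (Suc j) / ?m) - k (real j / ?m) \<le> C * (1 / ?m)\<^sup>2" .
    qed
    also have "\<dots> = C * (?m * (1 / ?m)\<^sup>2)" by simp
    also have "?m * (1 / ?m)\<^sup>2 = inverse ?m" unfolding power2_eq_square by (simp del: of_nat_Suc add: field_simps)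
    finally show ?thesis .
  qed
  moreover have "(\<lambda>n. C * inverse (real (Suc n))) \<longlonglongrightarrow> C * 0" by (intro tendsto_intros LIMSEQ_inverse_real_of_nat)
  ultimately have "k 1 - k 0 \<le> C * 0" by (intro tendsto_lowerbound[of _ _ sequentially]) auto
  then show ?thesis by simp
qed

definition second_order_at :: "(real^'n \<Rightarrow> real) \<Rightarrow> real^'n \<Rightarrow> real^'n \<Rightarrow> real^'n^'n \<Rightarrow> bool" where
  "second_order_at F x g X \<longleftrightarrow> (\<forall>\<eta>>0. \<exists>r>0. \<forall>h. norm h < r \<longrightarrow>
      \<bar>F (x + h) - F x - g \<bullet> h - (h \<bullet> (X *v h)) / 2\<bar> \<le> \<eta> * (norm h)\<^sup>2)"

text \<open>The increment of \<open>F\<close> along a segment is squeezed between the subgradients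
  at its ends, so a first order expansion of the subgradients integrates to a second order expansion
  of \<open>F\<close>.\<close>

lemma subgrad_second_order:
  fixes F :: "real^'n \<Rightarrow> real"
  assumes F: "subdifferentiable_bdd B F" and A: "linear A"
    and ex: "\<And>\<eta>. \<eta> > 0 \<Longrightarrow> \<exists>r>0. \<forall>x' g'. norm (x' - x) < r \<and> subgrad F x' g' \<longrightarrow> norm (g' - g - A (x' - x)) \<le> \<eta> * norm (x' - x)"
  shows "\<exists>X. transpose X = X \<and> second_order_at F x g X"
proof -
  \<comment> \<open>Only the quadratic form of \<open>A\<close> enters the expansion, so its
    symmetric part may be taken; symmetry is needed for eigenvalues to exist.\<close>
  define X where "X = (1/2) *\<^sub>R (matrix A + transpose (matrix A))"
  have symX: "transpose X = X" by (simp add: X_def transpose_def vec_eq_iff add.commute)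
  have qX: "h \<bullet> (X *v h) = h \<bullet> A h" for h
  proof -
    have "h \<bullet> (transpose (matrix A) *v h) = (matrix A *v h) \<bullet> h"
      by (metis dot_lmul_matrix inner_commute transpose_matrix_vector)
    then show ?thesis using matrix_works[OF A[unfolded linear_matrix_vector_mul_eq[symmetric]]] A
      by (simp add: X_def scaleR_matrix_vector_assoc[symmetric] matrix_vector_mult_add_rdistrib inner_add_right inner_commute matrix_works)
  qed
  have "second_order_at F x g X" unfolding second_order_at_def
  proof (intro allI impI)
    fix \<eta> :: real assume \<eta>: "\<eta> > 0"
    obtain r where r: "r > 0" "\<And>x' g'. norm (x' - x) < r \<and> subgrad F x' g' \<Longrightarrow> norm (g' - g - A (x' - x)) \<le> \<eta> * norm (x' - x)"
      using ex[OF \<eta>] by auto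
    have "\<bar>F (x + h) - F x - g \<bullet> h - (h \<bullet> A h) / 2\<bar> \<le> \<eta> * (norm h)\<^sup>2" if h: "norm h < r" for h
    proof -
      define q where "q = h \<bullet> A h"
      define w where "w = \<eta> * (norm h)\<^sup>2"
      have "\<forall>t. \<exists>g. subgrad F (x + t *\<^sub>R h) g" using F by (auto simp: subdifferentiable_bdd_def)
      then obtain G where G: "\<And>t. subgrad F (x + t *\<^sub>R h) (G t)" by metis
      have Gt: "\<bar>G t \<bullet> h - g \<bullet> h - t * q\<bar> \<le> w" if "0 \<le> t" "t \<le> 1" for t
      proof -
        have th: "norm (t *\<^sub>R h) \<le> norm h" using that by (simp add: mult_left_le_one_le)
        have "norm (G t - g - A (t *\<^sub>R h)) \<le> \<eta> * norm (t *\<^sub>R h)"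
          using r(2)[of "x + t *\<^sub>R h" "G t"] G[of t] th h by simp
        also have "\<dots> \<le> \<eta> * norm h" using th \<eta> by (intro mult_left_mono) auto
        finally have n: "norm (G t - g - A (t *\<^sub>R h)) \<le> \<eta> * norm h" .
        have "G t \<bullet> h - g \<bullet> h - t * q = (G t - g - A (t *\<^sub>R h)) \<bullet> h"
          using linear_cmul[OF A] by (simp add: q_def inner_diff_left inner_commute[of h])
        also have "\<bar>\<dots>\<bar> \<le> norm (G t - g - A (t *\<^sub>R h)) * norm h" by (rule Cauchy_Schwarz_ineq2)
        also have "\<dots> \<le> \<eta> * norm h * norm h" using n by (intro mult_right_mono) auto
        finally show ?thesis by (simp add: w_def power2_eq_square algebra_simps)
      qed
      have inc: "F (x + t *\<^sub>R h) - F (x + s *\<^sub>R h) \<le> (t - s) * (G t \<bullet> h)"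
                "(t - s) * (G s \<bullet> h) \<le> F (x + t *\<^sub>R h) - F (x + s *\<^sub>R h)" for s t
      proof -
        have "F (x + t *\<^sub>R h) + G t \<bullet> ((x + s *\<^sub>R h) - (x + t *\<^sub>R h)) \<le> F (x + s *\<^sub>R h)"
          using G[of t] unfolding subgrad_def by blast
        then show "F (x + t *\<^sub>R h) - F (x + s *\<^sub>R h) \<le> (t - s) * (G t \<bullet> h)"
          by (simp add: inner_diff_right algebra_simps)
        have "F (x + s *\<^sub>R h) + G s \<bullet> ((x + t *\<^sub>R h) - (x + s *\<^sub>R h)) \<le> F (x + t *\<^sub>R h)"
          using G[of s] unfolding subgrad_def by blast
        then show "(t - s) * (G s \<bullet> h) \<le> F (x + t *\<^sub>R h) - F (x + s *\<^sub>R h)"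
          by (simp add: inner_diff_right algebra_simps)
      qed
      \<comment> \<open>The deviation of \<open>F\<close> from its quadratic model along the
        segment. The linear term \<open>t * w\<close> absorbs the error of the subgradient
        expansion, leaving increments of second order.\<close>
      define k where "k = (\<lambda>t. F (x + t *\<^sub>R h) - t * (g \<bullet> h) - t\<^sup>2 * q / 2 - t * w)"
      have "k 1 \<le> k 0"
      proof (rule decreasing_of_quadratic_increments)
        fix s t :: real assume st: "0 \<le> s" "s < t" "t \<le> 1"
        have "(t - s) * (G t \<bullet> h) \<le> (t - s) * (g \<bullet> h + t * q + w)"
          using Gt[of t] st by (intro mult_left_mono) (auto simp: abs_le_iff)
        then show "k t - k s \<le> (q / 2) * (t - s)\<^sup>2"
          using inc(1)[of t s] by (simp add: k_def power2_eq_square algebra_simps)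
      qed
      then have 1: "F (x + h) - F x - g \<bullet> h - q / 2 \<le> w" by (simp add: k_def)
      define k where "k = (\<lambda>t. - F (x + t *\<^sub>R h) + t * (g \<bullet> h) + t\<^sup>2 * q / 2 - t * w)"
      have "k 1 \<le> k 0"
      proof (rule decreasing_of_quadratic_increments)
        fix s t :: real assume st: "0 \<le> s" "s < t" "t \<le> 1"
        have "(t - s) * (g \<bullet> h + s * q - w) \<le> (t - s) * (G s \<bullet> h)"
          using Gt[of s] st by (intro mult_left_mono) (auto simp: abs_le_iff)
        then show "k t - k s \<le> (q / 2) * (t - s)\<^sup>2"
          using inc(2)[of t s] by (simp add: k_def power2_eq_square algebra_simps)
      qed
      then have 2: "- w \<le> F (x + h) - F x - g \<bullet> h - q / 2" by (simp add: k_def)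
      show ?thesis using 1 2 by (simp add: q_def w_def)
    qed
    then show "\<exists>r>0. \<forall>h. norm h < r \<longrightarrow> \<bar>F (x + h) - F x - g \<bullet> h - (h \<bullet> (X *v h)) / 2\<bar> \<le> \<eta> * (norm h)\<^sup>2"
      using r(1) by (auto simp: qX)
  qed
  then show ?thesis using symX by blast
qed


section \<open>Calculus of second order expansions and Jensen's maximum principle\<close>

lemma linear_le_quadratic_imp_zero:
  fixes a :: "'a::real_inner"
  assumes "\<rho> > 0" "C \<ge> 0" "\<And>v. norm v \<le> \<rho> \<Longrightarrow> a \<bullet> v \<le> C * (norm v)\<^sup>2"
  shows "a = 0"
proof (rule ccontr)
  assume a: "a \<noteq> 0"
  define t where "t = min (\<rho> / norm a) (1 / (2 * (C + 1)))"
  have t: "t > 0" "t * norm a \<le> \<rho>" "t * C < 1"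
  proof -
    show t0: "t > 0" using a assms by (auto simp: t_def)
    have "t * norm a \<le> (\<rho> / norm a) * norm a" by (intro mult_right_mono) (auto simp: t_def)
    then show "t * norm a \<le> \<rho>" using a by simp
    have "t * C \<le> (1 / (2 * (C + 1))) * C" using assms by (intro mult_right_mono) (auto simp: t_def)
    also have "\<dots> < 1" using assms by (simp add: field_simps)
    finally show "t * C < 1" .
  qed
  have "t * (norm a)\<^sup>2 \<le> C * (t\<^sup>2 * (norm a)\<^sup>2)"
    using assms(3)[of "t *\<^sub>R a"] t by (simp add: power_mult_distrib dot_square_norm)
  also have "\<dots> = t * (t * C) * (norm a)\<^sup>2" by (simp add: power2_eq_square)
  also have "\<dots> < t * 1 * (norm a)\<^sup>2" using t a by (intro mult_strict_right_mono mult_strict_left_mono) auto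
  finally show False by simp
qed

lemma second_order_at_le:
  assumes "second_order_at F x g X" "\<rho> > 0" "\<And>h. norm h \<le> \<rho> \<Longrightarrow> F (x + h) \<le> F x + g \<bullet> h + C * (norm h)\<^sup>2"
  shows "v \<bullet> (X *v v) \<le> 2 * C * (norm v)\<^sup>2"
proof (cases "v = 0")
  case False
  show ?thesis
  proof (rule field_le_epsilon)
    fix e :: real assume e: "e > 0"
    define \<eta> where "\<eta> = e / (2 * (norm v)\<^sup>2)"
    have \<eta>: "\<eta> > 0" "2 * \<eta> * (norm v)\<^sup>2 = e" using e False by (auto simp: \<eta>_def)
    obtain r where r: "r > 0" "\<And>h. norm h < r \<Longrightarrow> \<bar>F (x + h) - F x - g \<bullet> h - (h \<bullet> (X *v h)) / 2\<bar> \<le> \<eta> * (norm h)\<^sup>2"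
      using assms(1) \<eta> unfolding second_order_at_def by blast
    define t where "t = min (r/2) \<rho> / norm v"
    have t: "t > 0" "norm (t *\<^sub>R v) < r" "norm (t *\<^sub>R v) \<le> \<rho>" using r assms(2) False by (auto simp: t_def min_def)
    let ?h = "t *\<^sub>R v"
    have "(?h \<bullet> (X *v ?h)) / 2 \<le> F (x + ?h) - F x - g \<bullet> ?h + \<eta> * (norm ?h)\<^sup>2" using r(2)[OF t(2)] by linarith
    also have "\<dots> \<le> C * (norm ?h)\<^sup>2 + \<eta> * (norm ?h)\<^sup>2" using assms(3)[OF t(3)] by linarith
    finally have "t\<^sup>2 * (v \<bullet> (X *v v)) \<le> t\<^sup>2 * (2 * C * (norm v)\<^sup>2 + 2 * \<eta> * (norm v)\<^sup>2)"
      by (simp add: matrix_vector_mult_scaleR power_mult_distrib power2_eq_square algebra_simps)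
    then show "v \<bullet> (X *v v) \<le> 2 * C * (norm v)\<^sup>2 + e" using t \<eta>(2) by simp
  qed
qed simp

lemma second_order_at_ge:
  assumes "second_order_at F x g X" "subgrad F x g"
  shows "0 \<le> v \<bullet> (X *v v)"
proof -
  have "second_order_at (\<lambda>y. - F y) x (- g) (- X)"
  proof -
    have "\<bar>- F (x + h) - - F x - (- g) \<bullet> h - (h \<bullet> (- X *v h)) / 2\<bar> = \<bar>F (x + h) - F x - g \<bullet> h - (h \<bullet> (X *v h)) / 2\<bar>" for h
      by (simp add: minus_matrix_vector_mult)
    then show ?thesis using assms(1) unfolding second_order_at_def by simp
  qed
  moreover have "- F (x + h) \<le> - F x + (- g) \<bullet> h + 0 * (norm h)\<^sup>2" for h
    using assms(2)[unfolded subgrad_def, rule_format, of "x + h"] by simp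
  ultimately have "v \<bullet> (- X *v v) \<le> 2 * 0 * (norm v)\<^sup>2" by (intro second_order_at_le[of "\<lambda>y. - F y" x "- g" "- X" 1 0]) auto
  then show ?thesis by (simp add: minus_matrix_vector_mult)
qed

lemma second_order_at_add:
  assumes "second_order_at F x g X" "second_order_at G x k Y"
  shows "second_order_at (\<lambda>y. F y + G y) x (g + k) (X + Y)"
  unfolding second_order_at_def
proof (intro allI impI)
  fix \<eta> :: real assume "\<eta> > 0"
  then have e: "\<eta>/2 > 0" by simp
  obtain r where r: "r > 0" "\<And>h. norm h < r \<Longrightarrow> \<bar>F (x + h) - F x - g \<bullet> h - (h \<bullet> (X *v h)) / 2\<bar> \<le> \<eta>/2 * (norm h)\<^sup>2"
    using assms(1) e unfolding second_order_at_def by blast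
  obtain s where s: "s > 0" "\<And>h. norm h < s \<Longrightarrow> \<bar>G (x + h) - G x - k \<bullet> h - (h \<bullet> (Y *v h)) / 2\<bar> \<le> \<eta>/2 * (norm h)\<^sup>2"
    using assms(2) e unfolding second_order_at_def by blast
  have "\<bar>F (x + h) + G (x + h) - (F x + G x) - (g + k) \<bullet> h - (h \<bullet> ((X + Y) *v h)) / 2\<bar> \<le> \<eta> * (norm h)\<^sup>2" if "norm h < min r s" for h
  proof -
    have "\<eta>/2 * (norm h)\<^sup>2 + \<eta>/2 * (norm h)\<^sup>2 = \<eta> * (norm h)\<^sup>2" by simp
    then show ?thesis using r(2)[of h] s(2)[of h] that
      unfolding matrix_vector_mult_add_rdistrib inner_add_right inner_add_left add_divide_distrib by linarith
  qed
  then show "\<exists>r>0. \<forall>h. norm h < r \<longrightarrow> \<bar>F (x + h) + G (x + h) - (F x + G x) - (g + k) \<bullet> h - (h \<bullet> ((X + Y) *v h)) / 2\<bar> \<le> \<eta> * (norm h)\<^sup>2"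
    using r(1) s(1) by (intro exI[of _ "min r s"]) auto
qed

lemma norm_sq_expand: "(norm (y::'a::real_inner))\<^sup>2 = (norm x)\<^sup>2 + 2 * (x \<bullet> (y - x)) + (norm (y - x))\<^sup>2"
  unfolding power2_norm_eq_inner by (simp add: inner_diff_left inner_diff_right inner_commute)

text \<open>Jensen's maximum principle: the slopes of the planes touching \<open>h\<close> from above fill a ball, and
  they depend in a Lipschitz way on the contact point, so the contact points form a set of positive
  measure.\<close>

lemma jensen_contact_point:
  fixes F :: "real^'n \<Rightarrow> real"
  assumes F: "subdifferentiable_bdd B F" and \<kappa>: "\<kappa> > 0"
    and R: "norm x0 < R" and m: "m > 0" and \<delta>: "\<delta> > 0"
    and bd: "\<And>y. norm y = R \<Longrightarrow> F y - \<kappa> * (norm y)\<^sup>2 \<le> F x0 - \<kappa> * (norm x0)\<^sup>2 - m"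
    and N: "negligible N"
  obtains x p where "norm x < R" "x \<notin> N" "norm p < \<delta>"
    "F x0 - \<kappa> * (norm x0)\<^sup>2 - m/2 \<le> F x - \<kappa> * (norm x)\<^sup>2"
    "\<And>y. norm y \<le> R \<Longrightarrow> F y - \<kappa> * (norm y)\<^sup>2 \<le> F x - \<kappa> * (norm x)\<^sup>2 + p \<bullet> (y - x)"
proof -
  define h where "h = (\<lambda>x. F x - \<kappa> * (norm x)\<^sup>2)"
  have R0: "R > 0" using R norm_ge_zero[of x0] by linarith
  have cF: "continuous_on UNIV F" using subdiff_lipschitz[OF F] lipschitz_on_continuous_on by blast
  \<comment> \<open>Tilting by a slope below \<open>d\<close> changes values over the ball by at
    most \<open>m/2\<close>, so the maximum of the tilted function stays off the sphere of radius
    \<open>R\<close>.\<close>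
  define d where "d = min \<delta> (m / (4 * R))"
  have d: "d > 0" "d \<le> \<delta>" "d * (2 * R) \<le> m/2"
  proof -
    show "d > 0" "d \<le> \<delta>" using \<delta> m R0 by (auto simp: d_def)
    have "d * (2 * R) \<le> (m / (4 * R)) * (2 * R)" using R0 by (intro mult_right_mono) (auto simp: d_def)
    then show "d * (2 * R) \<le> m/2" using R0 by simp
  qed
  define P where "P = (\<lambda>x p. norm x < R \<and> norm p < d \<and> h x0 - m/2 \<le> h x \<and> (\<forall>y. norm y \<le> R \<longrightarrow> h y \<le> h x + p \<bullet> (y - x)))"
  have ex: "\<exists>x. P x p" if p: "norm p < d" for p
  proof -
    have "continuous_on (cball 0 R) (\<lambda>y. h y - p \<bullet> y)" unfolding h_def
      by (intro continuous_intros continuous_on_subset[OF cF]) auto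
    then obtain x where x: "x \<in> cball 0 R" "\<And>y. y \<in> cball 0 R \<Longrightarrow> h y - p \<bullet> y \<le> h x - p \<bullet> x"
      using continuous_attains_sup[OF compact_cball, of 0 R "\<lambda>y. h y - p \<bullet> y"] R0 by auto
    have "h x0 \<le> h x + p \<bullet> (x0 - x)" using x(2)[of x0] R by (simp add: inner_diff_right)
    moreover have "p \<bullet> (x0 - x) \<le> m/2"
    proof -
      have "p \<bullet> (x0 - x) \<le> norm p * norm (x0 - x)" by (rule norm_cauchy_schwarz)
      also have "\<dots> \<le> d * (2 * R)" using p x(1) R d(1) norm_triangle_ineq4[of x0 x] by (intro mult_mono) auto
      finally show ?thesis using d by linarith
    qed
    ultimately have hx: "h x0 - m/2 \<le> h x" by linarith
    have "norm x \<noteq> R" using bd[of x] hx m by (auto simp: h_def)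
    moreover have "h y \<le> h x + p \<bullet> (y - x)" if "norm y \<le> R" for y using x(2)[of y] that by (simp add: inner_diff_right)
    ultimately have "P x p" using x(1) hx p by (auto simp: P_def)
    then show ?thesis by blast
  qed
  \<comment> \<open>A plane touching from above has the slope that the convex part dictates, so it
    also controls \<open>h\<close> from below up to a paraboloid of opening
    \<open>\<kappa>\<close>.\<close>
  have low: "h z \<ge> h x + p \<bullet> (z - x) - \<kappa> * (norm (z - x))\<^sup>2" if "P x p" for x p z
  proof -
    obtain G where G: "subgrad F x G" using F by (auto simp: subdifferentiable_bdd_def)
    define a where "a = G - (2 * \<kappa>) *\<^sub>R x - p"
    have lo: "h z \<ge> h x + (G - (2 * \<kappa>) *\<^sub>R x) \<bullet> (z - x) - \<kappa> * (norm (z - x))\<^sup>2" for z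
    proof -
      have "\<kappa> * (norm z)\<^sup>2 = \<kappa> * (norm x)\<^sup>2 + (2 * \<kappa>) * (x \<bullet> (z - x)) + \<kappa> * (norm (z - x))\<^sup>2"
        unfolding norm_sq_expand[of z x] distrib_left by simp
      then show ?thesis using G[unfolded subgrad_def, rule_format, of z]
        unfolding h_def inner_diff_left[of G] inner_scaleR_left by linarith
    qed
    have "a = 0"
    proof (rule linear_le_quadratic_imp_zero[of "R - norm x" \<kappa>])
      fix v :: "real^'n" assume v: "norm v \<le> R - norm x"
      have "norm (x + v) \<le> R" using v norm_triangle_ineq[of x v] by linarith
      then have "h (x + v) \<le> h x + p \<bullet> v" using that unfolding P_def by force
      then show "a \<bullet> v \<le> \<kappa> * (norm v)\<^sup>2" using lo[of "x + v"] by (simp add: a_def inner_diff_left)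
    qed (use that \<kappa> in \<open>auto simp: P_def\<close>)
    then show ?thesis using lo[of z] by (simp add: a_def)
  qed
  \<comment> \<open>The upper plane at \<open>y\<close> and the lower paraboloid at \<open>x\<close>
    are compared at \<open>y + v\<close>, with \<open>v\<close> along \<open>p - q\<close> and of
    length \<open>norm (x - y)\<close>; then \<open>norm (y + v - x)\<close> is at most twice that
    length.\<close>
  have lip: "norm (p - q) \<le> 4 * \<kappa> * norm (x - y)" if P: "P x p" "P y q" and near: "norm (x - y) \<le> R - norm y" for x y p q
  proof -
    have key: "(p - q) \<bullet> v \<le> \<kappa> * (norm (y + v - x))\<^sup>2" if v: "norm v \<le> R - norm y" for v
    proof -
      have "norm (y + v) \<le> R" using v norm_triangle_ineq[of y v] by linarith
      then have "h (y + v) \<le> h y + q \<bullet> v" using P(2) unfolding P_def by force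
      moreover have "h y \<le> h x + p \<bullet> (y - x)" using P unfolding P_def by force
      moreover have "h (y + v) \<ge> h x + p \<bullet> (y + v - x) - \<kappa> * (norm (y + v - x))\<^sup>2" by (rule low[OF P(1)])
      ultimately show ?thesis by (simp add: inner_diff_left inner_diff_right inner_add_right)
    qed
    show ?thesis
    proof (cases "x = y")
      case True
      have "p - q = 0"
        by (rule linear_le_quadratic_imp_zero[of "R - norm y" \<kappa>]) (use key True P \<kappa> in \<open>auto simp: P_def\<close>)
      then show ?thesis using True by simp
    next
      case False
      show ?thesis
      proof (cases "p = q")
        case False
        define s where "s = norm (x - y)"
        define v where "v = (s / norm (p - q)) *\<^sub>R (p - q)"
        have s: "s > 0" using \<open>x \<noteq> y\<close> by (simp add: s_def)
        have v: "norm v = s" "(p - q) \<bullet> v = s * norm (p - q)" using False s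
          by (auto simp: v_def dot_square_norm power2_eq_square)
        have "norm (y + v - x) \<le> 2 * s" using norm_triangle_ineq4[of v "x - y"] v by (simp add: s_def algebra_simps)
        then have "\<kappa> * (norm (y + v - x))\<^sup>2 \<le> \<kappa> * (2 * s)\<^sup>2" using \<kappa> by (intro mult_left_mono power_mono) auto
        moreover have "s * norm (p - q) \<le> \<kappa> * (norm (y + v - x))\<^sup>2" using key[of v] v near by (simp add: s_def)
        moreover have "\<kappa> * (2 * s)\<^sup>2 = s * (4 * \<kappa> * s)" by (simp add: power2_eq_square)
        ultimately have "s * norm (p - q) \<le> s * (4 * \<kappa> * s)" by linarith
        then show ?thesis using s by (simp add: s_def)
      qed (use \<kappa> in simp)
    qed
  qed
  define K where "K = {x. \<exists>p. P x p}"
  define S where "S = (\<lambda>x. SOME p. P x p)"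
  have S: "P x (S x)" if "x \<in> K" for x using that unfolding K_def S_def by (auto intro: someI)
  have Su: "S x = p" if "P x p" for x p
    using lip[of x p x "S x"] S[of x] that by (auto simp: K_def P_def)
  \<comment> \<open>Were the contact set null, so would be its set of slopes; but the slopes fill
    \<open>ball 0 d\<close>.\<close>
  have "\<not> K \<subseteq> N"
  proof
    assume "K \<subseteq> N"
    then have "negligible K" using N negligible_subset by blast
    then have "negligible (S ` K)"
    proof (rule negligible_locally_Lipschitz_image[rotated])
      fix x assume x: "x \<in> K"
      then have xR: "norm x < R" using S[OF x] by (simp add: P_def)
      have "norm (S y - S x) \<le> 4 * \<kappa> * norm (y - x)" if "y \<in> K" "norm (y - x) < R - norm x" for y
        using lip[OF S[OF that(1)] S[OF x]] that by simp
      then show "\<exists>T B. open T \<and> x \<in> T \<and> (\<forall>y\<in>K \<inter> T. norm (S y - S x) \<le> B * norm (y - x))"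
        using xR by (intro exI[of _ "ball x (R - norm x)"] exI[of _ "4 * \<kappa>"]) (auto simp: dist_norm norm_minus_commute)
    qed simp
    moreover have "ball 0 d \<subseteq> S ` K"
    proof
      fix p :: "real^'n" assume "p \<in> ball 0 d"
      then obtain x where "P x p" using ex[of p] by auto
      then show "p \<in> S ` K" using Su[of x p] by (auto simp: K_def intro!: image_eqI[of p S x])
    qed
    ultimately have "negligible (ball (0::real^'n) d)" using negligible_subset by blast
    then show False using d(1) open_not_negligible[of "ball (0::real^'n) d"] by auto
  qed
  then obtain x where "x \<in> K" "x \<notin> N" by blast
  then show ?thesis using that[of x "S x"] S[of x] d(2) by (auto simp: P_def h_def)
qed

text \<open>Jensen's argument is applied to the convex sum \<open>F1 + F2\<close>, avoiding the
  exceptional sets of both summands, so that both expansions exist at one common point.\<close>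

lemma jensen_second_order:
  fixes F1 F2 :: "real^'n \<Rightarrow> real"
  assumes F: "subdifferentiable_bdd B1 F1" "subdifferentiable_bdd B2 F2" and \<kappa>: "\<kappa> > 0"
    and R: "norm x0 < R" and m: "m > 0" and \<delta>: "\<delta> > 0"
    and bd: "\<And>y. norm y = R \<Longrightarrow> F1 y + F2 y - \<kappa> * (norm y)\<^sup>2 \<le> F1 x0 + F2 x0 - \<kappa> * (norm x0)\<^sup>2 - m"
  obtains x where "norm x < R"
    "F1 x0 + F2 x0 - \<kappa> * (norm x0)\<^sup>2 - m/2 \<le> F1 x + F2 x - \<kappa> * (norm x)\<^sup>2"
    "\<And>g1 g2. subgrad F1 x g1 \<Longrightarrow> subgrad F2 x g2 \<Longrightarrow> norm (g1 + g2 - (2 * \<kappa>) *\<^sub>R x) < \<delta> \<and>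
      (\<exists>X1 X2. transpose X1 = X1 \<and> transpose X2 = X2 \<and> second_order_at F1 x g1 X1 \<and> second_order_at F2 x g2 X2 \<and>
         (\<forall>v. 0 \<le> v \<bullet> (X1 *v v)) \<and> (\<forall>v. 0 \<le> v \<bullet> (X2 *v v)) \<and>
         (\<forall>v. v \<bullet> (X1 *v v) + v \<bullet> (X2 *v v) \<le> 2 * \<kappa> * (norm v)\<^sup>2))"
proof -
  define F where "F = (\<lambda>x. F1 x + F2 x)"
  have sF: "subdifferentiable_bdd (B1 + B2) F" unfolding subdifferentiable_bdd_def
  proof
    fix x
    obtain g1 g2 where g: "norm g1 \<le> B1" "subgrad F1 x g1" "norm g2 \<le> B2" "subgrad F2 x g2"
      using F by (metis subdifferentiable_bdd_def)
    have "F x + (g1 + g2) \<bullet> (y - x) \<le> F y" for y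
      using g(2,4)[unfolded subgrad_def, rule_format, of y] unfolding F_def inner_add_left by linarith
    then show "\<exists>g. norm g \<le> B1 + B2 \<and> subgrad F x g"
      using g norm_triangle_mono by (intro exI[of _ "g1 + g2"]) (auto simp: subgrad_def)
  qed
  define N where "N = (\<lambda>F::real^'n\<Rightarrow>real. prox F ` {z. \<not> (\<exists>D. (prox F has_derivative D) (at z))})"
  have "negligible (N F1 \<union> N F2)" unfolding N_def by (intro negligible_Un second_order_exceptional_null[OF F(1)] second_order_exceptional_null[OF F(2)])
  then obtain x p where x: "norm x < R" "x \<notin> N F1 \<union> N F2" "norm p < \<delta>"
    "F x0 - \<kappa> * (norm x0)\<^sup>2 - m/2 \<le> F x - \<kappa> * (norm x)\<^sup>2"
    "\<And>y. norm y \<le> R \<Longrightarrow> F y - \<kappa> * (norm y)\<^sup>2 \<le> F x - \<kappa> * (norm x)\<^sup>2 + p \<bullet> (y - x)"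
    using jensen_contact_point[OF sF \<kappa> R m \<delta>, of "N F1 \<union> N F2"] bd unfolding F_def by metis
  define \<rho> where "\<rho> = R - norm x"
  have \<rho>: "\<rho> > 0" using x by (simp add: \<rho>_def)
  have up: "F (x + v) \<le> F x + (p + (2 * \<kappa>) *\<^sub>R x) \<bullet> v + \<kappa> * (norm v)\<^sup>2" if "norm v \<le> \<rho>" for v
  proof -
    have "norm (x + v) \<le> R" using that norm_triangle_ineq[of x v] by (simp add: \<rho>_def)
    from x(5)[OF this] show ?thesis using norm_sq_expand[of "x + v" x] by (simp add: inner_add_left algebra_simps)
  qed
  have main: "norm (g1 + g2 - (2 * \<kappa>) *\<^sub>R x) < \<delta> \<and>
      (\<exists>X1 X2. transpose X1 = X1 \<and> transpose X2 = X2 \<and> second_order_at F1 x g1 X1 \<and> second_order_at F2 x g2 X2 \<and>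
         (\<forall>v. 0 \<le> v \<bullet> (X1 *v v)) \<and> (\<forall>v. 0 \<le> v \<bullet> (X2 *v v)) \<and>
         (\<forall>v. v \<bullet> (X1 *v v) + v \<bullet> (X2 *v v) \<le> 2 * \<kappa> * (norm v)\<^sup>2))"
    if g: "subgrad F1 x g1" "subgrad F2 x g2" for g1 g2
  proof -
    have l1: "F1 x + g1 \<bullet> v \<le> F1 (x + v)" and l2: "F2 x + g2 \<bullet> v \<le> F2 (x + v)" for v
      using g[unfolded subgrad_def] by (metis add_diff_cancel_left')+
    have "g1 + g2 - (p + (2 * \<kappa>) *\<^sub>R x) = 0"
    proof (rule linear_le_quadratic_imp_zero[of \<rho> \<kappa>])
      fix v :: "real^'n" assume "norm v \<le> \<rho>"
      then show "(g1 + g2 - (p + (2 * \<kappa>) *\<^sub>R x)) \<bullet> v \<le> \<kappa> * (norm v)\<^sup>2"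
        using up[of v] l1[of v] l2[of v] by (simp add: F_def inner_diff_left inner_add_left)
    qed (use \<rho> \<kappa> in auto)
    then have pe: "p = g1 + g2 - (2 * \<kappa>) *\<^sub>R x" "p + (2 * \<kappa>) *\<^sub>R x = g1 + g2" by (auto simp: algebra_simps)
    \<comment> \<open>Subtracting the supporting plane of \<open>F2\<close> from the upper
      paraboloid of the sum leaves an upper paraboloid for \<open>F1\<close> alone.\<close>
    have u1: "F1 y \<le> F1 x + g1 \<bullet> (y - x) + \<kappa> * (norm (y - x))\<^sup>2" if "norm (y - x) \<le> \<rho>" for y
      using up[OF that] l2[of "y - x"] unfolding pe(2) by (simp add: F_def inner_add_left)
    have u2: "F2 y \<le> F2 x + g2 \<bullet> (y - x) + \<kappa> * (norm (y - x))\<^sup>2" if "norm (y - x) \<le> \<rho>" for y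
      using up[OF that] l1[of "y - x"] unfolding pe(2) by (simp add: F_def inner_add_left)
    obtain A1 where A1: "linear A1" "\<And>\<eta>. \<eta> > 0 \<Longrightarrow> \<exists>r>0. \<forall>x' g'. norm (x' - x) < r \<and> subgrad F1 x' g' \<longrightarrow> norm (g' - g1 - A1 (x' - x)) \<le> \<eta> * norm (x' - x)"
      using subgrad_expansion[OF F(1) _ g(1) _ \<rho> u1] x(2) \<kappa> unfolding N_def by force
    obtain A2 where A2: "linear A2" "\<And>\<eta>. \<eta> > 0 \<Longrightarrow> \<exists>r>0. \<forall>x' g'. norm (x' - x) < r \<and> subgrad F2 x' g' \<longrightarrow> norm (g' - g2 - A2 (x' - x)) \<le> \<eta> * norm (x' - x)"
      using subgrad_expansion[OF F(2) _ g(2) _ \<rho> u2] x(2) \<kappa> unfolding N_def by force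
    obtain X1 where X1: "transpose X1 = X1" "second_order_at F1 x g1 X1" using subgrad_second_order[OF F(1) A1] by blast
    obtain X2 where X2: "transpose X2 = X2" "second_order_at F2 x g2 X2" using subgrad_second_order[OF F(2) A2] by blast
    have "second_order_at F x (g1 + g2) (X1 + X2)" unfolding F_def by (rule second_order_at_add[OF X1(2) X2(2)])
    then have "v \<bullet> ((X1 + X2) *v v) \<le> 2 * \<kappa> * (norm v)\<^sup>2" for v
      by (rule second_order_at_le[OF _ \<rho>]) (use up pe in auto)
    then have "v \<bullet> (X1 *v v) + v \<bullet> (X2 *v v) \<le> 2 * \<kappa> * (norm v)\<^sup>2" for v
      by (simp add: matrix_vector_mult_add_rdistrib inner_add_right)
    then show ?thesis using X1 X2 second_order_at_ge[OF X1(2) g(1)] second_order_at_ge[OF X2(2) g(2)] x(3) pe(1) by blast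
  qed
  show ?thesis by (rule that[of x]) (use x main in \<open>auto simp: F_def\<close>)
qed

section \<open>The comparison principle\<close>

definition psi_mat :: "real \<Rightarrow> real^'n \<Rightarrow> real^'n^'n \<Rightarrow> real^'n^'n" where
  "psi_mat v p X = exp (2 * v) *\<^sub>R (- X - outer_prod p + ((norm p)\<^sup>2 / 2) *\<^sub>R mat 1)"

text \<open>Since \<open>\<psi>\<close> is a decreasing function of \<open>u\<close>, a super-solution \<open>u\<close> corresponds to test functions
  touching \<open>\<psi>\<close> from above.\<close>

definition psi_super :: "(real^'n \<Rightarrow> real) \<Rightarrow> (real^'n) set \<Rightarrow> (real^'n) set \<Rightarrow> (real^'n \<Rightarrow> real) \<Rightarrow> bool" where
  "psi_super f \<Gamma> \<Omega> \<psi> \<longleftrightarrow>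
     (\<forall>x0\<in>\<Omega>. \<forall>phi g H. C2_near phi g H x0 \<and> touches_above phi \<psi> x0 \<longrightarrow>
        (\<forall>l. is_eigvals (psi_mat (phi x0) (g x0) (H x0)) l \<longrightarrow> l \<notin> closure \<Gamma> \<or> f l \<le> 1))"

definition psi_sub :: "(real^'n \<Rightarrow> real) \<Rightarrow> (real^'n) set \<Rightarrow> (real^'n) set \<Rightarrow> (real^'n \<Rightarrow> real) \<Rightarrow> bool" where
  "psi_sub f \<Gamma> \<Omega> \<psi> \<longleftrightarrow>
     (\<forall>x0\<in>\<Omega>. \<forall>phi g H. C2_near phi g H x0 \<and> touches_below phi \<psi> x0 \<longrightarrow>
        (\<forall>l. is_eigvals (psi_mat (phi x0) (g x0) (H x0)) l \<longrightarrow> l \<in> closure \<Gamma> \<and> f l \<ge> 1))"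

section \<open>Paraboloids as test functions, and the structural conditions on the closed
  cone\<close>

lemma C2_near_quadratic:
  fixes X :: "real^'n^'n"
  assumes X: "transpose X = X"
  shows "C2_near (\<lambda>y. c + p \<bullet> (y - z) + ((y - z) \<bullet> (X *v (y - z))) / 2) (\<lambda>y. p + X *v (y - z)) (\<lambda>_. X) z"
proof -
  have bl: "bounded_linear ((*v) X)" by (simp add: linear_linear)
  have d: "((\<lambda>y. X *v (y - z)) has_derivative (\<lambda>h. X *v h)) (at x)" for x
    by (rule bounded_linear.has_derivative[OF bl, THEN has_derivative_eq_rhs]) (auto intro!: derivative_eq_intros)
  have "((\<lambda>y. c + p \<bullet> (y - z) + ((y - z) \<bullet> (X *v (y - z))) / 2) has_derivative (\<lambda>h. (p + X *v (x - z)) \<bullet> h)) (at x)" for x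
  proof -
    have "((\<lambda>y. (y - z) \<bullet> (X *v (y - z))) has_derivative (\<lambda>h. (x - z) \<bullet> (X *v h) + h \<bullet> (X *v (x - z)))) (at x)"
      by (rule has_derivative_inner[OF _ d]) (auto intro!: derivative_eq_intros)
    then have "((\<lambda>y. (1/2) * ((y - z) \<bullet> (X *v (y - z)))) has_derivative (\<lambda>h. (1/2) * ((x - z) \<bullet> (X *v h) + h \<bullet> (X *v (x - z))))) (at x)"
      by (rule has_derivative_mult_right)
    moreover have "((\<lambda>y. c + p \<bullet> (y - z)) has_derivative (\<lambda>h. p \<bullet> h)) (at x)"
      by (auto intro!: derivative_eq_intros)
    ultimately have "((\<lambda>y. c + p \<bullet> (y - z) + (1/2) * ((y - z) \<bullet> (X *v (y - z)))) has_derivative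
       (\<lambda>h. p \<bullet> h + (1/2) * ((x - z) \<bullet> (X *v h) + h \<bullet> (X *v (x - z))))) (at x)"
      by (rule has_derivative_add[rotated])
    moreover have "(\<lambda>h. p \<bullet> h + (1/2) * ((x - z) \<bullet> (X *v h) + h \<bullet> (X *v (x - z)))) = (\<lambda>h. (p + X *v (x - z)) \<bullet> h)"
      using symmetric_inner[OF X, of "x - z"] by (auto simp: inner_add_right inner_commute[of _ "_ + _"] inner_commute)
    ultimately show ?thesis by simp
  qed
  moreover have "((\<lambda>y. p + X *v (y - z)) has_derivative (\<lambda>h. X *v h)) (at x)" for x
    by (rule has_derivative_eq_rhs[OF has_derivative_add[OF has_derivative_const d]]) simp
  ultimately show ?thesis unfolding C2_near_def by (intro exI[of _ 1]) auto
qed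

lemma psi_mat_quadratic_form:
  "v \<bullet> (psi_mat s p X *v v) = exp (2 * s) * (- (v \<bullet> (X *v v)) - (p \<bullet> v)\<^sup>2 + (norm p)\<^sup>2 / 2 * (norm v)\<^sup>2)"
proof -
  show ?thesis
    unfolding psi_mat_def scaleR_matrix_vector_assoc[symmetric] matrix_vector_mult_add_rdistrib matrix_vector_mult_diff_rdistrib
      outer_prod_vec minus_matrix_vector_mult power2_norm_eq_inner
    by (simp add: inner_diff_right inner_add_right power2_eq_square inner_commute)
qed

lemma psi_mat_symmetric:
  assumes "transpose X = X" shows "transpose (psi_mat s p X) = psi_mat s p X"
proof -
  have "X $ i $ j = X $ j $ i" for i j
  proof -
    have "transpose X $ i $ j = X $ j $ i" by (simp add: transpose_def)
    then show ?thesis using assms by simp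
  qed
  then show ?thesis by (auto simp: psi_mat_def transpose_def vec_eq_iff outer_prod_def mat_def mult.commute)
qed

lemma is_eigvals_affine:
  assumes "is_eigvals M l" shows "is_eigvals (t *\<^sub>R M - s *\<^sub>R mat 1) (\<chi> i. t * l $ i - s)"
proof -
  obtain Q where Q: "orthogonal_matrix Q" "M = Q ** diag_mat l ** transpose Q" using assms by (auto simp: is_eigvals_def)
  have e: "diag_mat (\<chi> i. t * l $ i - s) = t *\<^sub>R diag_mat l - s *\<^sub>R mat 1" by (simp add: diag_mat_def mat_def vec_eq_iff)
  have d: "A ** (B - C) = A ** B - A ** C" "(B - C) ** A = B ** A - C ** A" for A B C :: "real^'n^'n"
    by (simp_all add: matrix_matrix_mult_def vec_eq_iff algebra_simps sum_subtractf)
  have r: "A ** (c *\<^sub>R B) = c *\<^sub>R (A ** B)" "(c *\<^sub>R B) ** A = c *\<^sub>R (B ** A)" for A B :: "real^'n^'n" and c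
    by (simp_all add: matrix_matrix_mult_def vec_eq_iff sum_distrib_left algebra_simps)
  have "Q ** diag_mat (\<chi> i. t * l $ i - s) ** transpose Q = t *\<^sub>R M - s *\<^sub>R (Q ** mat 1 ** transpose Q)"
    unfolding e d r Q(2) ..
  also have "Q ** mat 1 ** transpose Q = mat 1" using Q(1) by (simp add: orthogonal_matrix_def)
  finally show ?thesis unfolding is_eigvals_def using Q(1) by metis
qed

text \<open>The structural condition speaks of strictly positive increments. Adding
  \<open>1/n\<close> to every coordinate of \<open>c\<close> makes the increment strict, and
  continuity of \<open>f\<close> on the closure allows the limit.\<close>

lemma structural_mono_closure:
  fixes b c :: "real^'n"
  assumes st: "structural f \<Gamma>" and b: "b \<in> \<Gamma>" and le: "\<And>i. b $ i \<le> c $ i"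
  shows "c \<in> closure \<Gamma>" "f b \<le> f c"
proof -
  define e where "e = (\<lambda>n. c + inverse (real (Suc n)) *\<^sub>R (\<chi> i. 1))"
  have lim: "e \<longlonglongrightarrow> c"
  proof -
    have "e \<longlonglongrightarrow> c + 0 *\<^sub>R (\<chi> i. 1)" unfolding e_def by (intro tendsto_intros LIMSEQ_inverse_real_of_nat)
    then show ?thesis by simp
  qed
  have e: "e n = b + (e n - b)" "(e n - b) $ i > 0" for n i
  proof -
    have "inverse (real (Suc n)) > 0" by simp
    then show "(e n - b) $ i > 0" using le[of i] by (simp add: e_def del: of_nat_Suc inverse_positive_iff_positive)
  qed simp
  have eG: "e n \<in> \<Gamma>" "f b \<le> f (e n)" for n
    using st b e[of n] unfolding structural_def by metis+
  show cG: "c \<in> closure \<Gamma>" using lim eG(1) closure_sequential by blast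
  have "continuous_on (closure \<Gamma>) f" using st by (simp add: structural_def)
  then have "(\<lambda>n. f (e n)) \<longlonglongrightarrow> f c"
    using lim cG eG(1) subsetD[OF closure_subset[of \<Gamma>]] unfolding continuous_on_sequentially o_def by blast
  then show "f b \<le> f c" by (rule tendsto_lowerbound) (use eG in auto)
qed

lemma closure_image_subset:
  assumes "continuous_on UNIV h" "h ` A \<subseteq> A" shows "h ` closure A \<subseteq> closure A"
  using image_closure_subset[of A h "closure A"] assms closure_subset continuous_on_subset by fastforce

lemma structural_scale:
  fixes l :: "real^'n"
  assumes st: "structural f \<Gamma>" and l: "l \<in> closure \<Gamma>" and t: "t > 0"
  shows "t *\<^sub>R l \<in> closure \<Gamma>"
proof -
  have "(\<lambda>l. t *\<^sub>R l) ` closure \<Gamma> \<subseteq> closure \<Gamma>"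
    by (rule closure_image_subset) (use st t in \<open>auto simp: structural_def intro!: continuous_intros\<close>)
  then show ?thesis using l by auto
qed

lemma structural_permute:
  fixes l :: "real^'n"
  assumes st: "structural f \<Gamma>" and p: "p permutes UNIV" and l: "permute_vec p l \<in> closure \<Gamma>"
  shows "l \<in> closure \<Gamma>" "f (permute_vec p l) = f l"
proof -
  have inv: "permute_vec (inv p) (permute_vec p l) = l"
    using p by (simp add: permute_vec_def vec_eq_iff permutes_inverses)
  have "permute_vec (inv p) ` closure \<Gamma> \<subseteq> closure \<Gamma>"
    by (rule closure_image_subset) (use st permutes_inv[OF p] in \<open>auto simp: structural_def permute_vec_def intro!: continuous_intros continuous_on_vec_lambda\<close>)
  then show "l \<in> closure \<Gamma>" using l inv by (metis image_subset_iff)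
  then show "f (permute_vec p l) = f l" using st p by (simp add: structural_def)
qed

text \<open>\<open>F x\<close> is the sup-convolution of \<open>\<psi>\<close> over \<open>K\<close>
  plus \<open>k/2 * (norm x)\<^sup>2\<close>. Expanding the square makes it a supremum of affine
  functions of \<open>x\<close>, hence convex, with the slope \<open>k *\<^sub>R Z x\<close> of the
  maximising one as a subgradient.\<close>

lemma supconv_maximizer:
  fixes \<psi> :: "real^'n \<Rightarrow> real"
  assumes K: "compact K" "K \<noteq> {}" and c: "continuous_on K \<psi>" and k: "k > 0"
  obtains F Z where "\<And>x. Z x \<in> K" "\<And>x. F x = \<psi> (Z x) - k/2 * (norm (Z x))\<^sup>2 + k * (x \<bullet> Z x)"
    "\<And>x z. z \<in> K \<Longrightarrow> \<psi> z - k/2 * (norm z)\<^sup>2 + k * (x \<bullet> z) \<le> F x"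
    "\<And>x. subgrad F x (k *\<^sub>R Z x)" "\<And>R. K \<subseteq> cball 0 R \<Longrightarrow> subdifferentiable_bdd (k * R) F"
proof -
  define q where "q = (\<lambda>x z. \<psi> z - k/2 * (norm z)\<^sup>2 + k * (x \<bullet> z))"
  have "\<exists>z\<in>K. \<forall>z'\<in>K. q x z' \<le> q x z" for x
    unfolding q_def by (intro continuous_attains_sup K continuous_intros c)
  then obtain Z where Z: "\<And>x. Z x \<in> K" "\<And>x z. z \<in> K \<Longrightarrow> q x z \<le> q x (Z x)" by metis
  define F where "F = (\<lambda>x. q x (Z x))"
  have sg: "subgrad F x (k *\<^sub>R Z x)" for x
    unfolding subgrad_def
  proof
    fix y
    have "q y (Z x) \<le> F y" using Z by (simp add: F_def)
    moreover have "q y (Z x) = F x + (k *\<^sub>R Z x) \<bullet> (y - x)" by (simp add: F_def q_def inner_diff_right inner_commute algebra_simps)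
    ultimately show "F x + (k *\<^sub>R Z x) \<bullet> (y - x) \<le> F y" by simp
  qed
  show ?thesis
  proof (rule that[of Z F])
    show "subdifferentiable_bdd (k * R) F" if "K \<subseteq> cball 0 R" for R
      unfolding subdifferentiable_bdd_def
    proof (intro allI exI conjI)
      fix x show "norm (k *\<^sub>R Z x) \<le> k * R" using Z(1)[of x] that k by (auto intro!: mult_left_mono)
    qed (rule sg)
  qed (use Z sg in \<open>auto simp: F_def q_def\<close>)
qed

lemma supconv_value:
  "\<psi> z - k/2 * (norm z)\<^sup>2 + k * (x \<bullet> z) = \<psi> z - k/2 * (norm (x - z))\<^sup>2 + k/2 * (norm x)\<^sup>2"
  for x z :: "real^'n"
  unfolding power2_norm_eq_inner by (simp add: inner_diff_left inner_diff_right inner_commute algebra_simps)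

text \<open>A second order expansion of a sup-convolution at \<open>x\<close> is transported by translation to the
  maximising point \<open>z\<close>.\<close>

lemma supconv_touch:
  fixes \<psi> :: "real^'n \<Rightarrow> real"
  assumes F: "\<And>y z. z \<in> K \<Longrightarrow> \<psi> z - k/2 * (norm z)\<^sup>2 + k * (y \<bullet> z) \<le> F y"
    and Fx: "F x = \<psi> z - k/2 * (norm z)\<^sup>2 + k * (x \<bullet> z)"
    and so: "second_order_at F x (k *\<^sub>R z) X" and \<eta>: "\<eta> > 0" and D: "open D" "D \<subseteq> K" "z \<in> D"
  shows "\<exists>r>0. \<forall>y\<in>ball z r. \<psi> y \<le> \<psi> z + (k *\<^sub>R (z - x)) \<bullet> (y - z) + ((y - z) \<bullet> ((X - (k - 2*\<eta>) *\<^sub>R mat 1) *v (y - z))) / 2"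
proof -
  obtain r1 where r1: "r1 > 0" "\<And>h. norm h < r1 \<Longrightarrow> \<bar>F (x + h) - F x - (k *\<^sub>R z) \<bullet> h - (h \<bullet> (X *v h)) / 2\<bar> \<le> \<eta> * (norm h)\<^sup>2"
    using so \<eta> unfolding second_order_at_def by blast
  obtain r2 where r2: "r2 > 0" "ball z r2 \<subseteq> D" using D openE by blast
  show ?thesis
  proof (intro exI[of _ "min r1 r2"] conjI ballI)
    show "0 < min r1 r2" using r1 r2 by simp
    fix y assume y: "y \<in> ball z (min r1 r2)"
    define h where "h = y - z"
    have yz: "y = z + h" by (simp add: h_def)
    have hr: "norm h < r1" "y \<in> K" using y r2(2) D(2) by (auto simp: h_def dist_norm norm_minus_commute dest!: subsetD)
    \<comment> \<open>Moving the point and the competitor by the same \<open>h\<close> leaves the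
      penalty unchanged, so the expansion of \<open>F\<close> passes directly to
      \<open>\<psi>\<close>.\<close>
    have xh: "(x + h) - y = x - z" by (simp add: h_def)
    have 1: "\<psi> y - k/2 * (norm (x - z))\<^sup>2 + k/2 * (norm (x + h))\<^sup>2 \<le> F (x + h)"
      using F[OF hr(2), of "x + h"] unfolding supconv_value xh .
    have 2: "F x = \<psi> z - k/2 * (norm (x - z))\<^sup>2 + k/2 * (norm x)\<^sup>2" unfolding Fx supconv_value ..
    have 3: "F (x + h) \<le> F x + (k *\<^sub>R z) \<bullet> h + (h \<bullet> (X *v h)) / 2 + \<eta> * (norm h)\<^sup>2" using r1(2)[OF hr(1)] by linarith
    have 4: "k/2 * (norm (x + h))\<^sup>2 = k/2 * (norm x)\<^sup>2 + k * (x \<bullet> h) + k/2 * (norm h)\<^sup>2"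
      unfolding power2_norm_eq_inner by (simp add: inner_add_left inner_add_right inner_commute algebra_simps)
    have 5: "h \<bullet> ((X - (k - 2*\<eta>) *\<^sub>R mat 1) *v h) = h \<bullet> (X *v h) - (k - 2*\<eta>) * (norm h)\<^sup>2"
      by (simp add: matrix_vector_mult_diff_rdistrib scaleR_matrix_vector_assoc[symmetric] inner_diff_right power2_norm_eq_inner)
    have 6: "(k *\<^sub>R (z - x)) \<bullet> h = (k *\<^sub>R z) \<bullet> h - k * (x \<bullet> h)" by (simp add: inner_diff_left algebra_simps)
    have "\<psi> y \<le> \<psi> z + (k *\<^sub>R (z - x)) \<bullet> h + (h \<bullet> ((X - (k - 2*\<eta>) *\<^sub>R mat 1) *v h)) / 2"
      using 1 2 3 4 unfolding 5 6 by (simp add: field_simps)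
    then show "\<psi> y \<le> \<psi> z + (k *\<^sub>R (z - x)) \<bullet> (y - z) + ((y - z) \<bullet> ((X - (k - 2*\<eta>) *\<^sub>R mat 1) *v (y - z))) / 2"
      by (simp add: h_def)
  qed
qed


text \<open>At a near-maximum of the regularised difference the matrix for \<open>\<psi>1\<close>
  dominates \<open>t > 1\<close> times the matrix for \<open>\<psi>2\<close>, up to an error of size
  \<open>\<delta>\<close>. Homogeneity makes \<open>f\<close> exceed 1 there, against the
  super-solution property of \<open>\<psi>1\<close>.\<close>

lemma comparison_principle:
  fixes \<psi>1 \<psi>2 :: "real^'n \<Rightarrow> real"
  assumes st: "structural f \<Gamma>" and D: "open D" "bounded D"
    and c: "continuous_on (closure D) \<psi>1" "continuous_on (closure D) \<psi>2"
    and sup: "psi_super f \<Gamma> D \<psi>1" and sub: "psi_sub f \<Gamma> D \<psi>2"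
    and bd: "\<And>x. x \<in> closure D - D \<Longrightarrow> \<psi>1 x \<le> \<psi>2 x" and x: "x \<in> closure D"
  shows "\<psi>1 x \<le> \<psi>2 x"
proof (rule ccontr)
  assume neg: "\<not> \<psi>1 x \<le> \<psi>2 x"
  define K where "K = closure D"
  have K: "compact K" "K \<noteq> {}" "D \<subseteq> K" using D x closure_subset by (auto simp: K_def)
  have cK: "continuous_on K \<psi>1" "continuous_on K \<psi>2" using c by (auto simp: K_def)
  define m where "m = \<psi>1 x - \<psi>2 x"
  have m: "m > 0" using neg by (simp add: m_def)
  have xK: "x \<in> K" using x by (simp add: K_def)
  obtain A where A: "\<And>z. z \<in> K \<Longrightarrow> \<bar>\<psi>1 z\<bar> \<le> A" "\<And>z. z \<in> K \<Longrightarrow> \<bar>\<psi>2 z\<bar> \<le> A" "A \<ge> 0"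
  proof -
    obtain A1 where A1: "\<And>z. z \<in> K \<Longrightarrow> \<bar>\<psi>1 z\<bar> \<le> A1"
      using compact_imp_bounded[OF compact_continuous_image[OF cK(1) K(1)]] by (auto simp: bounded_iff)
    obtain A2 where A2: "\<And>z. z \<in> K \<Longrightarrow> \<bar>\<psi>2 z\<bar> \<le> A2"
      using compact_imp_bounded[OF compact_continuous_image[OF cK(2) K(1)]] by (auto simp: bounded_iff)
    show ?thesis using that[of "max A1 A2"] A1 A2 xK by (metis abs_ge_zero max.coboundedI1 max.coboundedI2 order_trans)
  qed
  obtain R1 where R1: "K \<subseteq> cball 0 R1" "R1 \<ge> 0"
  proof -
    obtain b where "\<And>z. z \<in> K \<Longrightarrow> norm z \<le> b" using compact_imp_bounded[OF K(1)] by (auto simp: bounded_iff)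
    then have "K \<subseteq> cball 0 (max b 0)" by (auto simp: le_max_iff_disj)
    then show ?thesis using that[of "max b 0"] by simp
  qed
  obtain \<omega> where \<omega>: "\<omega> > 0" "\<And>z z'. \<lbrakk>z \<in> K; z' \<in> K; norm (z - z') < \<omega>\<rbrakk> \<Longrightarrow> \<bar>\<psi>1 z - \<psi>1 z'\<bar> < m/2"
      "\<And>z z'. \<lbrakk>z \<in> K; z' \<in> K; norm (z - z') < \<omega>\<rbrakk> \<Longrightarrow> \<bar>\<psi>2 z - \<psi>2 z'\<bar> < m/2"
  proof -
    have u: "uniformly_continuous_on K \<psi>1" "uniformly_continuous_on K \<psi>2" using cK K(1) compact_uniformly_continuous by auto
    obtain w1 where w1: "w1 > 0" "\<And>z z'. z \<in> K \<Longrightarrow> z' \<in> K \<Longrightarrow> dist z' z < w1 \<Longrightarrow> dist (\<psi>1 z') (\<psi>1 z) < m/2"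
      using u(1) m unfolding uniformly_continuous_on_def by (metis half_gt_zero)
    obtain w2 where w2: "w2 > 0" "\<And>z z'. z \<in> K \<Longrightarrow> z' \<in> K \<Longrightarrow> dist z' z < w2 \<Longrightarrow> dist (\<psi>2 z') (\<psi>2 z) < m/2"
      using u(2) m unfolding uniformly_continuous_on_def by (metis half_gt_zero)
    show ?thesis by (rule that[of "min w1 w2"]) (use w1 w2 in \<open>auto simp: dist_norm dist_real_def\<close>)
  qed
  \<comment> \<open>Since the maximal value is at least \<open>m/2\<close>, the penalties total at
    most \<open>2 * A\<close>, whence \<open>k * (norm (z1 - z2))\<^sup>2 \<le> 8 * A\<close>. This
    choice of \<open>k\<close> brings the contact points within the modulus of continuity
    \<open>\<omega>\<close>.\<close>
  define k where "k = 16 * (A + 1) / \<omega>\<^sup>2"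
  have k: "k > 0" "16 * (A + 1) = k * \<omega>\<^sup>2" using \<omega>(1) A(3) by (auto simp: k_def)
  obtain F1 Z1 where F1: "\<And>x. Z1 x \<in> K" "\<And>x. F1 x = \<psi>1 (Z1 x) - k/2 * (norm (Z1 x))\<^sup>2 + k * (x \<bullet> Z1 x)"
    "\<And>x z. z \<in> K \<Longrightarrow> \<psi>1 z - k/2 * (norm z)\<^sup>2 + k * (x \<bullet> z) \<le> F1 x"
    "\<And>x. subgrad F1 x (k *\<^sub>R Z1 x)" "subdifferentiable_bdd (k * R1) F1"
    using supconv_maximizer[OF K(1,2) cK(1) k(1)] R1(1) by metis
  obtain F2 Z2 where F2: "\<And>x. Z2 x \<in> K" "\<And>x. F2 x = - \<psi>2 (Z2 x) - k/2 * (norm (Z2 x))\<^sup>2 + k * (x \<bullet> Z2 x)"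
    "\<And>x z. z \<in> K \<Longrightarrow> - \<psi>2 z - k/2 * (norm z)\<^sup>2 + k * (x \<bullet> z) \<le> F2 x"
    "\<And>x. subgrad F2 x (k *\<^sub>R Z2 x)" "subdifferentiable_bdd (k * R1) F2"
    using supconv_maximizer[OF K(1,2) continuous_on_minus[OF cK(2)] k(1)] R1(1) by metis
  \<comment> \<open>The sup-convolution of \<open>\<psi>1\<close> minus the inf-convolution of
    \<open>\<psi>2\<close>: the two paraboloids added for convexity are removed again.\<close>
  define h where "h = (\<lambda>y. F1 y + F2 y - k * (norm y)\<^sup>2)"
  have hval: "h y = \<psi>1 (Z1 y) - \<psi>2 (Z2 y) - k/2 * (norm (y - Z1 y))\<^sup>2 - k/2 * (norm (y - Z2 y))\<^sup>2" for y
    unfolding h_def F1(2) F2(2) supconv_value[of \<psi>1] supconv_value[of "\<lambda>z. - \<psi>2 z"] by simp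
  have hx: "h x \<ge> m"
    using F1(3)[OF xK, of x] F2(3)[OF xK, of x] unfolding h_def m_def supconv_value[of \<psi>1] supconv_value[of "\<lambda>z. - \<psi>2 z"] by simp
  \<comment> \<open>On the sphere of radius \<open>R\<close> each penalty is at least
    \<open>A\<close>, so \<open>h\<close> is nonpositive there, while
    \<open>h x \<ge> m\<close>.\<close>
  define R where "R = R1 + 1 + 2 * A / k"
  have RR: "R1 < R" using A(3) k(1) by (simp add: R_def add_pos_nonneg)
  have hR: "h y \<le> 0" if y: "norm y = R" for y
  proof -
    have n: "(norm (y - z))\<^sup>2 \<ge> 2 * A / k" if "z \<in> K" for z
    proof -
      have "1 + 2 * A / k \<le> norm (y - z)" using norm_triangle_ineq2[of y z] y R1(1) that by (force simp: R_def)
      moreover have "1 + 2 * A / k \<le> (1 + 2 * A / k)\<^sup>2" using A(3) k(1) by (intro self_le_power) auto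
      moreover have "(1 + 2 * A / k)\<^sup>2 \<le> (norm (y - z))\<^sup>2" using calculation(1) A(3) k(1) by (intro power_mono) auto
      ultimately show ?thesis by linarith
    qed
    have "k/2 * (2 * A / k) \<le> k/2 * (norm (y - Z1 y))\<^sup>2" "k/2 * (2 * A / k) \<le> k/2 * (norm (y - Z2 y))\<^sup>2"
      using n[OF F1(1)[of y]] n[OF F2(1)[of y]] k(1) by (intro mult_left_mono; simp)+
    moreover have "k/2 * (2 * A / k) = A" using k(1) by simp
    ultimately show ?thesis using hval[of y] A(1)[OF F1(1)[of y]] A(2)[OF F2(1)[of y]] by linarith
  qed
  obtain d where d: "d > 0" "\<And>l t. l \<in> closure \<Gamma> \<Longrightarrow> t > 0 \<Longrightarrow> f (t *\<^sub>R l) = t powr d * f l"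
    using st unfolding structural_def by metis
  define P where "P = k * (R1 + R)"
  have P: "P \<ge> 0" using k(1) R1(2) RR by (auto simp: P_def)
  \<comment> \<open>Bounds the eigenvalues at the second contact point for every
    \<open>\<delta> \<le> 1\<close>; it must not depend on \<open>\<delta>\<close>, which is chosen
    later.\<close>
  define C0 where "C0 = exp (2 * A) * (k + 2 + 2 * P\<^sup>2)"
  define R3 where "R3 = real CARD('n) * (exp (4 * A) * C0)"
  define S where "S = {l \<in> closure \<Gamma>. exp (m/2 * d) \<le> f l} \<inter> cball 0 R3"
  have cf: "continuous_on (closure \<Gamma>) f" using st by (simp add: structural_def)
  have "closed {l \<in> closure \<Gamma>. exp (m/2 * d) \<le> f l}"
    using continuous_closed_preimage[OF cf closed_closure, of "{exp (m/2 * d)..}"] by (simp add: vimage_def Int_def)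
  then have cS: "compact S" unfolding S_def by (rule closed_Int_compact) simp
  define G where "G = {l \<in> \<Gamma>. 1 < f l}"
  have oG: "open G"
  proof -
    have "open \<Gamma>" using st by (simp add: structural_def)
    moreover have "continuous_on \<Gamma> f" using cf closure_subset continuous_on_subset by blast
    ultimately have "open (\<Gamma> \<inter> f -` {1<..})" using continuous_open_preimage open_greaterThan by blast
    then show ?thesis by (simp add: G_def vimage_def Int_def)
  qed
  \<comment> \<open>A point of the closure with \<open>f > 1\<close> cannot lie on the frontier,
    where \<open>f\<close> vanishes.\<close>
  have SG: "S \<subseteq> G"
  proof
    fix l assume l: "l \<in> S"
    have "exp (m/2 * d) > 1" using m d(1) by simp
    moreover have "exp (m/2 * d) \<le> f l" using l unfolding S_def by blast
    ultimately have "f l > 1" by linarith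
    moreover have "l \<in> \<Gamma>"
    proof (rule ccontr)
      assume "l \<notin> \<Gamma>"
      then have "l \<in> frontier \<Gamma>" using l st by (auto simp: S_def frontier_def structural_def interior_open)
      then show False using st \<open>f l > 1\<close> by (auto simp: structural_def)
    qed
    ultimately show "l \<in> G" by (simp add: G_def)
  qed
  \<comment> \<open>The vector \<open>t *\<^sub>R l2\<close> will lie in the compact set
    \<open>S\<close>; within distance \<open>e0\<close> of it, membership in \<open>\<Gamma>\<close>
    and \<open>f > 1\<close> persist.\<close>
  obtain e0 where e0: "e0 > 0" "(\<Union>l\<in>S. ball l e0) \<subseteq> G"
    using compact_subset_open_imp_ball_epsilon_subset[OF cS oG SG] by blast
  \<comment> \<open>\<open>\<delta> * Q\<close> bounds the shift of the eigenvalue vector in the sum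
    norm; the added 1 only makes \<open>Q\<close> positive.\<close>
  define Q where "Q = real CARD('n) * (exp (2 * A) * (4 + 3 * P)) + 1"
  have Q: "Q > 0" using P by (auto simp: Q_def intro!: add_nonneg_pos mult_nonneg_nonneg)
  define \<delta> where "\<delta> = min 1 (e0 / (2 * Q))"
  have \<delta>: "\<delta> > 0" "\<delta> \<le> 1" "\<delta> * Q < e0"
  proof -
    show "\<delta> > 0" "\<delta> \<le> 1" using e0 Q by (auto simp: \<delta>_def)
    have "\<delta> * Q \<le> (e0 / (2 * Q)) * Q" using Q by (intro mult_right_mono) (auto simp: \<delta>_def)
    then show "\<delta> * Q < e0" using Q e0(1) by simp
  qed
  have xR: "norm x < R" using xK R1(1) RR by force
  obtain y where y: "norm y < R" "h x - m/2 \<le> h y"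
    "\<And>g1 g2. subgrad F1 y g1 \<Longrightarrow> subgrad F2 y g2 \<Longrightarrow> norm (g1 + g2 - (2 * k) *\<^sub>R y) < \<delta> \<and>
      (\<exists>X1 X2. transpose X1 = X1 \<and> transpose X2 = X2 \<and> second_order_at F1 y g1 X1 \<and> second_order_at F2 y g2 X2 \<and>
         (\<forall>v. 0 \<le> v \<bullet> (X1 *v v)) \<and> (\<forall>v. 0 \<le> v \<bullet> (X2 *v v)) \<and>
         (\<forall>v. v \<bullet> (X1 *v v) + v \<bullet> (X2 *v v) \<le> 2 * k * (norm v)\<^sup>2))"
  proof (rule jensen_second_order[OF F1(5) F2(5) k(1) xR m \<delta>(1)])
    show "F1 y + F2 y - k * (norm y)\<^sup>2 \<le> F1 x + F2 x - k * (norm x)\<^sup>2 - m" if "norm y = R" for y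
      using hR[OF that] hx by (simp add: h_def)
  qed (use that in \<open>auto simp: h_def\<close>)
  define z1 z2 where "z1 = Z1 y" and "z2 = Z2 y"
  obtain X1 X2 where X: "transpose X1 = X1" "transpose X2 = X2" "second_order_at F1 y (k *\<^sub>R z1) X1"
      "second_order_at F2 y (k *\<^sub>R z2) X2" "\<And>v. 0 \<le> v \<bullet> (X1 *v v)" "\<And>v. 0 \<le> v \<bullet> (X2 *v v)"
      "\<And>v. v \<bullet> (X1 *v v) + v \<bullet> (X2 *v v) \<le> 2 * k * (norm v)\<^sup>2"
    and pd: "norm (k *\<^sub>R z1 + k *\<^sub>R z2 - (2 * k) *\<^sub>R y) < \<delta>"
    using y(3)[OF F1(4)[of y] F2(4)[of y]] unfolding z1_def z2_def by blast
  have zK: "z1 \<in> K" "z2 \<in> K" using F1(1) F2(1) by (auto simp: z1_def z2_def)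
  have hy: "m/2 \<le> \<psi>1 z1 - \<psi>2 z2 - k/2 * (norm (y - z1))\<^sup>2 - k/2 * (norm (y - z2))\<^sup>2"
    using y(2) hx hval[of y] by (simp add: z1_def z2_def)
  have pos: "0 \<le> k/2 * (norm (y - z1))\<^sup>2" "0 \<le> k/2 * (norm (y - z2))\<^sup>2" using k(1) by auto
  have gap: "\<psi>1 z1 - \<psi>2 z2 \<ge> m/2" using hy pos by linarith
  have near: "norm (z1 - z2) < \<omega>"
  proof -
    have "k/2 * (norm (y - z1))\<^sup>2 + k/2 * (norm (y - z2))\<^sup>2 \<le> 2 * A" using hy A(1)[OF zK(1)] A(2)[OF zK(2)] m by linarith
    moreover have "(norm (z1 - z2))\<^sup>2 \<le> 2 * (norm (y - z1))\<^sup>2 + 2 * (norm (y - z2))\<^sup>2"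
    proof -
      have "norm (z1 - z2) \<le> norm (y - z1) + norm (y - z2)" using norm_triangle_ineq4[of "y - z2" "y - z1"] by simp
      then have "(norm (z1 - z2))\<^sup>2 \<le> (norm (y - z1) + norm (y - z2))\<^sup>2" by (intro power_mono) auto
      also have "\<dots> \<le> 2 * (norm (y - z1))\<^sup>2 + 2 * (norm (y - z2))\<^sup>2" using sum_squares_bound[of "norm (y - z1)" "norm (y - z2)"] by (simp add: power2_sum)
      finally show ?thesis .
    qed
    ultimately have "k * (norm (z1 - z2))\<^sup>2 \<le> 8 * A" using k(1) mult_left_mono[of "(norm (z1 - z2))\<^sup>2" "2 * (norm (y - z1))\<^sup>2 + 2 * (norm (y - z2))\<^sup>2" k] by (simp add: algebra_simps)
    also have "\<dots> < k * \<omega>\<^sup>2" unfolding k(2)[symmetric] using A(3) by simp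
    finally have "(norm (z1 - z2))\<^sup>2 < \<omega>\<^sup>2" using k(1) by simp
    then show ?thesis using \<omega>(1) by (simp add: power2_less_imp_less)
  qed
  \<comment> \<open>A contact point on the boundary would give \<open>\<psi>1 \<le> \<psi>2\<close>
    there; the modulus of continuity moves this to the other point and contradicts the gap
    \<open>m/2\<close>.\<close>
  have zD: "z1 \<in> D" "z2 \<in> D"
  proof -
    show "z1 \<in> D"
    proof (rule ccontr)
      assume "z1 \<notin> D"
      then have "\<psi>1 z1 \<le> \<psi>2 z1" using bd zK by (simp add: K_def)
      then show False using \<omega>(3)[OF zK near] gap by linarith
    qed
    show "z2 \<in> D"
    proof (rule ccontr)
      assume "z2 \<notin> D"
      then have "\<psi>1 z2 \<le> \<psi>2 z2" using bd zK by (simp add: K_def)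
      then show False using \<omega>(2)[OF zK near] gap by linarith
    qed
  qed
  \<comment> \<open>The gradients of the touching paraboloids; their difference is the slope that
    Jensen's argument makes smaller than \<open>\<delta>\<close>.\<close>
  define p1 p2 where "p1 = k *\<^sub>R (z1 - y)" and "p2 = k *\<^sub>R (y - z2)"
  define Y1 where "Y1 = X1 - (k - 2 * \<delta>) *\<^sub>R mat 1"
  \<comment> \<open>The bound on \<open>X1\<close> and \<open>X2\<close> together gives
    \<open>Y1 \<le> Y2 + 4 * \<delta>\<close> as quadratic forms.\<close>
  define Y2 where "Y2 = - (X2 - (k - 2 * \<delta>) *\<^sub>R mat 1)"
  have sY: "transpose Y1 = Y1" "transpose Y2 = Y2"
  proof -
    have s: "transpose (X - c *\<^sub>R mat 1) = X - c *\<^sub>R mat 1" if "transpose X = X" for X :: "real^'n^'n" and c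
    proof -
      have "transpose (X - c *\<^sub>R mat 1) = transpose X - c *\<^sub>R mat 1" by (auto simp: transpose_def vec_eq_iff mat_def)
      then show ?thesis using that by simp
    qed
    have mn: "transpose (- X) = - transpose X" for X :: "real^'n^'n" by (simp add: transpose_def vec_eq_iff)
    show "transpose Y1 = Y1" "transpose Y2 = Y2" unfolding Y1_def Y2_def mn by (auto simp: s X)
  qed
  have qY: "v \<bullet> (Y1 *v v) = v \<bullet> (X1 *v v) - (k - 2 * \<delta>) * (norm v)\<^sup>2"
           "v \<bullet> (Y2 *v v) = - (v \<bullet> (X2 *v v)) + (k - 2 * \<delta>) * (norm v)\<^sup>2" for v
  proof -
    show "v \<bullet> (Y1 *v v) = v \<bullet> (X1 *v v) - (k - 2 * \<delta>) * (norm v)\<^sup>2"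
         "v \<bullet> (Y2 *v v) = - (v \<bullet> (X2 *v v)) + (k - 2 * \<delta>) * (norm v)\<^sup>2"
      unfolding Y1_def Y2_def minus_matrix_vector_mult
      by (simp_all add: matrix_vector_mult_diff_rdistrib scaleR_matrix_vector_assoc[symmetric] inner_diff_right power2_norm_eq_inner)
  qed
  obtain l1 where l1: "is_eigvals (psi_mat (\<psi>1 z1) p1 Y1) l1" using is_eigvals_exists[OF psi_mat_symmetric[OF sY(1)]] by blast
  obtain l2 where l2: "is_eigvals (psi_mat (\<psi>2 z2) p2 Y2) l2" using is_eigvals_exists[OF psi_mat_symmetric[OF sY(2)]] by blast
  have s1: "l1 \<notin> closure \<Gamma> \<or> f l1 \<le> 1"
  proof -
    define phi where "phi = (\<lambda>w. \<psi>1 z1 + p1 \<bullet> (w - z1) + ((w - z1) \<bullet> (Y1 *v (w - z1))) / 2)"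
    have "C2_near phi (\<lambda>w. p1 + Y1 *v (w - z1)) (\<lambda>_. Y1) z1" unfolding phi_def by (rule C2_near_quadratic[OF sY(1)])
    moreover have "touches_above phi \<psi>1 z1"
      using supconv_touch[OF F1(3) F1(2)[of y, folded z1_def] X(3) \<delta>(1) D(1) K(3) zD(1)]
      unfolding touches_above_def phi_def p1_def Y1_def by simp
    ultimately show ?thesis using sup zD(1) l1 unfolding psi_super_def by (fastforce simp: phi_def)
  qed
  have s2: "l2 \<in> closure \<Gamma> \<and> f l2 \<ge> 1"
  proof -
    define phi where "phi = (\<lambda>w. \<psi>2 z2 + p2 \<bullet> (w - z2) + ((w - z2) \<bullet> (Y2 *v (w - z2))) / 2)"
    have "C2_near phi (\<lambda>w. p2 + Y2 *v (w - z2)) (\<lambda>_. Y2) z2" unfolding phi_def by (rule C2_near_quadratic[OF sY(2)])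
    moreover have "touches_below phi \<psi>2 z2"
    proof -
      obtain r where r: "r > 0" "\<And>w. w \<in> ball z2 r \<Longrightarrow> - \<psi>2 w \<le> - \<psi>2 z2 + (k *\<^sub>R (z2 - y)) \<bullet> (w - z2) + ((w - z2) \<bullet> ((X2 - (k - 2*\<delta>) *\<^sub>R mat 1) *v (w - z2))) / 2"
        using supconv_touch[OF F2(3) F2(2)[of y, folded z2_def] X(4) \<delta>(1) D(1) K(3) zD(2)] by blast
      have neg: "Y2 *v v = - ((X2 - (k - 2*\<delta>) *\<^sub>R mat 1) *v v)" for v
        unfolding Y2_def by (rule minus_matrix_vector_mult)
      have "p2 = - (k *\<^sub>R (z2 - y))" by (simp add: p2_def algebra_simps)
      then have "phi w \<le> \<psi>2 w" if "w \<in> ball z2 r" for w using r(2)[OF that] by (simp add: phi_def neg)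
      then show ?thesis unfolding touches_below_def using r(1) by (auto simp: phi_def)
    qed
    ultimately show ?thesis using sub zD(2) l2 unfolding psi_sub_def by (fastforce simp: phi_def)
  qed
  \<comment> \<open>The ratio of the exponential factors at the two contact points.\<close>
  define t where "t = exp (2 * (\<psi>1 z1 - \<psi>2 z2))"
  \<comment> \<open>The three contributions are \<open>4 * \<delta>\<close> from the Hessians,
    \<open>2 * P * \<delta>\<close> from the outer products and \<open>P * \<delta>\<close> from the
    squared norms of the gradients.\<close>
  define s where "s = exp (2 * A) * ((4 + 3 * P) * \<delta>)"
  define b where "b = (\<chi> i. t * l2 $ i - s)"
  have pn: "norm p1 \<le> P" "norm p2 \<le> P" "norm (p1 - p2) \<le> \<delta>"
  proof -
    have zn: "norm z1 \<le> R1" "norm z2 \<le> R1" using zK R1(1) by auto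
    show "norm p1 \<le> P" using norm_triangle_ineq4[of z1 y] zn y(1) k(1) unfolding p1_def P_def by (auto intro!: mult_left_mono)
    show "norm p2 \<le> P" using norm_triangle_ineq4[of y z2] zn y(1) k(1) unfolding p2_def P_def by (auto intro!: mult_left_mono)
    have "p1 - p2 = k *\<^sub>R z1 + k *\<^sub>R z2 - (2 * k) *\<^sub>R y" unfolding p1_def p2_def by (simp add: algebra_simps scaleR_2 flip: scaleR_scaleR)
    then show "norm (p1 - p2) \<le> \<delta>" using pd by simp
  qed
  have eb: "is_eigvals (t *\<^sub>R psi_mat (\<psi>2 z2) p2 Y2 - s *\<^sub>R mat 1) b" unfolding b_def by (rule is_eigvals_affine[OF l2])
  have te: "t * exp (2 * \<psi>2 z2) = exp (2 * \<psi>1 z1)" unfolding t_def by (simp flip: exp_add add: algebra_simps)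
  have le: "v \<bullet> ((t *\<^sub>R psi_mat (\<psi>2 z2) p2 Y2 - s *\<^sub>R mat 1) *v v) \<le> v \<bullet> (psi_mat (\<psi>1 z1) p1 Y1 *v v)" for v
  proof -
    define n2 where "n2 = (norm v)\<^sup>2"
    have n2: "n2 \<ge> 0" by (simp add: n2_def)
    define N1 where "N1 = - (v \<bullet> (Y1 *v v)) - (p1 \<bullet> v)\<^sup>2 + (norm p1)\<^sup>2 / 2 * n2"
    define N2 where "N2 = - (v \<bullet> (Y2 *v v)) - (p2 \<bullet> v)\<^sup>2 + (norm p2)\<^sup>2 / 2 * n2"
    have l: "v \<bullet> ((t *\<^sub>R psi_mat (\<psi>2 z2) p2 Y2 - s *\<^sub>R mat 1) *v v) = exp (2 * \<psi>1 z1) * N2 - s * n2"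
      unfolding matrix_vector_mult_diff_rdistrib scaleR_matrix_vector_assoc[symmetric] inner_diff_right inner_scaleR_right psi_mat_quadratic_form
      unfolding te[symmetric] N2_def n2_def power2_norm_eq_inner[of v] by simp
    have r: "v \<bullet> (psi_mat (\<psi>1 z1) p1 Y1 *v v) = exp (2 * \<psi>1 z1) * N1" unfolding psi_mat_quadratic_form N1_def n2_def ..
    have a1: "\<bar>(p1 \<bullet> v)\<^sup>2 - (p2 \<bullet> v)\<^sup>2\<bar> \<le> 2 * P * \<delta> * n2"
    proof -
      have "(p1 \<bullet> v)\<^sup>2 - (p2 \<bullet> v)\<^sup>2 = ((p1 - p2) \<bullet> v) * ((p1 + p2) \<bullet> v)"
        by (simp add: inner_diff_left inner_add_left power2_eq_square algebra_simps)
      also have "\<bar>\<dots>\<bar> \<le> (\<delta> * norm v) * ((2 * P) * norm v)"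
        unfolding abs_mult
      proof (intro mult_mono)
        show "\<bar>(p1 - p2) \<bullet> v\<bar> \<le> \<delta> * norm v" using Cauchy_Schwarz_ineq2[of "p1 - p2" v] mult_right_mono[OF pn(3), of "norm v"] by simp
        have "norm (p1 + p2) \<le> 2 * P" using norm_triangle_ineq[of p1 p2] pn by linarith
        then show "\<bar>(p1 + p2) \<bullet> v\<bar> \<le> 2 * P * norm v" using Cauchy_Schwarz_ineq2[of "p1 + p2" v] mult_right_mono[of "norm (p1 + p2)" "2 * P" "norm v"] by simp
      qed (use \<delta> in auto)
      finally show ?thesis by (simp add: n2_def power2_eq_square algebra_simps)
    qed
    have a2: "\<bar>(norm p1)\<^sup>2 / 2 * n2 - (norm p2)\<^sup>2 / 2 * n2\<bar> \<le> P * \<delta> * n2"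
    proof -
      have "\<bar>(norm p1)\<^sup>2 - (norm p2)\<^sup>2\<bar> = \<bar>norm p1 - norm p2\<bar> * (norm p1 + norm p2)"
      proof -
        have "(norm p1)\<^sup>2 - (norm p2)\<^sup>2 = (norm p1 - norm p2) * (norm p1 + norm p2)" by (simp add: power2_eq_square algebra_simps)
        then show ?thesis by (simp add: abs_mult)
      qed
      also have "\<dots> \<le> \<delta> * (2 * P)" using pn norm_triangle_ineq3[of p1 p2] \<delta>(1) by (intro mult_mono) auto
      finally have "\<bar>(norm p1)\<^sup>2 - (norm p2)\<^sup>2\<bar> / 2 * n2 \<le> (\<delta> * (2 * P)) / 2 * n2" using n2 by (intro mult_right_mono divide_right_mono) auto
      moreover have "(norm p1)\<^sup>2 / 2 * n2 - (norm p2)\<^sup>2 / 2 * n2 = ((norm p1)\<^sup>2 - (norm p2)\<^sup>2) / 2 * n2" by (simp add: algebra_simps diff_divide_distrib)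
      moreover have "\<bar>((norm p1)\<^sup>2 - (norm p2)\<^sup>2) / 2 * n2\<bar> = \<bar>(norm p1)\<^sup>2 - (norm p2)\<^sup>2\<bar> / 2 * n2" using n2 by (simp add: abs_mult)
      moreover have "(\<delta> * (2 * P)) / 2 * n2 = P * \<delta> * n2" by simp
      ultimately show ?thesis by metis
    qed
    have "N2 - N1 \<le> (4 + 3 * P) * \<delta> * n2"
    proof -
      have "(v \<bullet> (Y1 *v v)) - (v \<bullet> (Y2 *v v)) \<le> 4 * \<delta> * n2" using X(7)[of v] unfolding qY n2_def by (simp add: algebra_simps)
      then have "N2 - N1 \<le> 4 * \<delta> * n2 + 2 * P * \<delta> * n2 + P * \<delta> * n2" using a1 a2 unfolding N1_def N2_def by linarith
      then show ?thesis by (simp add: algebra_simps)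
    qed
    then have "exp (2 * \<psi>1 z1) * (N2 - N1) \<le> exp (2 * \<psi>1 z1) * ((4 + 3 * P) * \<delta> * n2)" by (intro mult_left_mono) auto
    also have "\<dots> \<le> exp (2 * A) * ((4 + 3 * P) * \<delta> * n2)"
      using A(1)[OF zK(1)] P \<delta>(1) n2 by (intro mult_right_mono) (auto simp: abs_le_iff)
    also have "\<dots> = s * n2" by (simp add: s_def algebra_simps)
    finally show ?thesis unfolding l r by (simp add: algebra_simps)
  qed
  obtain p where p: "p permutes UNIV" "\<And>i. b $ i \<le> permute_vec p l1 $ i" using eigvals_mono[OF l1 eb le] by blast
  have t0: "t > 0" "exp (m/2) \<le> t" "t \<le> exp (4 * A)"
  proof -
    show "t > 0" by (simp add: t_def)
    show "exp (m/2) \<le> t" unfolding t_def using gap m by simp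
    show "t \<le> exp (4 * A)" unfolding t_def using A(1)[OF zK(1)] A(2)[OF zK(2)] by (simp add: abs_le_iff)
  qed
  have tlS: "t *\<^sub>R l2 \<in> S"
  proof -
    have c: "t *\<^sub>R l2 \<in> closure \<Gamma>" using structural_scale[OF st _ t0(1)] s2 by blast
    have "exp (m/2 * d) = exp (m/2) powr d" by (simp add: powr_def)
    also have "\<dots> \<le> t powr d" using t0 d(1) by (intro powr_mono2) auto
    also have "\<dots> \<le> t powr d * f l2" using s2 mult_left_mono[of 1 "f l2" "t powr d"] by simp
    also have "\<dots> = f (t *\<^sub>R l2)" using d(2)[of l2 t] s2 t0 by simp
    finally have 1: "exp (m/2 * d) \<le> f (t *\<^sub>R l2)" .
    have bnd: "\<bar>l2 $ i\<bar> \<le> C0" for i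
    proof (rule eigval_bounds[OF l2])
      fix v :: "real^'n"
      define n2 where "n2 = (norm v)\<^sup>2"
      have n2: "n2 \<ge> 0" by (simp add: n2_def)
      have 1: "\<bar>v \<bullet> (Y2 *v v)\<bar> \<le> (k + 2) * n2"
      proof -
        have "v \<bullet> (X2 *v v) \<le> 2 * k * n2" using X(5)[of v] X(7)[of v] by (simp add: n2_def)
        moreover have "\<delta> * n2 \<le> n2" "0 \<le> \<delta> * n2" "0 \<le> k * n2" using \<delta> n2 k(1) by (auto intro: mult_left_le_one_le)
        ultimately show ?thesis using X(6)[of v] unfolding qY n2_def[symmetric] by (simp add: abs_le_iff algebra_simps)
      qed
      have 2: "(p2 \<bullet> v)\<^sup>2 \<le> P\<^sup>2 * n2"
      proof -
        have "\<bar>p2 \<bullet> v\<bar> \<le> P * norm v" using Cauchy_Schwarz_ineq2[of p2 v] mult_right_mono[OF pn(2), of "norm v"] by simp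
        then have "\<bar>p2 \<bullet> v\<bar>\<^sup>2 \<le> (P * norm v)\<^sup>2" by (intro power_mono) auto
        then show ?thesis by (simp add: n2_def power_mult_distrib)
      qed
      have 3: "(norm p2)\<^sup>2 / 2 * n2 \<le> P\<^sup>2 * n2"
      proof (rule mult_right_mono)
        have "(norm p2)\<^sup>2 \<le> P\<^sup>2" using pn(2) by (intro power_mono) auto
        then show "(norm p2)\<^sup>2 / 2 \<le> P\<^sup>2" using zero_le_power2[of "norm p2"] by linarith
      qed (rule n2)
      have 4: "0 \<le> (norm p2)\<^sup>2 / 2 * n2" "0 \<le> (p2 \<bullet> v)\<^sup>2" using n2 by auto
      have "\<bar>- (v \<bullet> (Y2 *v v)) - (p2 \<bullet> v)\<^sup>2 + (norm p2)\<^sup>2 / 2 * n2\<bar> \<le> (k + 2) * n2 + P\<^sup>2 * n2 + P\<^sup>2 * n2"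
        using 1 2 3 4 by linarith
      also have "\<dots> = (k + 2 + 2 * P\<^sup>2) * n2" by (simp add: algebra_simps)
      finally have 5: "\<bar>- (v \<bullet> (Y2 *v v)) - (p2 \<bullet> v)\<^sup>2 + (norm p2)\<^sup>2 / 2 * n2\<bar> \<le> (k + 2 + 2 * P\<^sup>2) * n2" .
      have "\<bar>v \<bullet> (psi_mat (\<psi>2 z2) p2 Y2 *v v)\<bar> = exp (2 * \<psi>2 z2) * \<bar>- (v \<bullet> (Y2 *v v)) - (p2 \<bullet> v)\<^sup>2 + (norm p2)\<^sup>2 / 2 * n2\<bar>"
        unfolding psi_mat_quadratic_form n2_def by (simp add: abs_mult)
      also have "\<dots> \<le> exp (2 * A) * ((k + 2 + 2 * P\<^sup>2) * n2)"
        using A(2)[OF zK(2)] 5 by (intro mult_mono) (auto simp: abs_le_iff)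
      finally show "\<bar>v \<bullet> (psi_mat (\<psi>2 z2) p2 Y2 *v v)\<bar> \<le> C0 * (norm v)\<^sup>2" by (simp add: C0_def n2_def)
    qed
    have "norm (t *\<^sub>R l2) \<le> (\<Sum>i\<in>UNIV. \<bar>(t *\<^sub>R l2) $ i\<bar>)" by (rule norm_le_l1_cart)
    also have "\<dots> \<le> (\<Sum>i\<in>(UNIV::'n set). exp (4 * A) * C0)"
    proof (rule sum_mono)
      fix i show "\<bar>(t *\<^sub>R l2) $ i\<bar> \<le> exp (4 * A) * C0" using bnd[of i] t0 by (auto simp: abs_mult intro!: mult_mono)
    qed
    also have "\<dots> = R3" by (simp add: R3_def)
    finally show ?thesis using c 1 by (simp add: S_def)
  qed
  \<comment> \<open>\<open>b\<close> is \<open>t *\<^sub>R l2\<close> lowered by \<open>s\<close> in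
    each coordinate. It still satisfies \<open>f b > 1\<close> and is dominated by a permutation of
    \<open>l1\<close>, which yields \<open>f l1 > 1\<close>.\<close>
  have "b \<in> ball (t *\<^sub>R l2) e0"
  proof -
    have s0: "s \<ge> 0" using P \<delta>(1) by (simp add: s_def)
    have "norm (t *\<^sub>R l2 - b) \<le> (\<Sum>i\<in>UNIV. \<bar>(t *\<^sub>R l2 - b) $ i\<bar>)" by (rule norm_le_l1_cart)
    also have "\<dots> = real CARD('n) * s" using s0 by (simp add: b_def)
    also have "\<dots> = \<delta> * (Q - 1)" by (simp add: s_def Q_def algebra_simps)
    also have "\<dots> \<le> \<delta> * Q" using \<delta>(1) by simp
    also have "\<dots> < e0" by (rule \<delta>(3))
    finally show ?thesis by (simp add: dist_norm)
  qed
  then have "b \<in> G" using e0(2) tlS by blast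
  then have bG: "b \<in> \<Gamma>" "f b > 1" by (auto simp: G_def)
  have "permute_vec p l1 \<in> closure \<Gamma>" "f b \<le> f (permute_vec p l1)" using structural_mono_closure[OF st bG(1) p(2)] by auto
  then have "l1 \<in> closure \<Gamma>" "f l1 > 1" using structural_permute[OF st p(1)] bG(2) by auto
  then show False using s1 by simp
qed

section \<open>Conformal invariance\<close>

lemma continuous_on_outer_prod [continuous_intros]:
  "continuous_on A g \<Longrightarrow> continuous_on A (\<lambda>x. outer_prod (g x))"
  unfolding outer_prod_def by (intro continuous_on_vec_lambda continuous_intros)

lemma continuous_on_matrix_mult [continuous_intros]:
  fixes M N :: "'a::topological_space \<Rightarrow> real^'n^'n"
  shows "continuous_on A M \<Longrightarrow> continuous_on A N \<Longrightarrow> continuous_on A (\<lambda>x. M x ** N x)"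
  unfolding matrix_matrix_mult_def by (intro continuous_on_vec_lambda continuous_intros)

lemma C2_near_exp:
  assumes "C2_near phi g H x0"
  shows "C2_near (\<lambda>x. exp (c * phi x)) (\<lambda>x. (c * exp (c * phi x)) *\<^sub>R g x)
    (\<lambda>x. (c * exp (c * phi x)) *\<^sub>R H x + (c\<^sup>2 * exp (c * phi x)) *\<^sub>R outer_prod (g x)) x0"
proof -
  obtain r where r: "r > 0" "\<And>x. x \<in> ball x0 r \<Longrightarrow> (phi has_derivative (\<lambda>h. g x \<bullet> h)) (at x)"
    "\<And>x. x \<in> ball x0 r \<Longrightarrow> (g has_derivative (\<lambda>h. H x *v h)) (at x)" "continuous_on (ball x0 r) H"
    using assms unfolding C2_near_def by blast
  have e: "((\<lambda>x. exp (c * phi x)) has_derivative (\<lambda>h. exp (c * phi x) * (c * (g x \<bullet> h)))) (at x)" if "x \<in> ball x0 r" for x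
    using r(2)[OF that] by (auto intro!: derivative_eq_intros simp: mult.commute)
  have "((\<lambda>x. exp (c * phi x)) has_derivative (\<lambda>h. ((c * exp (c * phi x)) *\<^sub>R g x) \<bullet> h)) (at x)" if "x \<in> ball x0 r" for x
    by (rule has_derivative_eq_rhs[OF e[OF that]]) (simp add: algebra_simps)
  moreover have "((\<lambda>x. (c * exp (c * phi x)) *\<^sub>R g x) has_derivative
      (\<lambda>h. ((c * exp (c * phi x)) *\<^sub>R H x + (c\<^sup>2 * exp (c * phi x)) *\<^sub>R outer_prod (g x)) *v h)) (at x)" if "x \<in> ball x0 r" for x
  proof (rule has_derivative_eq_rhs)
    show "((\<lambda>x. (c * exp (c * phi x)) *\<^sub>R g x) has_derivative
      (\<lambda>h. (c * exp (c * phi x)) *\<^sub>R (H x *v h) + (c * (exp (c * phi x) * (c * (g x \<bullet> h)))) *\<^sub>R g x)) (at x)"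
      by (intro has_derivative_scaleR has_derivative_mult_right e[OF that] r(3)[OF that])
  qed (simp add: matrix_vector_mult_add_rdistrib scaleR_matrix_vector_assoc[symmetric] outer_prod_vec power2_eq_square algebra_simps)
  moreover have "continuous_on (ball x0 r) phi" "continuous_on (ball x0 r) g"
    using r(2,3) by (intro continuous_at_imp_continuous_on ballI; blast intro: has_derivative_continuous)+
  then have "continuous_on (ball x0 r) (\<lambda>x. (c * exp (c * phi x)) *\<^sub>R H x + (c\<^sup>2 * exp (c * phi x)) *\<^sub>R outer_prod (g x))"
    by (intro continuous_intros r(4))
  ultimately show ?thesis unfolding C2_near_def using r(1) by blast
qed

text \<open>The exponent \<open>\<kappa>\<close> is the one for which both powers of
  \<open>u\<close> in the conformal Hessian, combined with the factors from the chain rule, become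
  \<open>exp (2 * s)\<close>.\<close>

lemma conf_hess_exp:
  fixes p :: "real^'n"
  assumes n: "CARD('n) \<ge> 3"
  defines "\<kappa> \<equiv> (real CARD('n) - 2) / 2"
  shows "- conf_hess (exp (- \<kappa> * s)) ((- \<kappa> * exp (- \<kappa> * s)) *\<^sub>R p)
      ((- \<kappa> * exp (- \<kappa> * s)) *\<^sub>R X + ((- \<kappa>)\<^sup>2 * exp (- \<kappa> * s)) *\<^sub>R outer_prod p) = psi_mat s p X"
proof -
  define N where "N = real CARD('n)"
  have N: "N \<ge> 3" using n by (simp add: N_def)
  have k: "\<kappa> = (N - 2) / 2" by (simp add: \<kappa>_def N_def)
  have k0: "\<kappa> > 0" using N by (simp add: k)
  define E where "E = exp (2 * s)"
  define e where "e = exp (- \<kappa> * s)"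
  define A where "A = e powr (- (N + 2) / (N - 2))"
  define B where "B = e powr (- 2 * N / (N - 2))"
  have A: "A * e = E"
  proof -
    have "A * e = exp (- (N + 2) / (N - 2) * (- \<kappa> * s) + (- \<kappa> * s))" unfolding A_def e_def powr_def exp_add by simp
    also have "- (N + 2) / (N - 2) * (- \<kappa> * s) + (- \<kappa> * s) = 2 * s" using N by (simp add: k field_simps)
    finally show ?thesis by (simp add: E_def)
  qed
  have B: "B * e\<^sup>2 = E"
  proof -
    have "B * e\<^sup>2 = exp (- 2 * N / (N - 2) * (- \<kappa> * s) + (- \<kappa> * s) + (- \<kappa> * s))" unfolding B_def e_def powr_def exp_add by (simp add: power2_eq_square)
    also have "- 2 * N / (N - 2) * (- \<kappa> * s) + (- \<kappa> * s) + (- \<kappa> * s) = 2 * s" using N by (simp add: k field_simps)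
    finally show ?thesis by (simp add: E_def)
  qed
  have c1: "2 / (N - 2) = 1 / \<kappa>" "2 * N / (N - 2)\<^sup>2 = N / (2 * \<kappa>\<^sup>2)" "2 / (N - 2)\<^sup>2 = 1 / (2 * \<kappa>\<^sup>2)"
  proof -
    have m2: "N - 2 = 2 * \<kappa>" by (simp add: k)
    show "2 / (N - 2) = 1 / \<kappa>" "2 * N / (N - 2)\<^sup>2 = N / (2 * \<kappa>\<^sup>2)" "2 / (N - 2)\<^sup>2 = 1 / (2 * \<kappa>\<^sup>2)"
      unfolding m2 by (simp_all add: power2_eq_square)
  qed
  \<comment> \<open>The outer product has coefficient \<open>- \<kappa>\<close> from the second
    derivative of the exponential and \<open>N / 2\<close> from the gradient term; they sum to
    1.\<close>
  have nk: "N = 2 * \<kappa> + 2" by (simp add: k field_simps)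
  have op: "outer_prod (c *\<^sub>R p) = c\<^sup>2 *\<^sub>R outer_prod p" for c by (simp add: outer_prod_def vec_eq_iff power2_eq_square algebra_simps)
  have "conf_hess e ((- \<kappa> * e) *\<^sub>R p) ((- \<kappa> * e) *\<^sub>R X + ((- \<kappa>)\<^sup>2 * e) *\<^sub>R outer_prod p)
    = (- (1 / \<kappa>) * A) *\<^sub>R ((- \<kappa> * e) *\<^sub>R X + ((- \<kappa>)\<^sup>2 * e) *\<^sub>R outer_prod p)
      + ((N / (2 * \<kappa>\<^sup>2)) * B) *\<^sub>R ((- \<kappa> * e)\<^sup>2 *\<^sub>R outer_prod p) - ((1 / (2 * \<kappa>\<^sup>2)) * B * (norm ((- \<kappa> * e) *\<^sub>R p))\<^sup>2) *\<^sub>R mat 1"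
    unfolding conf_hess_def Let_def N_def[symmetric] A_def[symmetric] B_def[symmetric] c1 op ..
  also have "\<dots> = (A * e) *\<^sub>R X - (\<kappa> * (A * e)) *\<^sub>R outer_prod p + (N / 2 * (B * e\<^sup>2)) *\<^sub>R outer_prod p - (1 / 2 * (B * e\<^sup>2) * (norm p)\<^sup>2) *\<^sub>R mat 1"
    using k0 by (simp add: scaleR_add_right power_mult_distrib power2_eq_square algebra_simps)
  also have "\<dots> = E *\<^sub>R (X + outer_prod p - ((norm p)\<^sup>2 / 2) *\<^sub>R mat 1)"
    unfolding A B nk by (simp add: scaleR_add_right scaleR_diff_right algebra_simps add_divide_distrib flip: scaleR_add_left)
  finally show ?thesis unfolding e_def psi_mat_def E_def
    by (simp add: algebra_simps)
qed

lemma psi_of_visc: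
  fixes u :: "real^'n \<Rightarrow> real"
  assumes n: "CARD('n) \<ge> 3" and O: "open \<Omega>" and u: "\<And>x. x \<in> \<Omega> \<Longrightarrow> u x > 0"
  defines "\<kappa> \<equiv> (real CARD('n) - 2) / 2"
  defines "\<psi> \<equiv> \<lambda>x. - ln (u x) / \<kappa>"
  shows "visc_super_ineq f \<Gamma> \<Omega> u \<Longrightarrow> psi_super f \<Gamma> \<Omega> \<psi>"
    and "visc_sub_ineq f \<Gamma> \<Omega> u \<Longrightarrow> psi_sub f \<Gamma> \<Omega> \<psi>"
proof -
  have k0: "\<kappa> > 0" using n by (simp add: \<kappa>_def)
  have ue: "u x = exp (- \<kappa> * \<psi> x)" if "x \<in> \<Omega>" for x using u[OF that] k0 by (simp add: \<psi>_def)
  \<comment> \<open>The identity between \<open>u\<close> and \<open>\<psi>\<close> is available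
    only in \<open>\<Omega>\<close>, so the ball of touching has to be shrunk into it.\<close>
  have near: "\<exists>s>0. s \<le> r \<and> ball x s \<subseteq> \<Omega>" if x: "x \<in> \<Omega>" and r: "r > 0" for x r
  proof -
    obtain s where "s > 0" "ball x s \<subseteq> \<Omega>" using O x openE by blast
    then show ?thesis using r by (intro exI[of _ "min r s"]) auto
  qed
  show "psi_super f \<Gamma> \<Omega> \<psi>" if v: "visc_super_ineq f \<Gamma> \<Omega> u"
    unfolding psi_super_def
  proof (intro ballI allI impI; elim conjE)
    fix x0 phi g H l
    assume x0: "x0 \<in> \<Omega>" and C: "C2_near phi g H x0" and t: "touches_above phi \<psi> x0" and l: "is_eigvals (psi_mat (phi x0) (g x0) (H x0)) l"
    obtain r where r: "r > 0" "\<And>x. x \<in> ball x0 r \<Longrightarrow> \<psi> x \<le> phi x" and p0: "phi x0 = \<psi> x0" using t by (auto simp: touches_above_def)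
    obtain s where s: "s > 0" "s \<le> r" "ball x0 s \<subseteq> \<Omega>" using near[OF x0 r(1)] by blast
    have "touches_below (\<lambda>x. exp (- \<kappa> * phi x)) u x0"
      unfolding touches_below_def
    proof (intro conjI exI[of _ s] ballI)
      fix x assume x: "x \<in> ball x0 s"
      then have "u x = exp (- \<kappa> * \<psi> x)" using ue s by blast
      then show "exp (- \<kappa> * phi x) \<le> u x" using r(2)[of x] x s k0 by simp
    qed (use s p0 ue[OF x0] in auto)
    then show "l \<notin> closure \<Gamma> \<or> f l \<le> 1"
      using v[unfolded visc_super_ineq_def, rule_format, OF x0, of _ _ _ l, OF conjI[OF C2_near_exp[OF C, of "- \<kappa>"]]] l
      unfolding conf_hess_exp[OF n, folded \<kappa>_def] by blast
  qed
  show "psi_sub f \<Gamma> \<Omega> \<psi>" if v: "visc_sub_ineq f \<Gamma> \<Omega> u"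
    unfolding psi_sub_def
  proof (intro ballI allI impI; elim conjE)
    fix x0 phi g H l
    assume x0: "x0 \<in> \<Omega>" and C: "C2_near phi g H x0" and t: "touches_below phi \<psi> x0" and l: "is_eigvals (psi_mat (phi x0) (g x0) (H x0)) l"
    obtain r where r: "r > 0" "\<And>x. x \<in> ball x0 r \<Longrightarrow> phi x \<le> \<psi> x" and p0: "phi x0 = \<psi> x0" using t by (auto simp: touches_below_def)
    obtain s where s: "s > 0" "s \<le> r" "ball x0 s \<subseteq> \<Omega>" using near[OF x0 r(1)] by blast
    have "touches_above (\<lambda>x. exp (- \<kappa> * phi x)) u x0"
      unfolding touches_above_def
    proof (intro conjI exI[of _ s] ballI)
      fix x assume x: "x \<in> ball x0 s"
      then have "u x = exp (- \<kappa> * \<psi> x)" using ue s by blast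
      then show "u x \<le> exp (- \<kappa> * phi x)" using r(2)[of x] x s k0 by simp
    qed (use s p0 ue[OF x0] in auto)
    then show "l \<in> closure \<Gamma> \<and> f l \<ge> 1"
      using v[unfolded visc_sub_ineq_def, rule_format, OF x0, of _ _ _ l, OF conjI[OF C2_near_exp[OF C, of "- \<kappa>"]]] l
      unfolding conf_hess_exp[OF n, folded \<kappa>_def] by blast
  qed
qed

section \<open>The Kelvin transform: inversion in a sphere and its logarithmic weight\<close>

definition kelvin :: "real^'n \<Rightarrow> real \<Rightarrow> real^'n \<Rightarrow> real^'n" where
  "kelvin c m z = c + (m\<^sup>2 / ((z - c) \<bullet> (z - c))) *\<^sub>R (z - c)"

definition kelvin_psi :: "real^'n \<Rightarrow> real \<Rightarrow> (real^'n \<Rightarrow> real) \<Rightarrow> real^'n \<Rightarrow> real" where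
  "kelvin_psi c m \<psi> z = \<psi> (kelvin c m z) + ln ((z - c) \<bullet> (z - c)) - 2 * ln m"

lemma kelvin_minus: "kelvin c m z - c = (m\<^sup>2 / ((z - c) \<bullet> (z - c))) *\<^sub>R (z - c)"
  by (simp add: kelvin_def)

lemma kelvin_dot:
  assumes "z \<noteq> c" shows "(kelvin c m z - c) \<bullet> (kelvin c m z - c) = m ^ 4 / ((z - c) \<bullet> (z - c))"
  using assms by (simp add: kelvin_minus power2_eq_square eval_nat_numeral)

lemma kelvin_norm:
  assumes "z \<noteq> c" shows "norm (kelvin c m z - c) = m\<^sup>2 / norm (z - c)"
  using assms by (simp add: kelvin_minus dot_square_norm power2_eq_square)

lemma kelvin_neq: "z \<noteq> c \<Longrightarrow> m > 0 \<Longrightarrow> kelvin c m z \<noteq> c"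
  by (simp add: kelvin_def)

lemma kelvin_involution:
  assumes "z \<noteq> c" "m > 0" shows "kelvin c m (kelvin c m z) = z"
proof -
  have "kelvin c m (kelvin c m z) - c = (m\<^sup>2 / ((kelvin c m z - c) \<bullet> (kelvin c m z - c))) *\<^sub>R (kelvin c m z - c)"
    by (rule kelvin_minus)
  also have "\<dots> = (m\<^sup>2 / (m ^ 4 / ((z - c) \<bullet> (z - c)))) *\<^sub>R (kelvin c m z - c)"
    by (simp only: kelvin_dot[OF assms(1)])
  also have "\<dots> = (m\<^sup>2 / (m ^ 4 / ((z - c) \<bullet> (z - c)))) *\<^sub>R ((m\<^sup>2 / ((z - c) \<bullet> (z - c))) *\<^sub>R (z - c))"
    by (simp only: kelvin_minus)
  also have "\<dots> = z - c" using assms by (simp add: power2_eq_square eval_nat_numeral)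
  finally show ?thesis by simp
qed

lemma kelvin_psi_involution:
  assumes "z \<noteq> c" "m > 0" shows "kelvin_psi c m (kelvin_psi c m \<psi>) z = \<psi> z"
proof -
  have "ln (m ^ 4 / ((z - c) \<bullet> (z - c))) = 4 * ln m - ln ((z - c) \<bullet> (z - c))"
    using assms by (simp add: ln_div ln_realpow)
  then show ?thesis unfolding kelvin_psi_def kelvin_involution[OF assms] kelvin_dot[OF assms(1)] by simp
qed

text \<open>The chain rule, multiplied out: the reflection of \<open>k\<close> scaled by
  \<open>m\<^sup>2 * \<sigma>\<close>, plus \<open>2 * \<sigma>\<close> times \<open>w\<close> from
  the logarithm.\<close>

definition kelvin_grad :: "real^'n \<Rightarrow> real \<Rightarrow> (real^'n \<Rightarrow> real^'n) \<Rightarrow> real^'n \<Rightarrow> real^'n" where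
  "kelvin_grad c m g z = (let w = z - c; \<sigma> = 1 / (w \<bullet> w); k = g (kelvin c m z) in
     (m\<^sup>2 * \<sigma>) *\<^sub>R k + (2 * \<sigma> - 2 * m\<^sup>2 * \<sigma>\<^sup>2 * (w \<bullet> k)) *\<^sub>R w)"

text \<open>Reflection in the hyperplane orthogonal to \<open>w\<close>. Up to a scalar it is the
  derivative of the inversion, which is why the inversion is conformal.\<close>

definition refl_mat :: "real^'n \<Rightarrow> real^'n^'n" where
  "refl_mat w = mat 1 - (2 / (w \<bullet> w)) *\<^sub>R outer_prod w"

definition tensor :: "real^'n \<Rightarrow> real^'n \<Rightarrow> real^'n^'n" where
  "tensor a b = (\<chi> i j. a $ i * b $ j)"

text \<open>Obtained by differentiating \<open>kelvin_grad\<close>. The first term is the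
  transported Hessian; the others come from the curvature of the inversion and from the
  logarithm.\<close>

definition kelvin_hess :: "real^'n \<Rightarrow> real \<Rightarrow> (real^'n \<Rightarrow> real^'n) \<Rightarrow> (real^'n \<Rightarrow> real^'n^'n) \<Rightarrow> real^'n \<Rightarrow> real^'n^'n" where
  "kelvin_hess c m g H z = (let w = z - c; \<sigma> = 1 / (w \<bullet> w); k = g (kelvin c m z); R = refl_mat w in
     (m\<^sup>2 * \<sigma>)\<^sup>2 *\<^sub>R (R ** H (kelvin c m z) ** R) - (2 * m\<^sup>2 * \<sigma>\<^sup>2) *\<^sub>R (tensor k w + tensor w k)
     + (8 * m\<^sup>2 * (w \<bullet> k) * \<sigma>^3 - 4 * \<sigma>\<^sup>2) *\<^sub>R outer_prod w + (2 * \<sigma> - 2 * m\<^sup>2 * (w \<bullet> k) * \<sigma>\<^sup>2) *\<^sub>R mat 1)"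

lemma tensor_vec: "tensor a b *v v = (b \<bullet> v) *\<^sub>R a"
  by (simp add: tensor_def matrix_vector_mult_def vec_eq_iff inner_vec_def sum_distrib_left sum_distrib_right algebra_simps)

lemma refl_mat_vec: "refl_mat w *v v = v - (2 * (w \<bullet> v) / (w \<bullet> w)) *\<^sub>R w"
  by (simp add: refl_mat_def matrix_vector_mult_diff_rdistrib scaleR_matrix_vector_assoc[symmetric] outer_prod_vec)

lemma refl_mat_sym: "transpose (refl_mat w) = refl_mat w"
  by (auto simp: refl_mat_def transpose_def vec_eq_iff outer_prod_def mat_def mult.commute)

lemma refl_mat_square:
  assumes "w \<noteq> 0" shows "refl_mat w ** refl_mat w = mat 1"
proof -
  have "refl_mat w *v (refl_mat w *v v) = v" for v
  proof -
    have "w \<bullet> (v - (2 * (w \<bullet> v) / (w \<bullet> w)) *\<^sub>R w) = - (w \<bullet> v)" using assms by (simp add: inner_diff_right)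
    then show ?thesis by (simp add: refl_mat_vec)
  qed
  then show ?thesis unfolding matrix_eq by (simp add: matrix_vector_mul_assoc[symmetric])
qed

lemma kelvin_has_derivative:
  assumes "z \<noteq> c"
  shows "(kelvin c m has_derivative (\<lambda>h. (m\<^sup>2 / ((z - c) \<bullet> (z - c))) *\<^sub>R (refl_mat (z - c) *v h))) (at z)"
proof -
  have s: "(z - c) \<bullet> (z - c) \<noteq> 0" using assms by simp
  have "((\<lambda>z. c + (m\<^sup>2 * inverse ((z - c) \<bullet> (z - c))) *\<^sub>R (z - c)) has_derivative
    (\<lambda>h. (m\<^sup>2 / ((z - c) \<bullet> (z - c))) *\<^sub>R (refl_mat (z - c) *v h))) (at z)"
    by (rule derivative_eq_intros refl s | simp)+
       (use s in \<open>simp add: fun_eq_iff refl_mat_vec inner_commute field_simps scaleR_diff_right\<close>)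
  then show ?thesis by (simp add: kelvin_def[abs_def] divide_inverse)
qed


lemma kelvin_psi_C2:
  assumes C: "C2_near phi g H (kelvin c m z0)" and z0: "z0 \<noteq> c" and m: "m > 0"
  shows "C2_near (kelvin_psi c m phi) (kelvin_grad c m g) (kelvin_hess c m g H) z0"
proof -
  obtain r where r: "r > 0" "\<And>x. x \<in> ball (kelvin c m z0) r \<Longrightarrow> (phi has_derivative (\<lambda>h. g x \<bullet> h)) (at x)"
    "\<And>x. x \<in> ball (kelvin c m z0) r \<Longrightarrow> (g has_derivative (\<lambda>h. H x *v h)) (at x)" "continuous_on (ball (kelvin c m z0) r) H"
    using C unfolding C2_near_def by blast
  have cT: "isCont (kelvin c m) z" if "z \<noteq> c" for z
    using kelvin_has_derivative[OF that] has_derivative_continuous by blast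
  then have "continuous_on (- {c}) (kelvin c m)" by (intro continuous_at_imp_continuous_on) auto
  then have "open (- {c} \<inter> kelvin c m -` ball (kelvin c m z0) r)" by (intro continuous_open_preimage) auto
  then obtain s where s: "s > 0" "ball z0 s \<subseteq> - {c} \<inter> kelvin c m -` ball (kelvin c m z0) r"
    using z0 r(1) by (metis (no_types, lifting) ComplI IntI centre_in_ball openE singletonD vimageI)
  have main: "(kelvin_psi c m phi has_derivative (\<lambda>h. kelvin_grad c m g z \<bullet> h)) (at z) \<and>
     (kelvin_grad c m g has_derivative (\<lambda>h. kelvin_hess c m g H z *v h)) (at z)" if z: "z \<in> ball z0 s" for z
  proof -
    have zc: "z \<noteq> c" and zr: "kelvin c m z \<in> ball (kelvin c m z0) r" using z s by auto
    define w where "w = z - c"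
    define \<sigma> where "\<sigma> = 1 / (w \<bullet> w)"
    define M where "M = m\<^sup>2 * \<sigma>"
    define k where "k = g (kelvin c m z)"
    define G where "G = H (kelvin c m z)"
    have ww: "w \<bullet> w \<noteq> 0" using zc by (simp add: w_def)
    have dT: "(kelvin c m has_derivative (\<lambda>h. M *\<^sub>R (refl_mat w *v h))) (at z)"
      using kelvin_has_derivative[OF zc, of m] by (simp add: M_def \<sigma>_def w_def)
    have Rv: "refl_mat w *v h = h - (2 * (w \<bullet> h) * \<sigma>) *\<^sub>R w" for h by (simp add: refl_mat_vec \<sigma>_def)
    have dw: "((\<lambda>z. z - c) has_derivative (\<lambda>h. h)) (at z)" by (auto intro!: derivative_eq_intros)
    have ds: "((\<lambda>z. (z - c) \<bullet> (z - c)) has_derivative (\<lambda>h. 2 * (w \<bullet> h))) (at z)"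
      by (rule has_derivative_eq_rhs[OF has_derivative_inner[OF dw dw]]) (auto simp: w_def inner_commute)
    have d\<sigma>: "((\<lambda>z. 1 / ((z - c) \<bullet> (z - c))) has_derivative (\<lambda>h. - 2 * (w \<bullet> h) * \<sigma>\<^sup>2)) (at z)"
      by (rule has_derivative_eq_rhs[OF has_derivative_divide[OF has_derivative_const ds]])
         (use ww in \<open>auto simp: w_def \<sigma>_def power2_eq_square field_simps\<close>)
    have dphi: "((\<lambda>z. phi (kelvin c m z)) has_derivative (\<lambda>h. k \<bullet> (M *\<^sub>R (refl_mat w *v h)))) (at z)"
      using has_derivative_compose[OF dT r(2)[OF zr]] by (simp add: k_def)
    have dk: "((\<lambda>z. g (kelvin c m z)) has_derivative (\<lambda>h. G *v (M *\<^sub>R (refl_mat w *v h)))) (at z)"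
      using has_derivative_compose[OF dT r(3)[OF zr]] by (simp add: G_def)
    have dln: "((\<lambda>z. ln ((z - c) \<bullet> (z - c))) has_derivative (\<lambda>h. \<sigma> * (2 * (w \<bullet> h)))) (at z)"
    proof -
      have "(ln has_derivative (\<lambda>h. h * \<sigma>)) (at ((z - c) \<bullet> (z - c)))"
        by (rule has_derivative_eq_rhs[OF DERIV_ln[THEN has_field_derivative_imp_has_derivative]])
           (use zc in \<open>auto simp: \<sigma>_def w_def field_simps\<close>)
      from has_derivative_compose[OF ds this] show ?thesis by (simp add: mult.commute)
    qed
    have kg: "kelvin_grad c m g z = M *\<^sub>R k + (2 * \<sigma> - 2 * M * \<sigma> * (w \<bullet> k)) *\<^sub>R w"
      unfolding kelvin_grad_def Let_def w_def[symmetric] \<sigma>_def[symmetric] k_def[symmetric] M_def by (simp add: power2_eq_square algebra_simps)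
    have 1: "(kelvin_psi c m phi has_derivative (\<lambda>h. kelvin_grad c m g z \<bullet> h)) (at z)"
    proof (rule has_derivative_eq_rhs)
      show "(kelvin_psi c m phi has_derivative (\<lambda>h. k \<bullet> (M *\<^sub>R (refl_mat w *v h)) + \<sigma> * (2 * (w \<bullet> h)) - 0)) (at z)"
        unfolding kelvin_psi_def[abs_def] by (intro has_derivative_diff has_derivative_add dphi dln has_derivative_const)
      show "(\<lambda>h. k \<bullet> (M *\<^sub>R (refl_mat w *v h)) + \<sigma> * (2 * (w \<bullet> h)) - 0) = (\<lambda>h. kelvin_grad c m g z \<bullet> h)"
        unfolding kg Rv by (simp add: fun_eq_iff inner_diff_right inner_add_left inner_diff_left inner_commute algebra_simps)
    qed
    define b' where "b' = (\<lambda>h. w \<bullet> (G *v (M *\<^sub>R (refl_mat w *v h))) + h \<bullet> k)"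
    have db: "((\<lambda>z. (z - c) \<bullet> g (kelvin c m z)) has_derivative b') (at z)"
      unfolding b'_def k_def w_def by (rule has_derivative_inner[OF dw dk[unfolded w_def]])
    define \<beta> where "\<beta> = (\<lambda>h. 2 * (- 2 * (w \<bullet> h) * \<sigma>\<^sup>2) - ((2 * m\<^sup>2 * \<sigma>\<^sup>2) * b' h + (2 * m\<^sup>2 * (2 * \<sigma> * (- 2 * (w \<bullet> h) * \<sigma>\<^sup>2))) * (w \<bullet> k)))"
    have d\<sigma>2: "((\<lambda>z. (1 / ((z - c) \<bullet> (z - c)))\<^sup>2) has_derivative (\<lambda>h. 2 * \<sigma> * (- 2 * (w \<bullet> h) * \<sigma>\<^sup>2))) (at z)"
      by (rule has_derivative_eq_rhs[OF has_derivative_power[OF d\<sigma>]]) (auto simp: \<sigma>_def w_def)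
    have d\<beta>: "((\<lambda>z. 2 * (1 / ((z - c) \<bullet> (z - c))) - 2 * m\<^sup>2 * (1 / ((z - c) \<bullet> (z - c)))\<^sup>2 * ((z - c) \<bullet> g (kelvin c m z))) has_derivative \<beta>) (at z)"
      unfolding \<beta>_def k_def
      by (rule has_derivative_eq_rhs[OF has_derivative_diff[OF has_derivative_mult_right[OF d\<sigma>] has_derivative_mult[OF has_derivative_mult_right[OF d\<sigma>2] db]]])
         (simp add: \<sigma>_def w_def)
    have "(kelvin_grad c m g has_derivative
       (\<lambda>h. (M *\<^sub>R (G *v (M *\<^sub>R (refl_mat w *v h))) + (m\<^sup>2 * (- 2 * (w \<bullet> h) * \<sigma>\<^sup>2)) *\<^sub>R k) +
            ((2 * \<sigma> - 2 * m\<^sup>2 * \<sigma>\<^sup>2 * (w \<bullet> k)) *\<^sub>R h + \<beta> h *\<^sub>R w))) (at z)"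
      unfolding kelvin_grad_def[abs_def] Let_def
      by (rule has_derivative_eq_rhs[OF has_derivative_add[OF has_derivative_scaleR[OF has_derivative_mult_right[OF d\<sigma>] dk] has_derivative_scaleR[OF d\<beta> dw]]])
         (simp add: M_def \<sigma>_def w_def k_def)
    moreover have "(M *\<^sub>R (G *v (M *\<^sub>R (refl_mat w *v h))) + (m\<^sup>2 * (- 2 * (w \<bullet> h) * \<sigma>\<^sup>2)) *\<^sub>R k) +
            ((2 * \<sigma> - 2 * m\<^sup>2 * \<sigma>\<^sup>2 * (w \<bullet> k)) *\<^sub>R h + \<beta> h *\<^sub>R w) = kelvin_hess c m g H z *v h" for h
    proof -
      define y where "y = G *v (refl_mat w *v h)"
      have y1: "G *v (M *\<^sub>R (refl_mat w *v h)) = M *\<^sub>R y" by (simp add: y_def matrix_vector_mult_scaleR)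
      have kh: "kelvin_hess c m g H z *v h = M\<^sup>2 *\<^sub>R (y - (2 * (w \<bullet> y) * \<sigma>) *\<^sub>R w) - (2 * m\<^sup>2 * \<sigma>\<^sup>2) *\<^sub>R ((w \<bullet> h) *\<^sub>R k + (k \<bullet> h) *\<^sub>R w)
         + (8 * m\<^sup>2 * (w \<bullet> k) * \<sigma>^3 - 4 * \<sigma>\<^sup>2) *\<^sub>R ((w \<bullet> h) *\<^sub>R w) + (2 * \<sigma> - 2 * m\<^sup>2 * (w \<bullet> k) * \<sigma>\<^sup>2) *\<^sub>R h"
        unfolding kelvin_hess_def Let_def w_def[symmetric] \<sigma>_def[symmetric] k_def[symmetric] G_def[symmetric] M_def[symmetric]
          matrix_vector_mult_add_rdistrib matrix_vector_mult_diff_rdistrib scaleR_matrix_vector_assoc[symmetric]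
          matrix_vector_mul_assoc[symmetric] tensor_vec outer_prod_vec matrix_vector_mul_lid y_def[symmetric] Rv[of y] ..
      have bh: "b' h = M * (w \<bullet> y) + k \<bullet> h" unfolding b'_def y1 by (simp add: inner_commute)
      show ?thesis unfolding kh y1 \<beta>_def bh unfolding M_def
        by (simp add: vec_eq_iff power2_eq_square power3_eq_cube algebra_simps)
    qed
    ultimately have 2: "(kelvin_grad c m g has_derivative (\<lambda>h. kelvin_hess c m g H z *v h)) (at z)" by simp
    show ?thesis using 1 2 by blast
  qed
  have "continuous_on (ball z0 s) (kelvin_hess c m g H)"
  proof -
    have nc: "z \<noteq> c" if "z \<in> ball z0 s" for z using s(2) that by blast
    have cT': "continuous_on (ball z0 s) (kelvin c m)" using cT nc by (intro continuous_at_imp_continuous_on ballI) blast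
    have im: "kelvin c m ` ball z0 s \<subseteq> ball (kelvin c m z0) r" using s by auto
    have "continuous_on (ball (kelvin c m z0) r) g"
      using r(3) by (intro continuous_at_imp_continuous_on ballI) (blast intro: has_derivative_continuous)
    then have cg: "continuous_on (ball z0 s) (\<lambda>z. g (kelvin c m z))" using continuous_on_compose2 cT' im by blast
    have cH: "continuous_on (ball z0 s) (\<lambda>z. H (kelvin c m z))" using continuous_on_compose2[OF r(4) cT' im] .
    have ne: "\<forall>z\<in>ball z0 s. (z - c) \<bullet> (z - c) \<noteq> 0" using nc by simp
    have ct: "continuous_on A (\<lambda>z. tensor (a z) (b z))" if "continuous_on A a" "continuous_on A b" for A and a b :: "real^'n \<Rightarrow> real^'n"
      unfolding tensor_def using that by (intro continuous_on_vec_lambda continuous_intros)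
    show ?thesis unfolding kelvin_hess_def[abs_def] Let_def refl_mat_def
      by (intro continuous_intros ct cg cH ne)
  qed
  then show ?thesis unfolding C2_near_def using s(1) main by blast
qed

text \<open>Conformal covariance: all lower order terms of \<open>kelvin_hess\<close> cancel against
  the gradient terms of \<open>psi_mat\<close>, leaving a conjugation by a reflection, which
  preserves eigenvalues.\<close>

lemma kelvin_psi_mat:
  fixes phi :: "real^'n \<Rightarrow> real"
  assumes z: "z \<noteq> c" and m: "m > 0"
  shows "psi_mat (kelvin_psi c m phi z) (kelvin_grad c m g z) (kelvin_hess c m g H z) =
    refl_mat (z - c) ** psi_mat (phi (kelvin c m z)) (g (kelvin c m z)) (H (kelvin c m z)) ** refl_mat (z - c)"
proof -
  define w where "w = z - c"
  define \<sigma> where "\<sigma> = 1 / (w \<bullet> w)"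
  define M where "M = m\<^sup>2 * \<sigma>"
  define k where "k = g (kelvin c m z)"
  define G where "G = H (kelvin c m z)"
  define R where "R = refl_mat w"
  have w0: "w \<noteq> 0" using z by (simp add: w_def)
  then have ws: "(w \<bullet> w) * \<sigma> = 1" by (simp add: \<sigma>_def)
  have Rv: "R *v h = h - (2 * (w \<bullet> h) * \<sigma>) *\<^sub>R w" for h by (simp add: R_def refl_mat_vec \<sigma>_def)
  have RR: "R *v (R *v h) = h" for h using refl_mat_square[OF w0] by (simp add: R_def matrix_vector_mul_assoc)
  define k' where "k' = kelvin_grad c m g z"
  have kg: "k' = M *\<^sub>R k + (2 * \<sigma> - 2 * M * \<sigma> * (w \<bullet> k)) *\<^sub>R w"
    unfolding k'_def kelvin_grad_def Let_def w_def[symmetric] \<sigma>_def[symmetric] k_def[symmetric] M_def by (simp add: power2_eq_square algebra_simps)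
  \<comment> \<open>The logarithm in \<open>kelvin_psi\<close> is made for this identity: it cancels
    the square of the scaling factor of the inversion.\<close>
  have e: "exp (2 * kelvin_psi c m phi z) * M\<^sup>2 = exp (2 * phi (kelvin c m z))"
  proof -
    have wp: "w \<bullet> w > 0" using w0 by simp
    have "exp (2 * kelvin_psi c m phi z) = (exp (kelvin_psi c m phi z))\<^sup>2" by (simp add: exp_double)
    also have "exp (kelvin_psi c m phi z) = exp (phi (kelvin c m z)) * (w \<bullet> w) / m\<^sup>2"
      using wp m unfolding kelvin_psi_def w_def[symmetric] by (simp add: exp_add exp_diff exp_double)
    finally show ?thesis using wp m by (simp add: M_def \<sigma>_def power_mult_distrib power_divide exp_double)
  qed
  have n2: "(norm k')\<^sup>2 = M\<^sup>2 * (norm k)\<^sup>2 + 4 * \<sigma> - 4 * M * \<sigma> * (w \<bullet> k)"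
  proof -
    define \<gamma> where "\<gamma> = 2 * \<sigma> - 2 * M * \<sigma> * (w \<bullet> k)"
    have "(norm k')\<^sup>2 = M\<^sup>2 * (norm k)\<^sup>2 + 2 * M * \<gamma> * (w \<bullet> k) + \<gamma> * (\<gamma> * (w \<bullet> w))"
      unfolding kg \<gamma>_def[symmetric] power2_norm_eq_inner
      by (simp add: inner_add_left inner_add_right inner_commute power2_eq_square algebra_simps)
    also have "\<gamma> * (w \<bullet> w) = 2 - 2 * M * (w \<bullet> k)"
    proof -
      have "\<gamma> * (w \<bullet> w) = (2 - 2 * M * (w \<bullet> k)) * ((w \<bullet> w) * \<sigma>)" by (simp add: \<gamma>_def algebra_simps)
      then show ?thesis using ws by simp
    qed
    finally show ?thesis by (simp add: \<gamma>_def power2_eq_square algebra_simps)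
  qed
  have pv: "psi_mat v p X *v h = exp (2 * v) *\<^sub>R (- (X *v h) - (p \<bullet> h) *\<^sub>R p + ((norm p)\<^sup>2 / 2) *\<^sub>R h)" for v p X and h :: "real^'n"
    unfolding psi_mat_def scaleR_matrix_vector_assoc[symmetric] matrix_vector_mult_add_rdistrib matrix_vector_mult_diff_rdistrib minus_matrix_vector_mult outer_prod_vec matrix_vector_mul_lid ..
  have "psi_mat (kelvin_psi c m phi z) k' (kelvin_hess c m g H z) *v h = (R ** psi_mat (phi (kelvin c m z)) k G ** R) *v h" for h
  proof -
    define y where "y = G *v (R *v h)"
    have kh: "kelvin_hess c m g H z *v h = M\<^sup>2 *\<^sub>R (R *v y) - (2 * m\<^sup>2 * \<sigma>\<^sup>2) *\<^sub>R ((w \<bullet> h) *\<^sub>R k + (k \<bullet> h) *\<^sub>R w)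
         + (8 * m\<^sup>2 * (w \<bullet> k) * \<sigma>^3 - 4 * \<sigma>\<^sup>2) *\<^sub>R ((w \<bullet> h) *\<^sub>R w) + (2 * \<sigma> - 2 * m\<^sup>2 * (w \<bullet> k) * \<sigma>\<^sup>2) *\<^sub>R h"
        unfolding kelvin_hess_def Let_def w_def[symmetric] \<sigma>_def[symmetric] k_def[symmetric] G_def[symmetric] M_def[symmetric] R_def[symmetric]
          matrix_vector_mult_add_rdistrib matrix_vector_mult_diff_rdistrib scaleR_matrix_vector_assoc[symmetric]
          matrix_vector_mul_assoc[symmetric] tensor_vec outer_prod_vec matrix_vector_mul_lid y_def[symmetric] ..
    have kRh: "k \<bullet> (R *v h) = k \<bullet> h - 2 * (w \<bullet> h) * (w \<bullet> k) * \<sigma>" unfolding Rv by (simp add: inner_diff_right inner_commute algebra_simps)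
    have k'h: "k' \<bullet> h = M * (k \<bullet> h) + (2 * \<sigma> - 2 * M * \<sigma> * (w \<bullet> k)) * (w \<bullet> h)" unfolding kg by (simp add: inner_add_left inner_diff_left algebra_simps)
    have key: "- (kelvin_hess c m g H z *v h) - (k' \<bullet> h) *\<^sub>R k' + ((norm k')\<^sup>2 / 2) *\<^sub>R h =
       M\<^sup>2 *\<^sub>R (- (R *v y) - (k \<bullet> (R *v h)) *\<^sub>R (R *v k) + ((norm k)\<^sup>2 / 2) *\<^sub>R h)"
      unfolding kh kRh k'h n2 unfolding kg Rv[of k] unfolding M_def
      by (simp add: vec_eq_iff power2_eq_square power3_eq_cube algebra_simps add_divide_distrib diff_divide_distrib)
    have "(R ** psi_mat (phi (kelvin c m z)) k G ** R) *v h = R *v (exp (2 * phi (kelvin c m z)) *\<^sub>R (- y - (k \<bullet> (R *v h)) *\<^sub>R k + ((norm k)\<^sup>2 / 2) *\<^sub>R (R *v h)))"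
      unfolding matrix_vector_mul_assoc[symmetric] pv y_def ..
    also have "\<dots> = exp (2 * phi (kelvin c m z)) *\<^sub>R (- (R *v y) - (k \<bullet> (R *v h)) *\<^sub>R (R *v k) + ((norm k)\<^sup>2 / 2) *\<^sub>R h)"
    proof -
      have "R *v (- y) = - (R *v y)" using matrix_vector_mult_diff_distrib[of R 0 y] by simp
      then have "R *v (- y - a *\<^sub>R k + b *\<^sub>R (R *v h)) = - (R *v y) - a *\<^sub>R (R *v k) + b *\<^sub>R h" for a b
        by (simp only: matrix_vector_right_distrib matrix_vector_mult_diff_distrib matrix_vector_mult_scaleR RR)
      then show ?thesis by (simp only: matrix_vector_mult_scaleR)
    qed
    also have "\<dots> = exp (2 * kelvin_psi c m phi z) *\<^sub>R (M\<^sup>2 *\<^sub>R (- (R *v y) - (k \<bullet> (R *v h)) *\<^sub>R (R *v k) + ((norm k)\<^sup>2 / 2) *\<^sub>R h))"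
      unfolding e[symmetric] by simp
    finally show ?thesis unfolding pv key ..
  qed
  then show ?thesis unfolding matrix_eq k'_def[symmetric] k_def G_def R_def w_def by blast
qed

lemma is_eigvals_conj:
  assumes "is_eigvals M l" "orthogonal_matrix R" shows "is_eigvals (R ** M ** transpose R) l"
proof -
  obtain Q where Q: "orthogonal_matrix Q" "M = Q ** diag_mat l ** transpose Q" using assms(1) by (auto simp: is_eigvals_def)
  have "R ** M ** transpose R = (R ** Q) ** diag_mat l ** transpose (R ** Q)"
    unfolding Q(2) by (simp add: matrix_transpose_mul matrix_mul_assoc)
  then show ?thesis unfolding is_eigvals_def using orthogonal_matrix_mul[OF assms(2) Q(1)] by blast
qed

text \<open>A test function for the transform becomes one for \<open>\<psi>\<close> by transforming
  it back, since \<open>kelvin_psi\<close> is an order-preserving involution away from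
  \<open>c\<close>.\<close>

lemma psi_sub_kelvin:
  fixes \<psi> :: "real^'n \<Rightarrow> real"
  assumes sub: "psi_sub f \<Gamma> \<Omega> \<psi>" and m: "m > 0" and D: "c \<notin> D" "kelvin c m ` D \<subseteq> \<Omega>"
  shows "psi_sub f \<Gamma> D (kelvin_psi c m \<psi>)"
  unfolding psi_sub_def
proof (intro ballI allI impI; elim conjE)
  fix y0 phi g H l
  assume y0: "y0 \<in> D" and C: "C2_near phi g H y0" and t: "touches_below phi (kelvin_psi c m \<psi>) y0"
    and l: "is_eigvals (psi_mat (phi y0) (g y0) (H y0)) l"
  have y0c: "y0 \<noteq> c" using y0 D by auto
  define z0 where "z0 = kelvin c m y0"
  have z0: "z0 \<in> \<Omega>" "z0 \<noteq> c" using y0 D kelvin_neq[OF y0c m] by (auto simp: z0_def)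
  have Tz0: "kelvin c m z0 = y0" unfolding z0_def by (rule kelvin_involution[OF y0c m])
  have C': "C2_near (kelvin_psi c m phi) (kelvin_grad c m g) (kelvin_hess c m g H) z0"
    by (rule kelvin_psi_C2[OF _ z0(2) m]) (simp add: Tz0 C)
  obtain r where r: "r > 0" "\<And>y. y \<in> ball y0 r \<Longrightarrow> phi y \<le> kelvin_psi c m \<psi> y" and p0: "phi y0 = kelvin_psi c m \<psi> y0"
    using t by (auto simp: touches_below_def)
  have mono: "kelvin_psi c m phi z \<le> \<psi> z" if "z \<noteq> c" "phi (kelvin c m z) \<le> kelvin_psi c m \<psi> (kelvin c m z)" for z
    using that(2) kelvin_psi_involution[OF that(1) m, of \<psi>] unfolding kelvin_psi_def[of c m phi] kelvin_psi_def[of c m "kelvin_psi c m \<psi>"] by linarith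
  have "touches_below (kelvin_psi c m phi) \<psi> z0"
    unfolding touches_below_def
  proof
    show "kelvin_psi c m phi z0 = \<psi> z0"
      using kelvin_psi_involution[OF z0(2) m, of \<psi>] unfolding kelvin_psi_def[of c m phi] kelvin_psi_def[of c m "kelvin_psi c m \<psi>"] Tz0 p0 by linarith
    have "isCont (kelvin c m) z0" using kelvin_has_derivative[OF z0(2)] has_derivative_continuous by blast
    then obtain s where s: "s > 0" "\<And>z. dist z z0 < s \<Longrightarrow> dist (kelvin c m z) y0 < r"
      using r(1) unfolding continuous_at_eps_delta Tz0 by blast
    show "\<exists>r>0. \<forall>x\<in>ball z0 r. kelvin_psi c m phi x \<le> \<psi> x"
    proof (intro exI[of _ "min s (dist z0 c)"] conjI ballI)
      show "0 < min s (dist z0 c)" using s z0 by simp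
      fix x assume x: "x \<in> ball z0 (min s (dist z0 c))"
      show "kelvin_psi c m phi x \<le> \<psi> x"
        using x s(2)[of x] r(2)[of "kelvin c m x"] by (intro mono) (auto simp: dist_commute)
    qed
  qed
  moreover have "is_eigvals (psi_mat (kelvin_psi c m phi z0) (kelvin_grad c m g z0) (kelvin_hess c m g H z0)) l"
  proof -
    have "orthogonal_matrix (refl_mat (z0 - c))"
      using refl_mat_square[of "z0 - c"] z0 by (simp add: orthogonal_matrix_def refl_mat_sym)
    from is_eigvals_conj[OF l this] show ?thesis unfolding kelvin_psi_mat[OF z0(2) m] Tz0 refl_mat_sym .
  qed
  ultimately show "l \<in> closure \<Gamma> \<and> f l \<ge> 1" using sub z0(1) C' unfolding psi_sub_def by blast
qed

section \<open>The gradient estimate\<close>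

text \<open>Comparing \<open>\<psi>\<close> with its Kelvin transform in the sphere of radius \<open>sqrt (r * s)\<close>, which exchanges
  the two points of the ray.\<close>

lemma psi_ray_estimate:
  fixes \<psi> :: "real^'n \<Rightarrow> real"
  assumes st: "structural f \<Gamma>" and c\<psi>: "continuous_on \<Omega> \<psi>"
    and sup: "psi_super f \<Gamma> \<Omega> \<psi>" and sub: "psi_sub f \<Gamma> \<Omega> \<psi>"
    and osc: "\<And>x y. x \<in> \<Omega> \<Longrightarrow> y \<in> \<Omega> \<Longrightarrow> \<psi> x - \<psi> y \<le> \<Lambda>" "\<Lambda> \<ge> 0"
    and cb: "cball c \<rho> \<subseteq> \<Omega>" and e: "norm e = 1"
    and rs: "0 < s" "s < r" "r < \<rho> * exp (- \<Lambda> / 2)"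
  shows "\<psi> (c + r *\<^sub>R e) - \<psi> (c + s *\<^sub>R e) \<le> ln (r / s)"
proof -
  define m where "m = sqrt (r * s)"
  have r0: "r > 0" using rs by linarith
  have m: "m > 0" "m\<^sup>2 = r * s" using rs r0 by (auto simp: m_def)
  have "m\<^sup>2 < r\<^sup>2" using m rs r0 by (simp add: power2_eq_square)
  then have mr: "m < r" using r0 by (simp add: power2_less_imp_less)
  have "\<rho> * exp (- \<Lambda> / 2) > 0" using rs r0 by linarith
  then have \<rho>: "\<rho> > 0" by (simp add: zero_less_mult_iff)
  have "\<rho> * exp (- \<Lambda> / 2) \<le> \<rho> * 1" using \<rho> osc(2) by (intro mult_left_mono) auto
  then have r\<rho>: "r < \<rho>" using rs by linarith
  \<comment> \<open>The comparison takes place in the annulus between the sphere of inversion and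
    the sphere of radius \<open>\<rho>\<close>; inversion sends it into the inner ball, still inside
    \<open>\<Omega>\<close>.\<close>
  define D where "D = {y. m < norm (y - c)} \<inter> {y. norm (y - c) < \<rho>}"
  define E where "E = {y. m \<le> norm (y - c)} \<inter> {y. norm (y - c) \<le> \<rho>}"
  have D: "open D" unfolding D_def by (intro open_Int open_Collect_less continuous_intros)
  have "closed E" unfolding E_def by (intro closed_Int closed_Collect_le continuous_intros)
  then have DE: "closure D \<subseteq> E" by (intro closure_minimal) (auto simp: D_def E_def)
  have EO: "E \<subseteq> \<Omega>" using cb by (auto simp: E_def dist_norm norm_minus_commute)
  have DsE: "D \<subseteq> E" by (auto simp: D_def E_def)
  have bD: "bounded D" by (rule bounded_subset[of "cball c \<rho>"]) (auto simp: D_def dist_norm norm_minus_commute)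
  have Ec: "y \<noteq> c" if "y \<in> E" for y using that m by (auto simp: E_def)
  have TE: "kelvin c m y \<in> \<Omega>" if "y \<in> E" for y
  proof -
    have "norm (kelvin c m y - c) = m\<^sup>2 / norm (y - c)" by (rule kelvin_norm[OF Ec[OF that]])
    also have "\<dots> \<le> m\<^sup>2 / m" using that m(1) by (intro divide_left_mono mult_pos_pos) (auto simp: E_def)
    also have "\<dots> = m" using m(1) by (simp add: power2_eq_square)
    finally show ?thesis using cb mr r\<rho> by (auto simp: dist_norm norm_minus_commute)
  qed
  have cK: "continuous_on E (kelvin_psi c m \<psi>)"
  proof -
    have "continuous_on E (kelvin c m)"
      using kelvin_has_derivative[OF Ec] by (intro continuous_at_imp_continuous_on ballI) (blast intro: has_derivative_continuous)
    then have "continuous_on E (\<lambda>y. \<psi> (kelvin c m y))" using continuous_on_compose2[OF c\<psi>] TE by blast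
    then show ?thesis unfolding kelvin_psi_def[abs_def] using Ec by (intro continuous_intros) auto
  qed
  have lnw: "ln ((y - c) \<bullet> (y - c)) = 2 * ln (norm (y - c))" if "y \<in> E" for y
    using Ec[OF that] by (simp add: dot_square_norm ln_realpow)
  have x: "c + r *\<^sub>R e \<in> D" using e mr r\<rho> r0 by (simp add: D_def)
  have cmp: "\<psi> (c + r *\<^sub>R e) \<le> kelvin_psi c m \<psi> (c + r *\<^sub>R e)"
  proof (rule comparison_principle[OF st D bD])
    show "continuous_on (closure D) \<psi>" using c\<psi> DE EO continuous_on_subset by blast
    show "continuous_on (closure D) (kelvin_psi c m \<psi>)" using cK DE continuous_on_subset by blast
    show "psi_super f \<Gamma> D \<psi>" using sup DsE EO unfolding psi_super_def by blast
    show "psi_sub f \<Gamma> D (kelvin_psi c m \<psi>)"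
      by (rule psi_sub_kelvin[OF sub m(1)]) (use DsE TE Ec in auto)
    show "c + r *\<^sub>R e \<in> closure D" using x closure_subset by blast
    fix y assume y: "y \<in> closure D - D"
    then have yE: "y \<in> E" using DE by blast
    have yc: "y \<noteq> c" using Ec[OF yE] .
    from y yE have "norm (y - c) = m \<or> norm (y - c) = \<rho>" by (auto simp: D_def E_def)
    then show "\<psi> y \<le> kelvin_psi c m \<psi> y"
    proof
      \<comment> \<open>The sphere of inversion is fixed pointwise and the logarithmic weight
        vanishes on it.\<close>
      assume n: "norm (y - c) = m"
      then have "kelvin c m y = y" using m(1) yc by (simp add: kelvin_def dot_square_norm)
      then show ?thesis unfolding kelvin_psi_def lnw[OF yE] n by simp
    next
      assume n: "norm (y - c) = \<rho>"
      \<comment> \<open>The upper bound on \<open>r\<close> enters here, through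
        \<open>m < r\<close>: the logarithmic gain on the outer sphere is at least the oscillation
        \<open>\<Lambda>\<close>.\<close>
      have "ln m \<le> ln (\<rho> * exp (- \<Lambda> / 2))" using m mr rs by (subst ln_le_cancel_iff) auto
      also have "\<dots> = ln \<rho> - \<Lambda> / 2" using \<rho> by (simp add: ln_mult)
      finally have "\<Lambda> \<le> 2 * ln \<rho> - 2 * ln m" by linarith
      then show ?thesis unfolding kelvin_psi_def lnw[OF yE] n using osc(1)[of y "kelvin c m y"] TE[OF yE] EO yE by force
    qed
  qed
  have swap: "kelvin c m (c + r *\<^sub>R e) = c + s *\<^sub>R e"
    using e m r0 by (simp add: kelvin_def dot_square_norm power2_eq_square[of r])
  have "ln ((c + r *\<^sub>R e - c) \<bullet> (c + r *\<^sub>R e - c)) - 2 * ln m = ln (r / s)"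
  proof -
    have "2 * ln m = ln (m\<^sup>2)" using m(1) by (simp add: ln_realpow)
    also have "\<dots> = ln r + ln s" using m rs r0 by (simp add: ln_mult)
    finally show ?thesis using rs r0 e by (simp add: dot_square_norm ln_div ln_mult power2_eq_square)
  qed
  then show ?thesis using cmp unfolding kelvin_psi_def swap by linarith
qed

text \<open>The ray through \<open>y'\<close> and \<open>y\<close> is started at a centre a distance
  \<open>s\<close> behind \<open>y'\<close>; the logarithmic growth becomes
  \<open>ln (1 + d / s) \<le> d / s\<close>.\<close>

lemma psi_lipschitz:
  fixes \<psi> :: "real^'n \<Rightarrow> real"
  assumes st: "structural f \<Gamma>" and c\<psi>: "continuous_on \<Omega> \<psi>"
    and sup: "psi_super f \<Gamma> \<Omega> \<psi>" and sub: "psi_sub f \<Gamma> \<Omega> \<psi>"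
    and osc: "\<And>x y. x \<in> \<Omega> \<Longrightarrow> y \<in> \<Omega> \<Longrightarrow> \<psi> x - \<psi> y \<le> \<Lambda>" "\<Lambda> \<ge> 0"
    and \<rho>: "\<rho> > 0" and cb: "cball x (2 * \<rho>) \<subseteq> \<Omega>"
  defines "s \<equiv> \<rho> * exp (- \<Lambda> / 2) / 4"
  shows "(1 / s)-lipschitz_on (ball x (s / 2)) \<psi>"
proof -
  have s0: "s > 0" using \<rho> by (simp add: s_def)
  have "\<rho> * exp (- \<Lambda> / 2) \<le> \<rho> * 1" using \<rho> osc(2) by (intro mult_left_mono) auto
  then have s\<rho>: "4 * s \<le> \<rho>" by (simp add: s_def)
  have main: "\<psi> y - \<psi> y' \<le> norm (y - y') / s" if y: "y \<in> ball x (s / 2)" "y' \<in> ball x (s / 2)" for y y'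
  proof (cases "y = y'")
    case False
    define d where "d = norm (y - y')"
    define e where "e = (y - y') /\<^sub>R d"
    define c where "c = y' - s *\<^sub>R e"
    have d: "d > 0" using False by (simp add: d_def)
    have e: "norm e = 1" using d by (simp add: e_def d_def)
    have "dist y y' \<le> dist x y + dist x y'" by (rule dist_triangle3)
    \<comment> \<open>Thus the far radius \<open>s + d\<close> is below \<open>2 * s\<close>, half
      of the bound that \<open>psi_ray_estimate\<close> allows; this accounts for the 4 in
      \<open>s\<close>, together with the room left for balls of radius
      \<open>\<rho>\<close>.\<close>
    then have ds: "d < s" using y by (simp add: d_def dist_norm)
    have cc: "c + s *\<^sub>R e = y'" "c + (s + d) *\<^sub>R e = y" using d by (auto simp: c_def e_def algebra_simps)
    have "cball c \<rho> \<subseteq> cball x (2 * \<rho>)"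
    proof
      fix z assume z: "z \<in> cball c \<rho>"
      have "dist x c \<le> dist x y' + dist y' c" by (rule dist_triangle)
      also have "dist y' c = s" using e s0 by (simp add: c_def dist_norm)
      finally have "dist x c \<le> 2 * s" using y s0 by simp
      then show "z \<in> cball x (2 * \<rho>)" using z dist_triangle[of x z c] s\<rho> s0 by auto
    qed
    then have "cball c \<rho> \<subseteq> \<Omega>" using cb by blast
    from psi_ray_estimate[OF st c\<psi> sup sub osc this e s0, of "s + d"]
    have "\<psi> y - \<psi> y' \<le> ln ((s + d) / s)" using d ds cc s0 by (simp add: s_def)
    also have "\<dots> \<le> d / s" using ln_add_one_self_le_self[of "d / s"] d s0 by (simp add: add_divide_distrib)
    finally show ?thesis by (simp add: d_def)
  qed simp
  show ?thesis
  proof (rule lipschitz_onI)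
    fix y y' assume "y \<in> ball x (s / 2)" "y' \<in> ball x (s / 2)"
    then show "dist (\<psi> y) (\<psi> y') \<le> 1 / s * dist y y'"
      using main[of y y'] main[of y' y] by (auto simp: dist_norm abs_le_iff norm_minus_commute)
  qed (use s0 in simp)
qed

text \<open>Rademacher's theorem is stated for functions on the whole space. Composing with the
  nearest point projection onto a smaller closed ball extends \<open>\<psi>\<close> without
  increasing its Lipschitz constant.\<close>

lemma lipschitz_ball_ae_differentiable:
  fixes \<psi> :: "real^'n \<Rightarrow> real"
  assumes L: "L-lipschitz_on (ball x t) \<psi>" and t: "t > 0"
  shows "negligible {y \<in> ball x (t/2). \<not> (\<exists>p. (\<psi> has_derivative (\<lambda>h. p \<bullet> h)) (at y) \<and> norm p \<le> L)}"
proof -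
  define B where "B = cball x (t/2)"
  define F where "F = (\<lambda>y. \<psi> (closest_point B y))"
  have B: "convex B" "closed B" "B \<noteq> {}" "B \<subseteq> ball x t" using t by (auto simp: B_def)
  have "L-lipschitz_on UNIV F"
  proof (rule lipschitz_onI)
    fix y y'
    have "closest_point B y \<in> ball x t" "closest_point B y' \<in> ball x t"
      using closest_point_in_set[OF B(2,3)] B(4) by blast+
    then have "dist (F y) (F y') \<le> L * dist (closest_point B y) (closest_point B y')" unfolding F_def by (rule lipschitz_onD[OF L])
    also have "\<dots> \<le> L * dist y y'" using lipschitz_on_nonneg[OF L] closest_point_lipschitz[OF B(1-3)] by (intro mult_left_mono) auto
    finally show "dist (F y) (F y') \<le> L * dist y y'" .
  qed (rule lipschitz_on_nonneg[OF L])
  then have "negligible {y. \<not> (\<exists>g. (F has_derivative (\<lambda>h. g \<bullet> h)) (at y))}" by (rule rademacher)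
  moreover have "\<exists>p. (\<psi> has_derivative (\<lambda>h. p \<bullet> h)) (at y) \<and> norm p \<le> L"
    if y: "y \<in> ball x (t/2)" and g: "(F has_derivative (\<lambda>h. g \<bullet> h)) (at y)" for y g
  proof -
    have "(\<psi> has_derivative (\<lambda>h. g \<bullet> h)) (at y)"
    proof (rule has_derivative_transform_within_open[OF g open_ball y])
      fix z assume "z \<in> ball x (t/2)"
      then have "z \<in> B" by (auto simp: B_def)
      then show "F z = \<psi> z" by (simp add: F_def closest_point_self)
    qed
    moreover have "norm g \<le> L"
    proof (rule field_le_epsilon)
      fix \<epsilon> :: real assume \<epsilon>: "\<epsilon> > 0"
      show "norm g \<le> L + \<epsilon>"
      proof (cases "g = 0")
        case False
        obtain d where d: "d > 0" "\<And>z. norm (z - y) < d \<Longrightarrow> norm (F z - F y - g \<bullet> (z - y)) \<le> \<epsilon> * norm (z - y)"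
          using g \<epsilon> unfolding has_derivative_at_alt by blast
        \<comment> \<open>A small step in the direction of the gradient itself shows that the
          gradient is no longer than the Lipschitz constant.\<close>
        define k where "k = d / (2 * norm g)"
        have k: "k > 0" "k * norm g < d" using d False by (auto simp: k_def)
        have "\<bar>F (y + k *\<^sub>R g) - F y\<bar> \<le> L * (k * norm g)"
          using lipschitz_onD[OF \<open>L-lipschitz_on UNIV F\<close>, of "y + k *\<^sub>R g" y] k by (simp add: dist_norm)
        moreover have "\<bar>F (y + k *\<^sub>R g) - F y - k * (norm g * norm g)\<bar> \<le> \<epsilon> * (k * norm g)"
          using d(2)[of "y + k *\<^sub>R g"] k by (simp add: dot_square_norm power2_eq_square)
        ultimately have "k * (norm g * norm g) \<le> L * (k * norm g) + \<epsilon> * (k * norm g)" by linarith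
        then have "(k * norm g) * norm g \<le> (k * norm g) * (L + \<epsilon>)" by (simp add: algebra_simps)
        then show ?thesis using k False by simp
      qed (use \<epsilon> lipschitz_on_nonneg[OF L] in auto)
    qed
    ultimately show ?thesis by blast
  qed
  ultimately show ?thesis by (rule_tac negligible_subset) blast+
qed

section \<open>Back from \<open>\<psi>\<close> to the solution \<open>u\<close>\<close>

context
  fixes \<Omega> :: "(real^'n) set" and f \<Gamma> u a b \<kappa> \<psi>
  assumes n: "CARD('n) \<ge> 3" and O: "open \<Omega>" and st: "structural f \<Gamma>" and v: "visc_solution f \<Gamma> \<Omega> u"
    and a: "0 < a" and ab: "\<And>x. x \<in> \<Omega> \<Longrightarrow> a \<le> u x \<and> u x \<le> b"
  defines "\<kappa> \<equiv> (real CARD('n) - 2) / 2" and "\<psi> \<equiv> \<lambda>x. - ln (u x) / \<kappa>"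
begin

lemma kappa_pos: "\<kappa> > 0" using n by (simp add: \<kappa>_def)

lemma u_eq_exp: "x \<in> \<Omega> \<Longrightarrow> u x = exp (- \<kappa> * \<psi> x)"
  using kappa_pos ab[of x] a by (simp add: \<psi>_def)

text \<open>The bounds on \<open>u\<close> limit the oscillation of \<open>\<psi>\<close> to
  \<open>ln (b / a) / \<kappa>\<close>; the radius and the Lipschitz constant depend on the solution
  through \<open>b / a\<close> only.\<close>

lemma solution_psi_lipschitz:
  assumes \<rho>: "\<rho> > 0" and cb: "cball x (2 * \<rho>) \<subseteq> \<Omega>"
  defines "s \<equiv> \<rho> * exp (- (ln (b / a) / \<kappa>) / 2) / 4"
  shows "(1 / s)-lipschitz_on (ball x (s / 2)) \<psi>" "ball x (s / 2) \<subseteq> \<Omega>" "s > 0"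
proof -
  have up: "u x > 0" if "x \<in> \<Omega>" for x using ab[OF that] a by linarith
  have xO: "x \<in> \<Omega>" using cb \<rho> by auto
  have ba: "b \<ge> a" "b > 0" using ab[OF xO] a by auto
  have L0: "ln (b / a) / \<kappa> \<ge> 0" using ba a kappa_pos by simp
  have cu: "continuous_on \<Omega> u" using v by (simp add: visc_solution_def)
  show "(1 / s)-lipschitz_on (ball x (s / 2)) \<psi>" unfolding s_def
  proof (rule psi_lipschitz[OF st])
    show "continuous_on \<Omega> \<psi>" unfolding \<psi>_def using cu up kappa_pos by (intro continuous_intros) (auto dest: up)
    show "psi_super f \<Gamma> \<Omega> \<psi>" "psi_sub f \<Gamma> \<Omega> \<psi>"
      unfolding \<psi>_def \<kappa>_def using psi_of_visc[OF n O up] v by (auto simp: visc_solution_def)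
    fix y z assume yz: "y \<in> \<Omega>" "z \<in> \<Omega>"
    have "ln a \<le> ln (u y)" "ln (u z) \<le> ln b" using ab[OF yz(1)] ab[OF yz(2)] a ba up[OF yz(2)] by auto
    then have "(ln (u z) - ln (u y)) / \<kappa> \<le> (ln b - ln a) / \<kappa>" using kappa_pos by (intro divide_right_mono) auto
    then show "\<psi> y - \<psi> z \<le> ln (b / a) / \<kappa>" using a ba by (simp add: \<psi>_def ln_div diff_divide_distrib)
  qed (use L0 \<rho> cb in auto)
  show s0: "s > 0" using \<rho> by (simp add: s_def)
  have "\<rho> * exp (- (ln (b / a) / \<kappa>) / 2) \<le> \<rho> * 1" using \<rho> L0 by (intro mult_left_mono) auto
  then have "4 * s \<le> \<rho>" by (simp add: s_def)
  then show "ball x (s / 2) \<subseteq> \<Omega>" using cb s0 \<rho> by (auto simp: subset_iff)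
qed

lemma solution_locally_lipschitz: "locally_lipschitz_in \<Omega> u"
  unfolding locally_lipschitz_in_def
proof
  fix x assume x: "x \<in> \<Omega>"
  obtain \<rho>' where \<rho>': "\<rho>' > 0" "cball x \<rho>' \<subseteq> \<Omega>" using O x open_contains_cball by blast
  define \<rho> where "\<rho> = \<rho>' / 2"
  have \<rho>: "\<rho> > 0" "cball x (2 * \<rho>) \<subseteq> \<Omega>" using \<rho>' by (auto simp: \<rho>_def)
  define s where "s = \<rho> * exp (- (ln (b / a) / \<kappa>) / 2) / 4"
  note s = solution_psi_lipschitz[OF \<rho>, folded s_def]
  have b0: "b > 0" using ab[OF x] a by linarith
  \<comment> \<open>The exponential has Lipschitz constant \<open>b\<close> where its values are at
    most \<open>b\<close>.\<close>
  have ineq: "exp p - exp q \<le> b * \<bar>p - q\<bar>" if "exp p \<le> b" for p q :: real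
  proof -
    have "exp p - exp q = exp p * (1 - exp (q - p))" by (simp add: exp_diff algebra_simps)
    also have "\<dots> \<le> exp p * \<bar>p - q\<bar>"
    proof (rule mult_left_mono)
      show "1 - exp (q - p) \<le> \<bar>p - q\<bar>" using exp_ge_add_one_self[of "q - p"] by linarith
    qed simp
    also have "\<dots> \<le> b * \<bar>p - q\<bar>" using that by (intro mult_right_mono) auto
    finally show ?thesis .
  qed
  have "(b * (\<kappa> * (1 / s)))-lipschitz_on (ball x (s / 2) \<inter> \<Omega>) u"
  proof (rule lipschitz_onI)
    fix y z assume yz: "y \<in> ball x (s / 2) \<inter> \<Omega>" "z \<in> ball x (s / 2) \<inter> \<Omega>"
    have uyz: "u y = exp (- \<kappa> * \<psi> y)" "u z = exp (- \<kappa> * \<psi> z)" using u_eq_exp yz by auto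
    have "\<bar>u y - u z\<bar> \<le> b * \<bar>- \<kappa> * \<psi> y - - \<kappa> * \<psi> z\<bar>"
      using ineq[of "- \<kappa> * \<psi> y" "- \<kappa> * \<psi> z"] ineq[of "- \<kappa> * \<psi> z" "- \<kappa> * \<psi> y"] ab[of y] ab[of z] yz uyz
      by (auto simp: abs_le_iff abs_minus_commute)
    also have "\<bar>- \<kappa> * \<psi> y - - \<kappa> * \<psi> z\<bar> = \<kappa> * \<bar>\<psi> y - \<psi> z\<bar>"
    proof -
      have "- \<kappa> * \<psi> y - - \<kappa> * \<psi> z = - (\<kappa> * (\<psi> y - \<psi> z))" by (simp add: algebra_simps)
      then show ?thesis using kappa_pos by (simp add: abs_mult)
    qed
    also have "b * (\<kappa> * \<bar>\<psi> y - \<psi> z\<bar>) \<le> b * (\<kappa> * (1 / s * dist y z))"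
      using lipschitz_onD[OF s(1), of y z] yz b0 kappa_pos by (intro mult_left_mono) (auto simp: dist_real_def)
    finally show "dist (u y) (u z) \<le> b * (\<kappa> * (1 / s)) * dist y z" by (simp add: dist_real_def)
  qed (use b0 kappa_pos s in auto)
  then show "\<exists>r>0. \<exists>L. L-lipschitz_on (ball x r \<inter> \<Omega>) u" using s(3) by (intro exI[of _ "s / 2"]) auto
qed

text \<open>Where \<open>\<psi>\<close> is differentiable, the chain rule gives the length of the
  gradient of \<open>u\<close>, divided by \<open>u\<close>, as \<open>\<kappa>\<close> times that
  of the gradient of \<open>\<psi>\<close>.\<close>

lemma solution_gradient_bound:
  assumes \<rho>: "\<rho> > 0" and cb: "cball x (2 * \<rho>) \<subseteq> \<Omega>"
  defines "s \<equiv> \<rho> * exp (- (ln (b / a) / \<kappa>) / 2) / 4"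
  shows "negligible {y \<in> ball x (s / 4). \<not> (\<exists>g. (u has_derivative (\<lambda>h. g \<bullet> h)) (at y) \<and> norm g / u y \<le> \<kappa> / s)}"
proof -
  note s = solution_psi_lipschitz[OF \<rho> cb, folded s_def]
  have neg: "negligible {y \<in> ball x (s / 4). \<not> (\<exists>p. (\<psi> has_derivative (\<lambda>h. p \<bullet> h)) (at y) \<and> norm p \<le> 1 / s)}"
    using lipschitz_ball_ae_differentiable[OF s(1)] s(3) by simp
  moreover have "\<exists>g. (u has_derivative (\<lambda>h. g \<bullet> h)) (at y) \<and> norm g / u y \<le> \<kappa> / s"
    if y: "y \<in> ball x (s / 4)" and p: "(\<psi> has_derivative (\<lambda>h. p \<bullet> h)) (at y)" "norm p \<le> 1 / s" for y p
  proof -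
    have yO: "y \<in> \<Omega>" using y s by auto
    have uy: "u y > 0" using ab[OF yO] a by linarith
    have "((\<lambda>y. exp (- \<kappa> * \<psi> y)) has_derivative (\<lambda>h. ((- \<kappa> * exp (- \<kappa> * \<psi> y)) *\<^sub>R p) \<bullet> h)) (at y)"
      by (rule has_derivative_eq_rhs[OF has_derivative_exp[OF has_derivative_mult_right[OF p(1)]]]) (simp add: algebra_simps)
    then have "(u has_derivative (\<lambda>h. ((- \<kappa> * u y) *\<^sub>R p) \<bullet> h)) (at y)"
      unfolding u_eq_exp[OF yO, symmetric]
      by (rule has_derivative_transform_within_open[OF _ O yO]) (simp add: u_eq_exp)
    moreover have "norm ((- \<kappa> * u y) *\<^sub>R p) / u y \<le> \<kappa> / s"
      using p(2) uy kappa_pos mult_left_mono[of "norm p" "1 / s" \<kappa>] by (simp add: abs_mult)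
    ultimately show ?thesis by blast
  qed
  ultimately show ?thesis by (rule_tac negligible_subset) blast+
qed

end

theorem theorem3p5:
  fixes \<Omega> :: "(real^'n) set"
  assumes dim: "CARD('n) \<ge> 3"
    and dom: "open \<Omega>" "connected \<Omega>"
  shows "(\<forall>f \<Gamma> u a b. structural f \<Gamma> \<and> visc_solution f \<Gamma> \<Omega> u
            \<and> 0 < a \<and> (\<forall>x\<in>\<Omega>. a \<le> u x \<and> u x \<le> b)
          \<longrightarrow> locally_lipschitz_in \<Omega> u)
       \<and> (\<forall>\<Omega>'. compact (closure \<Omega>') \<and> closure \<Omega>' \<subseteq> \<Omega> \<longrightarrow>
            (\<exists>C :: real \<Rightarrow> real. \<forall>f \<Gamma> u a b. structural f \<Gamma> \<and> visc_solution f \<Gamma> \<Omega> u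
               \<and> 0 < a \<and> (\<forall>x\<in>\<Omega>. a \<le> u x \<and> u x \<le> b) \<longrightarrow>
               (AE x in lebesgue. x \<in> \<Omega>' \<longrightarrow>
                  (\<exists>g. (u has_derivative (\<lambda>h. g \<bullet> h)) (at x) \<and> norm g / u x \<le> C (b / a)))))"
proof (intro conjI allI impI; (elim conjE)?)
  fix f \<Gamma> u a b
  assume "structural f \<Gamma>" "visc_solution f \<Gamma> \<Omega> u" "0 < (a::real)" "\<forall>x\<in>\<Omega>. a \<le> u x \<and> u x \<le> b"
  then show "locally_lipschitz_in \<Omega> u" using solution_locally_lipschitz[OF dim dom(1)] by blast
next
  fix \<Omega>' assume cl: "compact (closure \<Omega>')" "closure \<Omega>' \<subseteq> \<Omega>"
  \<comment> \<open>One radius serves all points of the compact closure, which makes the constant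
    uniform.\<close>
  obtain e where e: "e > 0" "(\<Union>x\<in>closure \<Omega>'. cball x e) \<subseteq> \<Omega>"
    using compact_subset_open_imp_cball_epsilon_subset[OF cl(1) dom(1) cl(2)] by blast
  define \<rho> where "\<rho> = e / 2"
  define \<kappa> where "\<kappa> = (real CARD('n) - 2) / 2"
  \<comment> \<open>A function of the quotient \<open>b / a\<close> alone, fixed before
    \<open>f\<close>, \<open>\<Gamma>\<close> and \<open>u\<close> are introduced, as the order of
    the quantifiers demands.\<close>
  define s where "s = (\<lambda>q. \<rho> * exp (- (ln q / \<kappa>) / 2) / 4)"
  have \<rho>: "\<rho> > 0" "\<And>x. x \<in> closure \<Omega>' \<Longrightarrow> cball x (2 * \<rho>) \<subseteq> \<Omega>" using e by (auto simp: \<rho>_def)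
  show "\<exists>C :: real \<Rightarrow> real. \<forall>f \<Gamma> u a b. structural f \<Gamma> \<and> visc_solution f \<Gamma> \<Omega> u
               \<and> 0 < a \<and> (\<forall>x\<in>\<Omega>. a \<le> u x \<and> u x \<le> b) \<longrightarrow>
               (AE x in lebesgue. x \<in> \<Omega>' \<longrightarrow>
                  (\<exists>g. (u has_derivative (\<lambda>h. g \<bullet> h)) (at x) \<and> norm g / u x \<le> C (b / a)))"
  proof (intro exI[of _ "\<lambda>q. \<kappa> / s q"] allI impI; elim conjE)
    fix f \<Gamma> u a b
    assume h: "structural f \<Gamma>" "visc_solution f \<Gamma> \<Omega> u" "0 < (a::real)" "\<forall>x\<in>\<Omega>. a \<le> u x \<and> u x \<le> b"
    define t where "t = s (b / a)"
    have t: "t > 0" using \<rho> by (simp add: t_def s_def)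
    define N where "N = (\<lambda>x. {y \<in> ball x (t / 4). \<not> (\<exists>g. (u has_derivative (\<lambda>h. g \<bullet> h)) (at y) \<and> norm g / u y \<le> \<kappa> / t)})"
    have neg: "negligible (N x)" if "x \<in> closure \<Omega>'" for x
      using solution_gradient_bound[OF dim dom(1) h(1,2,3) _ \<rho>(1) \<rho>(2)[OF that]] h(4)
      unfolding N_def t_def s_def \<kappa>_def by blast
    \<comment> \<open>The gradient bound holds off a null set in each small ball; finitely many such
      balls cover the closure.\<close>
    have "closure \<Omega>' \<subseteq> (\<Union>x\<in>closure \<Omega>'. ball x (t / 4))" using t by auto
    then obtain K where K: "K \<subseteq> closure \<Omega>'" "finite K" "closure \<Omega>' \<subseteq> (\<Union>x\<in>K. ball x (t / 4))"
      using compactE_image[OF cl(1), of "closure \<Omega>'" "\<lambda>x. ball x (t / 4)"] by auto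
    have "negligible (\<Union>x\<in>K. N x)" using K neg by (intro negligible_Union) auto
    then have "(\<Union>x\<in>K. N x) \<in> null_sets lebesgue" by (simp add: negligible_iff_null_sets)
    then show "AE x in lebesgue. x \<in> \<Omega>' \<longrightarrow> (\<exists>g. (u has_derivative (\<lambda>h. g \<bullet> h)) (at x) \<and> norm g / u x \<le> \<kappa> / s (b / a))"
    proof (rule AE_I')
      have "x \<in> (\<Union>x\<in>K. N x)" if "x \<in> \<Omega>'" "\<not> (\<exists>g. (u has_derivative (\<lambda>h. g \<bullet> h)) (at x) \<and> norm g / u x \<le> \<kappa> / t)" for x
        using that K(3) closure_subset[of \<Omega>'] unfolding N_def by blast
      then show "{x \<in> space lebesgue. \<not> (x \<in> \<Omega>' \<longrightarrow> (\<exists>g. (u has_derivative (\<lambda>h. g \<bullet> h)) (at x) \<and> norm g / u x \<le> \<kappa> / s (b / a)))} \<subseteq> (\<Union>x\<in>K. N x)"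
        unfolding t_def by blast
    qed
  qed
qed

end
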